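(* Let $T$ be a paracompact space and $\xi_i=(\mathcal{E}_i,p_i,T)$, $i=1,2$, Banach bundles. Let $\varphi$ be a Banach bundle map from $\xi_1$ to $\xi_2$ with $\varphi(\mathcal{E}_1)=\mathcal{E}_2$ and $\sup_{t\in T}\|\varphi_t\|<\infty$. Then $\tilde{\varphi}(\Gamma_b(\xi_1))=\Gamma_b(\xi_2)$ if and only if there is a positive number $m$ with the property that for each $y\in\mathcal{E}_2$ there exists $x\in\mathcal{E}_1$ such that $\varphi(x)=y$ and $\|x\|\leq m\|y\|$.
   Context: $\mathbb{K}$ is the real or the complex field. A Banach bundle $\xi=(\mathcal{E},p,T)$ consists of a Hausdorff space $T$ (base space), a topological space $\mathcal{E}$ (bundle space, not assumed Hausdorff), and a continuous open surjection $p:\mathcal{E}\to T$ such that each fiber $\mathcal{E}(t)=p^{-1}(t)$ is a Banach space over $\mathbb{K}$ with origin $0_t$, and: addition $\{(x,y)\in\mathcal{E}\times\mathcal{E}: p(x)=p(y)\}\to\mathcal{E}$ and scalar multiplication $\mathbb{K}\times\mathcal{E}\to\mathcal{E}$ are continuous; $x\mapsto\|x\|$ is upper semi-continuous on $\mathcal{E}$; and if $(x_\iota)$ is a net in $\mathcal{E}$ with $p(x_\iota)\to t$ and $\|x_\iota\|\to 0$, then $x_\iota\to 0_t$. Paracompact spaces are assumed Hausdorff. A section of $\xi$ is a continuous $f:T\to\mathcal{E}$ with $p(f(t))=t$ for all $t\in T$; $\Gamma_b(\xi)$ is the Banach space of bounded sections with norm $\|f\|=\sup_{t\in T}\|f(t)\|$.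 A Banach bundle map from $\xi_1$ to $\xi_2$ is a continuous map $\varphi:\mathcal{E}_1\to\mathcal{E}_2$ with $\varphi(p_1^{-1}(t))\subset p_2^{-1}(t)$ for every $t\in T$ whose restriction to each fiber is linear; $\varphi_t:\mathcal{E}_1(t)\to\mathcal{E}_2(t)$ denotes its restriction to the fiber over $t$, a bounded linear operator with operator norm $\|\varphi_t\|$. For a section $f$ of $\xi_1$, $\tilde\varphi(f)$ is the section $t\mapsto\varphi(f(t))$ of $\xi_2$. *)

theory Defs
  imports "HOL-Analysis.Analysis"
begin

definition paracompact_Hausdorff_space :: "'a topology \<Rightarrow> bool" where
  "paracompact_Hausdorff_space X \<longleftrightarrow>
     Hausdorff_space X \<and>
     (\<forall>\<U>. (\<forall>U\<in>\<U>. openin X U) \<and> \<Union>\<U> = topspace X \<longrightarrow>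
        (\<exists>\<V>. (\<forall>V\<in>\<V>. openin X V) \<and> \<Union>\<V> = topspace X \<and>
             (\<forall>V\<in>\<V>. \<exists>U\<in>\<U>. V \<subseteq> U) \<and> locally_finite_in X \<V>))"

text \<open>
  Scalars: the type \<open>'k\<close> is of class \<^class>\<open>real_normed_field\<close>. The norm of that class is
  multiplicative, so by the Gelfand-Mazur theorem every such field is isometrically isomorphic
  to the real or the complex field; both \<^typ>\<open>real\<close> and \<^typ>\<open>complex\<close> are instances.

  The fibers of a bundle are subsets of one type, so Banach spaces are given on a carrier.
\<close>

locale banach_space_on =
  fixes V :: "'v set"
    and add :: "'v \<Rightarrow> 'v \<Rightarrow> 'v"
    and scale :: "'k::real_normed_field \<Rightarrow> 'v \<Rightarrow> 'v"
    and zero :: 'v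
    and nrm :: "'v \<Rightarrow> real"
  assumes zero_closed: "zero \<in> V"
    and add_closed: "\<lbrakk>x \<in> V; y \<in> V\<rbrakk> \<Longrightarrow> add x y \<in> V"
    and scale_closed: "x \<in> V \<Longrightarrow> scale c x \<in> V"
    and add_assoc: "\<lbrakk>x \<in> V; y \<in> V; z \<in> V\<rbrakk> \<Longrightarrow> add (add x y) z = add x (add y z)"
    and add_commute: "\<lbrakk>x \<in> V; y \<in> V\<rbrakk> \<Longrightarrow> add x y = add y x"
    and add_zero: "x \<in> V \<Longrightarrow> add x zero = x"
    and add_inverse: "x \<in> V \<Longrightarrow> \<exists>y\<in>V. add x y = zero"
    and scale_add_right: "\<lbrakk>x \<in> V; y \<in> V\<rbrakk> \<Longrightarrow> scale c (add x y) = add (scale c x) (scale c y)"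
    and scale_add_left: "x \<in> V \<Longrightarrow> scale (c + d) x = add (scale c x) (scale d x)"
    and scale_scale: "x \<in> V \<Longrightarrow> scale c (scale d x) = scale (c * d) x"
    and scale_one: "x \<in> V \<Longrightarrow> scale 1 x = x"
    and norm_nonneg: "x \<in> V \<Longrightarrow> 0 \<le> nrm x"
    and norm_eq_zero: "x \<in> V \<Longrightarrow> nrm x = 0 \<longleftrightarrow> x = zero"
    and norm_scale: "x \<in> V \<Longrightarrow> nrm (scale c x) = norm c * nrm x"
    and norm_triangle: "\<lbrakk>x \<in> V; y \<in> V\<rbrakk> \<Longrightarrow> nrm (add x y) \<le> nrm x + nrm y"
    and complete: "\<lbrakk>range \<sigma> \<subseteq> V;
        \<And>e. e > 0 \<Longrightarrow> \<exists>N. \<forall>i\<ge>N. \<forall>j\<ge>N. nrm (add (\<sigma> i) (scale (-1) (\<sigma> j))) < e\<rbrakk>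
        \<Longrightarrow> \<exists>l\<in>V. (\<lambda>n. nrm (add (\<sigma> n) (scale (-1) l))) \<longlonglongrightarrow> 0"

text \<open>
  The base space is kept outside the record, as bundles are compared over a common base.
  \<open>badd\<close> is meaningful only for two points of the same fiber.
\<close>

record ('k, 'e, 't) bundle_data =
  btotal :: "'e topology"
  bproj :: "'e \<Rightarrow> 't"
  badd :: "'e \<Rightarrow> 'e \<Rightarrow> 'e"
  bscale :: "'k \<Rightarrow> 'e \<Rightarrow> 'e"
  bzero :: "'t \<Rightarrow> 'e"
  bnorm :: "'e \<Rightarrow> real"

definition fiber :: "('k, 'e, 't) bundle_data \<Rightarrow> 't \<Rightarrow> 'e set" where
  "fiber \<xi> t = {x \<in> topspace (btotal \<xi>). bproj \<xi> x = t}"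

text \<open>
  In \<open>net_to_zero\<close> a net in the bundle space is represented by its filter of eventuality, a filter
  containing the whole bundle space; every such filter arises from a net.
\<close>

locale banach_bundle =
  fixes T :: "'t topology" and \<xi> :: "('k::real_normed_field, 'e, 't) bundle_data"
  assumes Hausdorff_base: "Hausdorff_space T"
    and proj_continuous: "continuous_map (btotal \<xi>) T (bproj \<xi>)"
    and proj_open: "open_map (btotal \<xi>) T (bproj \<xi>)"
    and proj_surj: "bproj \<xi> ` topspace (btotal \<xi>) = topspace T"
    and fiber_banach: "t \<in> topspace T \<Longrightarrow>
          banach_space_on (fiber \<xi> t) (badd \<xi>) (bscale \<xi>) (bzero \<xi> t) (bnorm \<xi>)"
    and add_continuous:
          "continuous_map
             (subtopology (prod_topology (btotal \<xi>) (btotal \<xi>)) {(x, y). bproj \<xi> x = bproj \<xi> y})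
             (btotal \<xi>) (\<lambda>(x, y). badd \<xi> x y)"
    and scale_continuous:
          "continuous_map (prod_topology euclidean (btotal \<xi>)) (btotal \<xi>) (\<lambda>(c, x). bscale \<xi> c x)"
    and norm_upper_semicontinuous:
          "openin (btotal \<xi>) {x \<in> topspace (btotal \<xi>). bnorm \<xi> x < a}"
    and net_to_zero:
          "\<lbrakk>F \<le> principal (topspace (btotal \<xi>)); limitin T (bproj \<xi>) t F; (bnorm \<xi> \<longlongrightarrow> 0) F\<rbrakk>
           \<Longrightarrow> limitin (btotal \<xi>) (\<lambda>x. x) (bzero \<xi> t) F"

text \<open>
  Functions on the base space are taken \<^const>\<open>extensional\<close>, so that equality of sections is
  agreement on the base space.
\<close>

definition bundle_sections :: "'t topology \<Rightarrow> ('k, 'e, 't) bundle_data \<Rightarrow> ('t \<Rightarrow> 'e) set" where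
  "bundle_sections T \<xi> =
     {f \<in> extensional (topspace T).
        continuous_map T (btotal \<xi>) f \<and> (\<forall>t\<in>topspace T. bproj \<xi> (f t) = t)}"

definition bounded_sections :: "'t topology \<Rightarrow> ('k, 'e, 't) bundle_data \<Rightarrow> ('t \<Rightarrow> 'e) set" where
  "bounded_sections T \<xi> =
     {f \<in> bundle_sections T \<xi>. bdd_above ((\<lambda>t. bnorm \<xi> (f t)) ` topspace T)}"

locale banach_bundle_map =
  fixes T :: "'t topology"
    and \<xi>\<^sub>1 :: "('k::real_normed_field, 'e1, 't) bundle_data"
    and \<xi>\<^sub>2 :: "('k, 'e2, 't) bundle_data"
    and \<phi> :: "'e1 \<Rightarrow> 'e2"
  assumes map_continuous: "continuous_map (btotal \<xi>\<^sub>1) (btotal \<xi>\<^sub>2) \<phi>"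
    and map_fiber: "t \<in> topspace T \<Longrightarrow> \<phi> ` fiber \<xi>\<^sub>1 t \<subseteq> fiber \<xi>\<^sub>2 t"
    and map_add: "\<lbrakk>t \<in> topspace T; x \<in> fiber \<xi>\<^sub>1 t; y \<in> fiber \<xi>\<^sub>1 t\<rbrakk>
          \<Longrightarrow> \<phi> (badd \<xi>\<^sub>1 x y) = badd \<xi>\<^sub>2 (\<phi> x) (\<phi> y)"
    and map_scale: "\<lbrakk>t \<in> topspace T; x \<in> fiber \<xi>\<^sub>1 t\<rbrakk>
          \<Longrightarrow> \<phi> (bscale \<xi>\<^sub>1 c x) = bscale \<xi>\<^sub>2 c (\<phi> x)"

text \<open>
  The operator norm on a fiber, as an extended real: \<open>\<infinity>\<close> means that the operator is unbounded.
\<close>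

definition fiber_onorm ::
  "('k, 'e1, 't) bundle_data \<Rightarrow> ('k, 'e2, 't) bundle_data \<Rightarrow> ('e1 \<Rightarrow> 'e2) \<Rightarrow> 't \<Rightarrow> ennreal" where
  "fiber_onorm \<xi>\<^sub>1 \<xi>\<^sub>2 \<phi> t = (SUP x\<in>{x \<in> fiber \<xi>\<^sub>1 t. bnorm \<xi>\<^sub>1 x \<le> 1}. ennreal (bnorm \<xi>\<^sub>2 (\<phi> x)))"

definition induced_section_map :: "'t topology \<Rightarrow> ('e1 \<Rightarrow> 'e2) \<Rightarrow> ('t \<Rightarrow> 'e1) \<Rightarrow> 't \<Rightarrow> 'e2" where
  "induced_section_map T \<phi> f = restrict (\<lambda>t. \<phi> (f t)) (topspace T)"

end

theory Submission
  imports Defs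
begin

text \<open>
  Both directions use a selection theorem for Banach bundles over a paracompact base: a lower
  semicontinuous field \<open>\<Phi>\<close> of nonempty convex sets \<open>\<Phi>(t) \<subseteq> E(t)\<close> admits a continuous section lying in
  the norm closures of the \<open>\<Phi>(t)\<close>. As no continuous sections are available at the start, one glues
  discontinuous local selections inside norm-thin open sets by partitions of unity; the resulting
  sections are continuous up to an error, and a sequence of them with errors tending to \<open>0\<close> is
  uniformly Cauchy.

  If every \<open>y\<close> has a preimage of norm at most \<open>m \<parallel>y\<parallel>\<close>, then for a bounded section \<open>g\<close> the field
  \<open>\<Phi>(t) = {x. \<phi>(x) = g(t), \<parallel>x\<parallel> < m \<parallel>g\<parallel> + 1}\<close> is lower semicontinuous: given \<open>x \<in> \<Phi>(s)\<close>, a point \<open>u\<close> near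
  \<open>x\<close> in the fiber over \<open>t\<close> is corrected by a small preimage of \<open>g(t) - \<phi>(u)\<close>. A selection is a bounded
  lift of \<open>g\<close>. Conversely, the open mapping theorem for the bounded sections bounds the norm of a lift
  of a section, and it suffices that every point \<open>y \<noteq> 0\<close> lies on a section of norm at most \<open>2 \<parallel>y\<parallel>\<close>;
  this is the selection theorem for \<open>\<Phi>(t) = {x. \<parallel>x\<parallel> < 2 \<parallel>y\<parallel>}\<close> with the value at \<open>p(y)\<close> prescribed.
\<close>

section \<open>Partitions of unity on paracompact spaces\<close>

text \<open>The norm is only upper semicontinuous and the bundle space need not be Hausdorff. The
  open sets at hand are the sublevel sets \<open>bnorm < a\<close>, the tubes around zero vectors
  that the net axiom provides, and what addition and scalar multiplication make of them; closeness
  of points over different base points is never a number. Hence the strict inequalities in the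
  fields \<Phi>: they make the norm constraint an open condition, and the summand 1 and the factor 2
  in the two bounds leave room for it.

  In Michael's usual argument the approximants are continuous and only close to \<Phi>(t). Here the
  roles are exchanged: each approximant lies in \<Phi>(t) exactly, being a convex combination of
  points of \<Phi>(t), and only its continuity is approximate. The limit may leave \<Phi>(t) for its
  norm closure, which does no harm: as \<phi> is bounded on fibers the equation \<phi>(x) = g(t)
  survives, a strict norm bound becomes a weak one, and a prescribed single value stays.\<close>

lemma paracompact_Hausdorff_refinement:
  assumes "paracompact_Hausdorff_space X" "\<And>U. U \<in> \<U> \<Longrightarrow> openin X U" "\<Union>\<U> = topspace X"
  obtains \<V> where "\<And>V. V \<in> \<V> \<Longrightarrow> openin X V" "\<Union>\<V> = topspace X"
    "\<And>V. V \<in> \<V> \<Longrightarrow> \<exists>U\<in>\<U>. V \<subseteq> U" "locally_finite_in X \<V>"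
proof -
  have "(\<forall>U\<in>\<U>. openin X U) \<and> \<Union>\<U> = topspace X"
    using assms(2,3) by blast
  then have "\<exists>\<V>. (\<forall>V\<in>\<V>. openin X V) \<and> \<Union>\<V> = topspace X \<and>
             (\<forall>V\<in>\<V>. \<exists>U\<in>\<U>. V \<subseteq> U) \<and> locally_finite_in X \<V>"
    using assms(1) unfolding paracompact_Hausdorff_space_def by blast
  then obtain \<V> where "(\<forall>V\<in>\<V>. openin X V) \<and> \<Union>\<V> = topspace X \<and>
             (\<forall>V\<in>\<V>. \<exists>U\<in>\<U>. V \<subseteq> U) \<and> locally_finite_in X \<V>" ..
  then show thesis
    by (intro that [of \<V>]) auto
qed

text \<open>The common core of regularity and normality: the closures of a locally finite family
  have a closed union, so separating \<open>A\<close> from each point of \<open>C\<close> suffices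
  to separate it from all of \<open>C\<close>. The cover consists of the complement of
  \<open>C\<close> and the open sets whose closure misses \<open>A\<close>; a member of the
  refinement that meets \<open>C\<close> cannot lie in that complement.\<close>

lemma paracompact_separation:
  assumes X: "paracompact_Hausdorff_space X" and C: "closedin X C" and A: "A \<subseteq> topspace X"
    and sep: "\<And>y. y \<in> C \<Longrightarrow> \<exists>U. openin X U \<and> y \<in> U \<and> disjnt A (X closure_of U)"
  obtains U V where "openin X U" "openin X V" "A \<subseteq> U" "C \<subseteq> V" "disjnt U V"
proof -
  define \<U> where "\<U> = insert (topspace X - C) {U. openin X U \<and> disjnt A (X closure_of U)}"
  have 1: "openin X U" if "U \<in> \<U>" for U
    using that C by (auto simp: \<U>_def)
  have "topspace X \<subseteq> \<Union>\<U>"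
    using sep by (fastforce simp: \<U>_def)
  with 1 have 2: "\<Union>\<U> = topspace X"
    using openin_subset by fastforce
  obtain \<V> where \<V>: "\<And>V. V \<in> \<V> \<Longrightarrow> openin X V" "\<Union>\<V> = topspace X"
    "\<And>V. V \<in> \<V> \<Longrightarrow> \<exists>U\<in>\<U>. V \<subseteq> U" "locally_finite_in X \<V>"
    using paracompact_Hausdorff_refinement [OF X 1 2] by blast
  define \<W> where "\<W> = {V \<in> \<V>. V \<inter> C \<noteq> {}}"
  have lf: "locally_finite_in X \<W>"
    using \<V>(4) locally_finite_in_subset by (force simp: \<W>_def)
  have "disjnt A (X closure_of W)" if W: "W \<in> \<W>" for W
  proof -
    obtain U where "U \<in> \<U>" "W \<subseteq> U"
      using W \<V>(3) [of W] unfolding \<W>_def by blast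
    moreover from this W have "U \<noteq> topspace X - C"
      by (auto simp: \<W>_def)
    ultimately show ?thesis
      using closure_of_mono unfolding \<U>_def disjnt_def by blast
  qed
  then have 3: "A \<subseteq> topspace X - \<Union>((\<lambda>S. X closure_of S) ` \<W>)"
    using A unfolding disjnt_def by blast
  have 4: "closedin X (\<Union>((\<lambda>S. X closure_of S) ` \<W>))"
    by (rule closedin_Union_locally_finite_closure [OF lf])
  have 5: "C \<subseteq> \<Union>\<W>"
    using \<V>(2) closedin_subset [OF C] unfolding \<W>_def by blast
  have "W \<subseteq> X closure_of W" if "W \<in> \<W>" for W
    using that \<V>(1) by (simp add: \<W>_def closure_of_subset openin_subset)
  then have 6: "disjnt (topspace X - \<Union>((\<lambda>S. X closure_of S) ` \<W>)) (\<Union>\<W>)"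
    unfolding disjnt_def by blast
  have 7: "openin X (\<Union>\<W>)"
    using \<V>(1) unfolding \<W>_def by blast
  show thesis
    using that [OF _ 7 3 5 6] 4 by blast
qed

lemma disjnt_closure_of_nbhd:
  assumes "openin X U" "openin X V" "A \<subseteq> U" "disjnt U V"
  shows "disjnt A (X closure_of V)"
proof -
  have "U \<inter> X closure_of V = {}"
    using assms openin_Int_closure_of_eq_empty [of X U V] by (simp add: disjnt_def)
  then show ?thesis
    using assms(3) unfolding disjnt_def by blast
qed

lemma paracompact_Hausdorff_imp_regular:
  assumes X: "paracompact_Hausdorff_space X"
  shows "regular_space X"
  unfolding regular_space_def
proof (intro allI impI)
  fix C a assume Ca: "closedin X C \<and> a \<in> topspace X - C"
  have "\<exists>U. openin X U \<and> y \<in> U \<and> disjnt {a} (X closure_of U)" if y: "y \<in> C" for y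
  proof -
    have "Hausdorff_space X"
      using X by (simp add: paracompact_Hausdorff_space_def)
    moreover have "a \<in> topspace X" "y \<in> topspace X" "a \<noteq> y"
      using y Ca closedin_subset by blast+
    ultimately obtain U V where "openin X U" "openin X V" "a \<in> U" "y \<in> V" "disjnt U V"
      unfolding Hausdorff_space_def by blast
    then show ?thesis
      using disjnt_closure_of_nbhd [of X U V "{a}"] by auto
  qed
  then obtain U V where "openin X U" "openin X V" "{a} \<subseteq> U" "C \<subseteq> V" "disjnt U V"
    using paracompact_separation [OF X, of C "{a}"] Ca by blast
  then show "\<exists>U V. openin X U \<and> openin X V \<and> a \<in> U \<and> C \<subseteq> V \<and> disjnt U V"
    by blast
qed

lemma regular_space_shrink:
  assumes "regular_space X" "openin X U" "a \<in> U"
  obtains V where "openin X V" "a \<in> V" "X closure_of V \<subseteq> U"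
proof -
  have "closedin X (topspace X - U)" "a \<in> topspace X - (topspace X - U)"
    using assms openin_subset by auto
  then obtain V W where "openin X V" "openin X W" "a \<in> V" "topspace X - U \<subseteq> W" "disjnt V W"
    using assms unfolding regular_space_def by meson
  then have "disjnt (topspace X - U) (X closure_of V)"
    using disjnt_closure_of_nbhd [of X W V] disjnt_sym by blast
  then show thesis
    using that \<open>openin X V\<close> \<open>a \<in> V\<close> closure_of_subset_topspace by (fastforce simp: disjnt_def)
qed

text \<open>Regularity separates a closed set from single points, and
  \<open>paracompact_separation\<close> makes this uniform. Normality is what the Urysohn functions
  of the partition of unity rest on.\<close>

lemma paracompact_Hausdorff_imp_normal:
  assumes X: "paracompact_Hausdorff_space X"
  shows "normal_space X"
  unfolding normal_space_def
proof (intro allI impI)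
  fix S C assume SC: "closedin X S \<and> closedin X C \<and> disjnt S C"
  have "\<exists>U. openin X U \<and> y \<in> U \<and> disjnt S (X closure_of U)" if y: "y \<in> C" for y
  proof -
    have "openin X (topspace X - S)"
      using SC by blast
    moreover have "y \<in> topspace X - S"
      using SC y closedin_subset unfolding disjnt_def by blast
    ultimately obtain U where "openin X U" "y \<in> U" "X closure_of U \<subseteq> topspace X - S"
      using regular_space_shrink [OF paracompact_Hausdorff_imp_regular [OF X]] by blast
    then show ?thesis
      unfolding disjnt_def by blast
  qed
  moreover have "S \<subseteq> topspace X" "closedin X C"
    using SC closedin_subset by blast+
  ultimately obtain U V where "openin X U" "openin X V" "S \<subseteq> U" "C \<subseteq> V" "disjnt U V"
    using paracompact_separation [OF X, of C S] by blast
  then show "\<exists>U V. openin X U \<and> openin X V \<and> S \<subseteq> U \<and> C \<subseteq> V \<and> disjnt U V"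
    by blast
qed

text \<open>By regularity the open sets whose closure lies in some member of \<open>\<U>\<close>
  already cover the space; refining this cover in place of \<open>\<U>\<close> controls the
  closures.\<close>

lemma paracompact_closure_refinement:
  assumes X: "paracompact_Hausdorff_space X" and \<U>: "\<And>U. U \<in> \<U> \<Longrightarrow> openin X U" "\<Union>\<U> = topspace X"
  obtains \<V> where "\<And>V. V \<in> \<V> \<Longrightarrow> openin X V" "\<Union>\<V> = topspace X"
    "\<And>V. V \<in> \<V> \<Longrightarrow> \<exists>U\<in>\<U>. X closure_of V \<subseteq> U" "locally_finite_in X \<V>"
proof -
  define \<O> where "\<O> = {V. openin X V \<and> (\<exists>U\<in>\<U>. X closure_of V \<subseteq> U)}"
  have 1: "openin X V" if "V \<in> \<O>" for V
    using that by (simp add: \<O>_def)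
  have "topspace X \<subseteq> \<Union>\<O>"
  proof
    fix x assume "x \<in> topspace X"
    then obtain U where "U \<in> \<U>" "x \<in> U" using \<U>(2) by auto
    moreover obtain V where "openin X V" "x \<in> V" "X closure_of V \<subseteq> U"
      using regular_space_shrink [OF paracompact_Hausdorff_imp_regular [OF X]] \<U>(1) calculation by blast
    ultimately show "x \<in> \<Union>\<O>" by (auto simp: \<O>_def)
  qed
  with 1 have 2: "\<Union>\<O> = topspace X"
    using openin_subset by fastforce
  obtain \<V> where \<V>: "\<And>V. V \<in> \<V> \<Longrightarrow> openin X V" "\<Union>\<V> = topspace X"
    "\<And>V. V \<in> \<V> \<Longrightarrow> \<exists>U\<in>\<O>. V \<subseteq> U" "locally_finite_in X \<V>"
    using paracompact_Hausdorff_refinement [OF X 1 2] by blast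
  have "\<exists>U\<in>\<U>. X closure_of V \<subseteq> U" if V: "V \<in> \<V>" for V
  proof -
    obtain W U where "V \<subseteq> W" "U \<in> \<U>" "X closure_of W \<subseteq> U"
      using \<V>(3) [OF V] unfolding \<O>_def by blast
    then show ?thesis using closure_of_mono by (meson subset_trans)
  qed
  with \<V> show thesis
    by (intro that [of \<V>])
qed

text \<open>Of the finitely many members near \<open>s\<close>, those whose closure misses
  \<open>s\<close> are avoided by shrinking the neighbourhood. Keeping only members with
  \<open>s\<close> in their closure is what later places \<open>s\<close> in the prescribed set
  \<open>N (c i)\<close> of every index that counts near \<open>s\<close>.\<close>

lemma locally_finite_in_nhdsin:
  assumes lf: "locally_finite_in X \<V>" and s: "s \<in> topspace X"
  obtains J where "finite J" "J \<subseteq> \<V>" "\<And>V. V \<in> J \<Longrightarrow> s \<in> X closure_of V"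
    "\<forall>\<^sub>F t in nhdsin X s. \<forall>V\<in>\<V> - J. t \<notin> V"
proof -
  obtain W where W: "openin X W" "s \<in> W" "finite {V \<in> \<V>. V \<inter> W \<noteq> {}}"
    using lf s unfolding locally_finite_in_def by meson
  define J where "J = {V \<in> \<V>. V \<inter> W \<noteq> {} \<and> s \<in> X closure_of V}"
  define K where "K = {V \<in> \<V>. V \<inter> W \<noteq> {} \<and> s \<notin> X closure_of V}"
  have fin: "finite J" "finite K"
    using W(3) by (auto simp: J_def K_def elim: rev_finite_subset)
  have "\<forall>\<^sub>F t in nhdsin X s. t \<notin> V" if "V \<in> K" for V
  proof -
    have "openin X (topspace X - X closure_of V)" "s \<in> topspace X - X closure_of V"
      using that s by (auto simp: K_def)
    moreover have "V \<subseteq> X closure_of V"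
      using that lf by (intro closure_of_subset) (auto simp: K_def locally_finite_in_def)
    ultimately show ?thesis
      unfolding eventually_nhdsin by (intro disjI2 exI[of _ "topspace X - X closure_of V"]) auto
  qed
  then have "\<forall>\<^sub>F t in nhdsin X s. \<forall>V\<in>K. t \<notin> V"
    using fin by (simp add: eventually_ball_finite_distrib)
  moreover have "\<forall>\<^sub>F t in nhdsin X s. t \<in> W"
    using W by (auto simp: eventually_nhdsin)
  ultimately have "\<forall>\<^sub>F t in nhdsin X s. \<forall>V\<in>\<V> - J. t \<notin> V"
    by eventually_elim (auto simp: J_def K_def)
  then show thesis
    using fin(1) by (intro that [of J]) (auto simp: J_def)
qed

lemma continuous_map_real_tendsto_nhdsin:
  assumes "continuous_map X euclideanreal h" "s \<in> topspace X"
  shows "(h \<longlongrightarrow> h s) (nhdsin X s)"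
  unfolding tendsto_def
proof (intro allI impI)
  fix S :: "real set" assume "open S" "h s \<in> S"
  moreover from this have "openin X {x \<in> topspace X. h x \<in> S}"
    using assms by (simp add: openin_continuous_map_preimage)
  ultimately show "\<forall>\<^sub>F x in nhdsin X s. h x \<in> S"
    using assms(2) unfolding eventually_nhdsin by blast
qed

text \<open>Two shrinkings are made. Closures of members of \<open>\<V>\<close> inside the given
  neighbourhoods keep the supports there, so that \<open>s\<close> itself lies in
  \<open>N (c i)\<close> for all indices of \<open>J\<close>; closures of members of
  \<open>\<W>\<close> inside members of \<open>\<V>\<close> give closed sets on which the Urysohn
  functions equal 1.\<close>

lemma paracompact_partition_of_unity:
  assumes X: "paracompact_Hausdorff_space X"
    and N: "\<And>x. x \<in> topspace X \<Longrightarrow> openin X (N x) \<and> x \<in> N x"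
  obtains I :: "'a set set" and c :: "'a set \<Rightarrow> 'a" and h :: "'a set \<Rightarrow> 'a \<Rightarrow> real"
  where "\<And>i. i \<in> I \<Longrightarrow> c i \<in> topspace X" "\<And>i t. h i t \<ge> 0"
    "\<And>i s. \<lbrakk>i \<in> I; s \<in> topspace X\<rbrakk> \<Longrightarrow> (h i \<longlongrightarrow> h i s) (nhdsin X s)"
    "\<And>s. s \<in> topspace X \<Longrightarrow> \<exists>J\<subseteq>I. finite J \<and> (\<forall>i\<in>J. s \<in> N (c i)) \<and>
        (\<forall>\<^sub>F t in nhdsin X s. (\<forall>i\<in>I - J. h i t = 0) \<and> (\<Sum>i\<in>J. h i t) = 1)"
proof -
  have N1: "openin X U" if "U \<in> N ` topspace X" for U
    using N that by blast
  then have N2: "\<Union>(N ` topspace X) = topspace X"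
    using openin_subset [OF N1] N by blast
  obtain \<V> where \<V>: "\<And>V. V \<in> \<V> \<Longrightarrow> openin X V" "\<Union>\<V> = topspace X"
    "\<And>V. V \<in> \<V> \<Longrightarrow> \<exists>U\<in>N ` topspace X. X closure_of V \<subseteq> U" "locally_finite_in X \<V>"
    using paracompact_closure_refinement [OF X N1 N2] by blast
  obtain \<W> where \<W>: "\<And>W. W \<in> \<W> \<Longrightarrow> openin X W" "\<Union>\<W> = topspace X"
    "\<And>W. W \<in> \<W> \<Longrightarrow> \<exists>V\<in>\<V>. X closure_of W \<subseteq> V" "locally_finite_in X \<W>"
    using paracompact_closure_refinement [OF X \<V>(1,2)] by blast
  have "\<forall>V\<in>\<V>. \<exists>x. x \<in> topspace X \<and> X closure_of V \<subseteq> N x"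
    using \<V>(3) by blast
  then obtain c where c: "\<And>V. V \<in> \<V> \<Longrightarrow> c V \<in> topspace X \<and> X closure_of V \<subseteq> N (c V)"
    using bchoice by (metis (no_types, lifting))
  \<comment> \<open>\<open>C V\<close> is closed by local finiteness and lies in \<open>V\<close>.
    The sets \<open>C V\<close> still cover the space, since the closure of each member of
    \<open>\<W>\<close> lies in some \<open>V\<close>; this makes the sum \<open>S\<close>
    positive.\<close>
  define C where "C V = \<Union>((\<lambda>W. X closure_of W) ` {W \<in> \<W>. X closure_of W \<subseteq> V})" for V
  have "\<exists>g. continuous_map X euclideanreal g \<and> (\<forall>t\<in>C V. g t = 1) \<and> (\<forall>t\<in>topspace X - V. g t = 0)"
    if V: "V \<in> \<V>" for V
  proof -
    have "locally_finite_in X {W \<in> \<W>. X closure_of W \<subseteq> V}"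
      using \<W>(4) locally_finite_in_subset by force
    then have "closedin X (C V)"
      unfolding C_def by (rule closedin_Union_locally_finite_closure)
    moreover have "closedin X (topspace X - V)"
      using V \<V>(1) by blast
    moreover have "disjnt (C V) (topspace X - V)"
      by (auto simp: C_def disjnt_def)
    ultimately obtain g where "continuous_map X euclideanreal g" "g ` C V \<subseteq> {1}"
        "g ` (topspace X - V) \<subseteq> {0}"
      using Urysohn_lemma_alt [OF paracompact_Hausdorff_imp_normal [OF X], of "C V" "topspace X - V" 1 0]
      by blast
    then show ?thesis by (intro exI [of _ g]) (auto simp: image_subset_iff)
  qed
  then have "\<forall>V\<in>\<V>. \<exists>g. continuous_map X euclideanreal g \<and> (\<forall>t\<in>C V. g t = 1) \<and> (\<forall>t\<in>topspace X - V. g t = 0)"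
    by blast
  from bchoice [OF this] obtain g where g: "\<And>V. V \<in> \<V> \<Longrightarrow> continuous_map X euclideanreal (g V)"
      "\<And>V t. \<lbrakk>V \<in> \<V>; t \<in> C V\<rbrakk> \<Longrightarrow> g V t = 1"
      "\<And>V t. \<lbrakk>V \<in> \<V>; t \<in> topspace X - V\<rbrakk> \<Longrightarrow> g V t = 0"
    by blast
  \<comment> \<open>The Urysohn functions come without a bound on their range, so absolute values
    supply nonnegative weights. At a point of the space only finitely many \<open>V\<close>
    enter.\<close>
  define S where "S t = (\<Sum>V\<in>{V\<in>\<V>. t \<in> V}. \<bar>g V t\<bar>)" for t
  define h where "h V t = \<bar>g V t\<bar> / S t" for V t
  have g_tendsto: "((\<lambda>t. \<bar>g V t\<bar>) \<longlongrightarrow> \<bar>g V s\<bar>) (nhdsin X s)" if "V \<in> \<V>" "s \<in> topspace X" for V s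
    by (intro tendsto_rabs continuous_map_real_tendsto_nhdsin g that)
  have loc: "\<exists>J\<subseteq>\<V>. finite J \<and> (\<forall>V\<in>J. s \<in> X closure_of V) \<and>
     (\<forall>\<^sub>F t in nhdsin X s. t \<in> topspace X \<and> (\<forall>V\<in>\<V> - J. g V t = 0) \<and> S t = (\<Sum>V\<in>J. \<bar>g V t\<bar>))"
    if s: "s \<in> topspace X" for s
  proof -
    obtain J where J: "finite J" "J \<subseteq> \<V>" "\<And>V. V \<in> J \<Longrightarrow> s \<in> X closure_of V"
      "\<forall>\<^sub>F t in nhdsin X s. \<forall>V\<in>\<V> - J. t \<notin> V"
      using locally_finite_in_nhdsin [OF \<V>(4) s] by blast
    have "\<forall>\<^sub>F t in nhdsin X s. t \<in> topspace X"
      using s by (auto simp: eventually_nhdsin)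
    then have "\<forall>\<^sub>F t in nhdsin X s. t \<in> topspace X \<and> (\<forall>V\<in>\<V> - J. g V t = 0) \<and> S t = (\<Sum>V\<in>J. \<bar>g V t\<bar>)"
      using J(4)
    proof eventually_elim
      case (elim t)
      then have "S t = (\<Sum>V\<in>J. \<bar>g V t\<bar>)"
        unfolding S_def using J(1,2) g(3) by (intro sum.mono_neutral_left) auto
      with elim g(3) show ?case by auto
    qed
    then show ?thesis using J by blast
  qed
  have S_pos: "S t > 0" if t: "t \<in> topspace X" for t
  proof -
    obtain W where W: "W \<in> \<W>" "t \<in> W" using \<W>(2) t by auto
    obtain V where V: "V \<in> \<V>" "X closure_of W \<subseteq> V" using \<W>(3) W(1) by blast
    have "t \<in> X closure_of W"
      using W(2) closure_of_subset [OF openin_subset [OF \<W>(1) [OF W(1)]]] by blast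
    then have tV: "t \<in> C V" "t \<in> V" using W V by (auto simp: C_def)
    have "finite {V \<in> \<V>. t \<in> V}"
    proof -
      obtain U where "openin X U" "t \<in> U" "finite {V \<in> \<V>. V \<inter> U \<noteq> {}}"
        using \<V>(4) t unfolding locally_finite_in_def by meson
      then show ?thesis by (auto elim!: rev_finite_subset)
    qed
    then have "\<bar>g V t\<bar> \<le> S t"
      unfolding S_def using V tV by (intro member_le_sum) auto
    then show ?thesis using g(2) [OF V(1) tV(1)] by simp
  qed
  have S_tendsto: "(S \<longlongrightarrow> S s) (nhdsin X s)" if s: "s \<in> topspace X" for s
  proof -
    obtain J where J: "J \<subseteq> \<V>" "finite J"
      "\<forall>\<^sub>F t in nhdsin X s. t \<in> topspace X \<and> (\<forall>V\<in>\<V> - J. g V t = 0) \<and> S t = (\<Sum>V\<in>J. \<bar>g V t\<bar>)"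
      using loc [OF s] by blast
    have "((\<lambda>t. \<Sum>V\<in>J. \<bar>g V t\<bar>) \<longlongrightarrow> (\<Sum>V\<in>J. \<bar>g V s\<bar>)) (nhdsin X s)"
      using J s by (intro tendsto_sum g_tendsto) auto
    moreover have "S s = (\<Sum>V\<in>J. \<bar>g V s\<bar>)"
      using J(3) s by (auto simp: eventually_nhdsin)
    moreover have "\<forall>\<^sub>F t in nhdsin X s. S t = (\<Sum>V\<in>J. \<bar>g V t\<bar>)"
      using J(3) by eventually_elim blast
    ultimately show ?thesis
      by (simp add: tendsto_cong)
  qed
  show thesis
  proof (rule that [of \<V> c h])
    show "c i \<in> topspace X" if "i \<in> \<V>" for i using c [OF that] by blast
    show "h i t \<ge> 0" for i t by (simp add: h_def S_def sum_nonneg)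
    show "(h i \<longlongrightarrow> h i s) (nhdsin X s)" if "i \<in> \<V>" "s \<in> topspace X" for i s
      unfolding h_def
      by (intro tendsto_divide g_tendsto S_tendsto that) (use S_pos [OF that(2)] in simp)
    show "\<exists>J\<subseteq>\<V>. finite J \<and> (\<forall>i\<in>J. s \<in> N (c i)) \<and>
        (\<forall>\<^sub>F t in nhdsin X s. (\<forall>i\<in>\<V> - J. h i t = 0) \<and> (\<Sum>i\<in>J. h i t) = 1)"
      if s: "s \<in> topspace X" for s
    proof -
      obtain J where J: "J \<subseteq> \<V>" "finite J" "\<forall>V\<in>J. s \<in> X closure_of V"
        "\<forall>\<^sub>F t in nhdsin X s. t \<in> topspace X \<and> (\<forall>V\<in>\<V> - J. g V t = 0) \<and> S t = (\<Sum>V\<in>J. \<bar>g V t\<bar>)"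
        using loc [OF s] by blast
      have "\<forall>\<^sub>F t in nhdsin X s. (\<forall>i\<in>\<V> - J. h i t = 0) \<and> (\<Sum>i\<in>J. h i t) = 1"
        using J(4)
      proof eventually_elim
        case (elim t)
        then show ?case
          using S_pos [of t] by (simp add: h_def flip: sum_divide_distrib)
      qed
      moreover have "\<forall>i\<in>J. s \<in> N (c i)" using J c by blast
      ultimately show ?thesis using J by blast
    qed
  qed
qed

section \<open>Banach spaces on a carrier\<close>

context banach_space_on
begin

text \<open>Additive inverses are given only by existence; the scalar -1 yields a definite one, and
  this is the form in which completeness is assumed.\<close>

definition diff :: "'v \<Rightarrow> 'v \<Rightarrow> 'v" where
  "diff x y = add x (scale (-1) y)"

declare zero_closed [simp] add_closed [simp] scale_closed [simp]

lemma diff_closed [simp]: "\<lbrakk>x \<in> V; y \<in> V\<rbrakk> \<Longrightarrow> diff x y \<in> V"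
  by (simp add: diff_def)

lemma norm_zero [simp]: "nrm zero = 0"
  using norm_eq_zero by simp

text \<open>Homogeneity gives the multiple norm 0, and only zero has norm 0; this bypasses
  cancellation in the carrier.\<close>

lemma scale_zero_left [simp]: "x \<in> V \<Longrightarrow> scale 0 x = zero"
  using norm_scale [of x 0] norm_eq_zero [of "scale 0 x"] by simp

lemma scale_zero_right [simp]: "scale c zero = zero"
  using norm_scale [of zero c] norm_eq_zero [of "scale c zero"] by simp

lemma add_zero_left: "x \<in> V \<Longrightarrow> add zero x = x"
  using add_commute [of x zero] add_zero by simp

lemma diff_self [simp]: "x \<in> V \<Longrightarrow> diff x x = zero"
  using scale_add_left [of x 1 "-1"] by (simp add: diff_def scale_one)

lemma diff_zero_right [simp]: "x \<in> V \<Longrightarrow> diff x zero = x"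
  by (simp add: diff_def add_zero)

lemma add_left_commute:
  "\<lbrakk>x \<in> V; y \<in> V; z \<in> V\<rbrakk> \<Longrightarrow> add x (add y z) = add y (add x z)"
  by (metis add_assoc add_commute)

lemma diff_add_cancel [simp]: "\<lbrakk>x \<in> V; y \<in> V\<rbrakk> \<Longrightarrow> add (diff x y) y = x"
  using diff_self [of y] by (metis add_assoc add_commute add_zero diff_def scale_closed)

lemma add_diff_cancel [simp]: "\<lbrakk>x \<in> V; y \<in> V\<rbrakk> \<Longrightarrow> diff (add y x) y = x"
  using diff_self [of y]
  by (metis add_assoc add_commute add_zero diff_def scale_closed)

lemma diff_add_diff [simp]:
  "\<lbrakk>x \<in> V; y \<in> V; z \<in> V\<rbrakk> \<Longrightarrow> add (diff x y) (diff y z) = diff x z"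
  by (metis add_assoc diff_add_cancel diff_closed diff_def scale_closed)

lemma diff_diff_diff:
  "\<lbrakk>a \<in> V; b \<in> V; c \<in> V; d \<in> V\<rbrakk> \<Longrightarrow> diff (diff a b) (diff c d) = diff (diff a c) (diff b d)"
  by (simp add: diff_def scale_add_right scale_scale add_assoc add_left_commute)

lemma scale_diff:
  "\<lbrakk>x \<in> V; y \<in> V\<rbrakk> \<Longrightarrow> scale c (diff x y) = diff (scale c x) (scale c y)"
  by (simp add: diff_def scale_add_right scale_scale)

lemma diff_add_add:
  "\<lbrakk>a \<in> V; b \<in> V; c \<in> V; d \<in> V\<rbrakk> \<Longrightarrow> diff (add a b) (add c d) = add (diff a c) (diff b d)"
  by (simp add: diff_def scale_add_right add_assoc add_left_commute)

lemma norm_diff_commute: "\<lbrakk>x \<in> V; y \<in> V\<rbrakk> \<Longrightarrow> nrm (diff x y) = nrm (diff y x)"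
proof -
  assume "x \<in> V" "y \<in> V"
  then have "diff y x = scale (-1) (diff x y)"
    by (simp add: diff_def scale_add_right scale_scale scale_one add_commute)
  then show ?thesis
    by (simp add: norm_scale \<open>x \<in> V\<close> \<open>y \<in> V\<close>)
qed

lemma norm_diff_triangle:
  "\<lbrakk>x \<in> V; y \<in> V; z \<in> V\<rbrakk> \<Longrightarrow> nrm (diff x z) \<le> nrm (diff x y) + nrm (diff y z)"
  using norm_triangle [of "diff x y" "diff y z"] by simp

lemma norm_le_diff: "\<lbrakk>x \<in> V; y \<in> V\<rbrakk> \<Longrightarrow> nrm x \<le> nrm (diff x y) + nrm y"
  using norm_triangle [of "diff x y" y] by simp

lemma norm_diff_le: "\<lbrakk>x \<in> V; y \<in> V\<rbrakk> \<Longrightarrow> nrm (diff x y) \<le> nrm x + nrm y"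
  using norm_triangle [of x "scale (-1) y"] by (simp add: diff_def norm_scale)

lemma norm_diff_eq_zero: "\<lbrakk>x \<in> V; y \<in> V\<rbrakk> \<Longrightarrow> nrm (diff x y) = 0 \<longleftrightarrow> x = y"
  by (metis add_zero_left diff_add_cancel diff_closed diff_self norm_eq_zero)

lemma norm_diff_le_zero: "\<lbrakk>x \<in> V; y \<in> V; nrm (diff x y) \<le> 0\<rbrakk> \<Longrightarrow> x = y"
  using norm_diff_eq_zero norm_nonneg [of "diff x y"] by simp

text \<open>
  The sum is restricted to members of the carrier because addition is only known to be
  associative and commutative there; other summands are skipped.
\<close>

definition vsum :: "('i \<Rightarrow> 'v) \<Rightarrow> 'i set \<Rightarrow> 'v" where
  "vsum x J = Finite_Set.fold (\<lambda>i s. if x i \<in> V \<and> s \<in> V then add (x i) s else s) zero J"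

lemma vsum_empty [simp]: "vsum x {} = zero"
  by (simp add: vsum_def)

text \<open>The guards make the folded function commute with itself on the whole type, as the fold
  law demands; they are discharged only afterwards.\<close>

lemma vsum_insert_aux:
  assumes "finite J" "i \<notin> J"
  shows "vsum x (insert i J) = (if x i \<in> V \<and> vsum x J \<in> V then add (x i) (vsum x J) else vsum x J)"
proof -
  interpret comp_fun_commute "\<lambda>i s. if x i \<in> V \<and> s \<in> V then add (x i) s else s"
    by unfold_locales (auto simp: fun_eq_iff add_left_commute)
  show ?thesis
    unfolding vsum_def by (rule fold_insert [OF assms])
qed

lemma vsum_closed [simp]: "vsum x J \<in> V"
proof (cases "finite J")
  case True
  then show ?thesis
    by induction (simp_all add: vsum_insert_aux)
qed (simp add: vsum_def)

lemma vsum_insert [simp]: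
  "\<lbrakk>finite J; i \<notin> J; x i \<in> V\<rbrakk> \<Longrightarrow> vsum x (insert i J) = add (x i) (vsum x J)"
  by (simp add: vsum_insert_aux)

lemma vsum_mono_neutral:
  assumes "finite J" "I \<subseteq> J" "\<And>i. i \<in> J - I \<Longrightarrow> x i = zero"
  shows "vsum x J = vsum x I"
proof -
  have "finite I" using assms finite_subset by blast
  have "vsum x (I \<union> K) = vsum x I" if "finite K" "\<And>i. i \<in> K \<Longrightarrow> x i = zero" "I \<inter> K = {}" for K
    using that
  proof (induction K)
    case (insert i K)
    then show ?case
      using \<open>finite I\<close> by (simp add: add_zero_left)
  qed simp
  from this [of "J - I"] assms show ?thesis
    by (auto simp: Un_absorb1)
qed

text \<open>Coefficients are real numbers embedded by \<open>of_real\<close>, so that one notion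
  serves real and complex scalars. Containment in \<open>V\<close> is part of it because the vector
  space laws hold only there.\<close>

definition convex_in :: "'v set \<Rightarrow> bool" where
  "convex_in C \<longleftrightarrow> C \<subseteq> V \<and>
     (\<forall>x\<in>C. \<forall>y\<in>C. \<forall>u\<ge>0. \<forall>v\<ge>0. u + v = 1 \<longrightarrow> add (scale (of_real u) x) (scale (of_real v) y) \<in> C)"

lemma convex_inD:
  "\<lbrakk>convex_in C; x \<in> C; y \<in> C; u \<ge> 0; v \<ge> 0; u + v = 1\<rbrakk>
    \<Longrightarrow> add (scale (of_real u) x) (scale (of_real v) y) \<in> C"
  unfolding convex_in_def by blast

lemma convex_in_vsum:
  assumes C: "convex_in C" and "finite J" "\<And>i. i \<in> J \<Longrightarrow> a i \<ge> 0" "\<And>i. i \<in> J \<Longrightarrow> x i \<in> C"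
    and "sum a J = 1"
  shows "vsum (\<lambda>i. scale (of_real (a i)) (x i)) J \<in> C"
proof -
  have CV: "C \<subseteq> V" using C by (simp add: convex_in_def)
  \<comment> \<open>A partial sum may have total weight below 1, so the induction claims that it is
    its total weight times a point of \<open>C\<close>; at weight 1 this is the goal.\<close>
  have "\<exists>c\<in>C. vsum (\<lambda>i. scale (of_real (a i)) (x i)) J = scale (of_real (sum a J)) c"
    if "finite J" "J \<noteq> {}" "\<And>i. i \<in> J \<Longrightarrow> a i \<ge> 0" "\<And>i. i \<in> J \<Longrightarrow> x i \<in> C" for J
    using that
  proof (induction J rule: finite_ne_induct)
    case (singleton i)
    then show ?case
      using CV by (intro bexI [of _ "x i"]) (auto simp: add_zero)
  next
    case (insert i J)
    then obtain c where c: "c \<in> C"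
      "vsum (\<lambda>i. scale (of_real (a i)) (x i)) J = scale (of_real (sum a J)) c"
      by auto
    have xi: "x i \<in> C" "x i \<in> V" "c \<in> V" using insert c CV by auto
    have nn: "a i \<ge> 0" "sum a J \<ge> 0"
      using insert by (auto intro: sum_nonneg)
    have eq: "vsum (\<lambda>i. scale (of_real (a i)) (x i)) (insert i J) =
        add (scale (of_real (a i)) (x i)) (scale (of_real (sum a J)) c)"
      using insert.hyps xi c by simp
    \<comment> \<open>At total weight 0 the weights cannot be normalised, but then both terms vanish
      and any point of \<open>C\<close> serves.\<close>
    show ?case
    proof (cases "a i + sum a J = 0")
      case True
      then have "a i = 0" "sum a J = 0" using nn by auto
      then show ?thesis
        using insert.hyps xi c(1) unfolding eq by (intro bexI [of _ c]) (auto simp: add_zero)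
    next
      case False
      define r where "r = a i + sum a J"
      have r: "r > 0" using False nn by (simp add: r_def)
      have "add (scale (of_real (a i / r)) (x i)) (scale (of_real (sum a J / r)) c) \<in> C"
        using nn r by (intro convex_inD [OF C] xi c(1)) (auto simp: r_def simp flip: add_divide_distrib)
      moreover have "of_real r * of_real (b / r) = (of_real b :: 'k)" for b
        using r by simp
      then have "scale (of_real r) (add (scale (of_real (a i / r)) (x i)) (scale (of_real (sum a J / r)) c))
         = add (scale (of_real (a i)) (x i)) (scale (of_real (sum a J)) c)"
        using xi r by (simp add: scale_add_right scale_scale del: of_real_divide of_real_sum)
      ultimately show ?thesis
        unfolding eq using insert.hyps by (force simp: r_def)
    qed
  qed
  from this [of J] assms show ?thesis
    using CV by (fastforce simp: scale_one)
qed

lemma convex_in_Int: "\<lbrakk>convex_in C; convex_in D\<rbrakk> \<Longrightarrow> convex_in (C \<inter> D)"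
  unfolding convex_in_def by blast

lemma convex_in_singleton: "x \<in> V \<Longrightarrow> convex_in {x}"
  unfolding convex_in_def by (auto simp: scale_one simp flip: scale_add_left of_real_add)

lemma convex_combination_diff:
  assumes "x \<in> V" "y \<in> V" "z \<in> V" "u + v = 1"
  shows "diff (add (scale (of_real u) x) (scale (of_real v) y)) z =
    add (scale (of_real u) (diff x z)) (scale (of_real v) (diff y z))"
proof -
  have "add (scale (of_real u) z) (scale (of_real v) z) = z"
    using assms by (simp add: scale_one flip: scale_add_left of_real_add)
  then show ?thesis
    using assms diff_add_add [of "scale (of_real u) x" "scale (of_real v) y" "scale (of_real u) z" "scale (of_real v) z"]
    by (simp add: scale_diff)
qed

lemma norm_convex_combination:
  assumes "x \<in> V" "y \<in> V" "u \<ge> 0" "v \<ge> 0"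
  shows "nrm (add (scale (of_real u) x) (scale (of_real v) y)) \<le> u * nrm x + v * nrm y"
  using norm_triangle [of "scale (of_real u) x" "scale (of_real v) y"] assms by (simp add: norm_scale)

lemma convex_in_cball: 
  assumes z: "z \<in> V"
  shows "convex_in {x \<in> V. nrm (diff x z) \<le> r}"
  unfolding convex_in_def
proof (intro conjI ballI allI impI)
  fix x y and u v :: real
  assume *: "x \<in> {x \<in> V. nrm (diff x z) \<le> r}" "y \<in> {x \<in> V. nrm (diff x z) \<le> r}" "0 \<le> u" "0 \<le> v" "u + v = 1"
  have "nrm (diff (add (scale (of_real u) x) (scale (of_real v) y)) z) \<le> u * nrm (diff x z) + v * nrm (diff y z)"
    using * z by (simp add: convex_combination_diff norm_convex_combination)
  also have "\<dots> \<le> u * r + v * r"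
    using * by (intro add_mono mult_left_mono) auto
  also have "\<dots> = r"
    using * by (simp flip: distrib_right)
  finally show "add (scale (of_real u) x) (scale (of_real v) y) \<in> {x \<in> V. nrm (diff x z) \<le> r}"
    using * by simp
qed auto

lemma convex_in_ball: "convex_in {x \<in> V. nrm x < r}"
  unfolding convex_in_def
proof (intro conjI ballI allI impI)
  fix x y and u v :: real
  assume *: "x \<in> {x \<in> V. nrm x < r}" "y \<in> {x \<in> V. nrm x < r}" "0 \<le> u" "0 \<le> v" "u + v = 1"
  \<comment> \<open>Comparison with the larger of the two norms keeps the inequality strict even if
    one coefficient is 0.\<close>
  define s where "s = max (nrm x) (nrm y)"
  have "nrm (add (scale (of_real u) x) (scale (of_real v) y)) \<le> u * nrm x + v * nrm y"
    using * by (simp add: norm_convex_combination)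
  also have "\<dots> \<le> u * s + v * s"
    using * by (intro add_mono mult_left_mono) (auto simp: s_def)
  also have "\<dots> = s"
    using * by (simp flip: distrib_right)
  also have "\<dots> < r"
    using * by (simp add: s_def)
  finally show "add (scale (of_real u) x) (scale (of_real v) y) \<in> {x \<in> V. nrm x < r}"
    using * by simp
qed auto

text \<open>The tail of the geometric series contributes the factor 2. The distance to the limit is
  kept explicit because both the open mapping theorem and the selection theorem use it as a
  rate.\<close>

lemma geometric_Cauchy_limit:
  assumes \<sigma>: "\<And>n. \<sigma> n \<in> V" and K: "\<And>n. nrm (diff (\<sigma> (Suc n)) (\<sigma> n)) \<le> K / 2 ^ n"
  obtains l where "l \<in> V" "\<And>n. nrm (diff (\<sigma> n) l) \<le> 2 * K / 2 ^ n"
proof -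
  have K0: "K \<ge> 0"
    using K [of 0] norm_nonneg [OF diff_closed [OF \<sigma> \<sigma>]] by (metis div_by_1 order_trans power_0)
  \<comment> \<open>The right-hand side is the partial geometric sum in closed form. The subtracted
    term carries the induction and is dropped in \<open>bound\<close>.\<close>
  have step: "nrm (diff (\<sigma> (n + k)) (\<sigma> n)) \<le> 2 * K / 2 ^ n - 2 * K / 2 ^ (n + k)" for n k
  proof (induction k)
    case (Suc k)
    have "nrm (diff (\<sigma> (n + Suc k)) (\<sigma> n)) \<le> nrm (diff (\<sigma> (Suc (n + k))) (\<sigma> (n + k))) + nrm (diff (\<sigma> (n + k)) (\<sigma> n))"
      using norm_diff_triangle \<sigma> by simp
    also have "\<dots> \<le> K / 2 ^ (n + k) + (2 * K / 2 ^ n - 2 * K / 2 ^ (n + k))"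
      using Suc K by (intro add_mono) auto
    finally show ?case by (simp add: field_simps)
  qed (simp add: \<sigma>)
  have bound: "nrm (diff (\<sigma> m) (\<sigma> n)) \<le> 2 * K / 2 ^ n" if "m \<ge> n" for m n
  proof -
    have "2 * K / 2 ^ (n + (m - n)) \<ge> 0" using K0 by simp
    then show ?thesis
      using step [of n "m - n"] that by simp
  qed
  have lim0: "(\<lambda>n. 2 * K / 2 ^ n) \<longlonglongrightarrow> 0"
    by (rule LIMSEQ_divide_realpow_zero) simp
  have "\<exists>N. \<forall>i\<ge>N. \<forall>j\<ge>N. nrm (add (\<sigma> i) (scale (-1) (\<sigma> j))) < e" if "e > 0" for e
  proof -
    obtain N where N: "2 * K / 2 ^ N < e / 2"
      using order_tendstoD(2) [OF lim0, of "e/2"] \<open>e > 0\<close> by (auto simp: eventually_sequentially)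
    have "nrm (diff (\<sigma> i) (\<sigma> j)) < e" if "i \<ge> N" "j \<ge> N" for i j
    proof -
      have "nrm (diff (\<sigma> i) (\<sigma> j)) \<le> nrm (diff (\<sigma> i) (\<sigma> N)) + nrm (diff (\<sigma> N) (\<sigma> j))"
        by (intro norm_diff_triangle \<sigma>)
      also have "\<dots> < e"
        using bound [OF that(1)] bound [OF that(2)] N norm_diff_commute [OF \<sigma> [of N] \<sigma> [of j]] by simp
      finally show ?thesis .
    qed
    then show ?thesis unfolding diff_def by blast
  qed
  then obtain l where l: "l \<in> V" "(\<lambda>n. nrm (add (\<sigma> n) (scale (-1) l))) \<longlonglongrightarrow> 0"
    using complete [of \<sigma>] \<sigma> by blast
  have "nrm (diff (\<sigma> n) l) \<le> 2 * K / 2 ^ n" for n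
  proof (rule tendsto_le [OF sequentially_bot])
    show "(\<lambda>m. 2 * K / 2 ^ n + nrm (diff (\<sigma> m) l)) \<longlonglongrightarrow> 2 * K / 2 ^ n"
      using tendsto_add [OF tendsto_const l(2)] unfolding diff_def by simp
    show "\<forall>\<^sub>F m in sequentially. nrm (diff (\<sigma> n) l) \<le> 2 * K / 2 ^ n + nrm (diff (\<sigma> m) l)"
      using eventually_ge_at_top [of n]
    proof eventually_elim
      case (elim m)
      have "nrm (diff (\<sigma> n) l) \<le> nrm (diff (\<sigma> n) (\<sigma> m)) + nrm (diff (\<sigma> m) l)"
        by (intro norm_diff_triangle \<sigma> l)
      then show ?case
        using bound [OF elim] norm_diff_commute [OF \<sigma> [of n] \<sigma> [of m]] by simp
    qed
  qed simp
  then show thesis using that l(1) by blast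
qed

end

section \<open>The open mapping theorem\<close>

text \<open>The classical argument: by Baire the closure of the image of some ball has an interior
  point, differences move it to the origin, scaling gives lifts that halve the error, and successive
  approximation removes the error. The conclusion is quantitative because a norm bound on lifts is
  what can be evaluated at a single base point.\<close>

theorem open_mapping_banach_space_on:
  fixes scale\<^sub>1 :: "'k::real_normed_field \<Rightarrow> 'a \<Rightarrow> 'a" and scale\<^sub>2 :: "'k \<Rightarrow> 'b \<Rightarrow> 'b"
  assumes X: "banach_space_on V\<^sub>1 add\<^sub>1 scale\<^sub>1 zero\<^sub>1 nrm\<^sub>1" and Y: "banach_space_on V\<^sub>2 add\<^sub>2 scale\<^sub>2 zero\<^sub>2 nrm\<^sub>2"
    and L_add: "\<And>x y. \<lbrakk>x \<in> V\<^sub>1; y \<in> V\<^sub>1\<rbrakk> \<Longrightarrow> L (add\<^sub>1 x y) = add\<^sub>2 (L x) (L y)"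
    and L_scale: "\<And>c x. x \<in> V\<^sub>1 \<Longrightarrow> L (scale\<^sub>1 c x) = scale\<^sub>2 c (L x)"
    and surj: "L ` V\<^sub>1 = V\<^sub>2"
    and bounded: "\<And>x. x \<in> V\<^sub>1 \<Longrightarrow> nrm\<^sub>2 (L x) \<le> K * nrm\<^sub>1 x"
  obtains M where "M > 0" "\<And>y. y \<in> V\<^sub>2 \<Longrightarrow> \<exists>x\<in>V\<^sub>1. L x = y \<and> nrm\<^sub>1 x \<le> M * nrm\<^sub>2 y"
proof -
  interpret X: banach_space_on V\<^sub>1 add\<^sub>1 scale\<^sub>1 zero\<^sub>1 nrm\<^sub>1 by (rule X)
  interpret Y: banach_space_on V\<^sub>2 add\<^sub>2 scale\<^sub>2 zero\<^sub>2 nrm\<^sub>2 by (rule Y)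
  have LV [simp]: "L x \<in> V\<^sub>2" if "x \<in> V\<^sub>1" for x using that surj by blast
  have L_diff: "L (X.diff x y) = Y.diff (L x) (L y)" if "x \<in> V\<^sub>1" "y \<in> V\<^sub>1" for x y
    using that by (simp add: X.diff_def Y.diff_def L_add L_scale)
  have L_zero: "L zero\<^sub>1 = zero\<^sub>2"
    using L_scale [of zero\<^sub>1 0] by simp
  \<comment> \<open>\<open>Metric_space\<close> demands nonnegativity and symmetry on the whole
    type, hence the value 0 off the carrier.\<close>
  define d where "d y z = (if y \<in> V\<^sub>2 \<and> z \<in> V\<^sub>2 then nrm\<^sub>2 (Y.diff y z) else 0)" for y z
  interpret D: Metric_space V\<^sub>2 d
  proof
    show "0 \<le> d y z" for y z
      by (simp add: d_def Y.norm_nonneg)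
    show "d y z = d z y" for y z
      by (simp add: d_def Y.norm_diff_commute)
    show "d y z = 0 \<longleftrightarrow> y = z" if "y \<in> V\<^sub>2" "z \<in> V\<^sub>2" for y z
      using that by (simp add: d_def Y.norm_diff_eq_zero)
    show "d x z \<le> d x y + d y z" if "x \<in> V\<^sub>2" "y \<in> V\<^sub>2" "z \<in> V\<^sub>2" for x y z
      using that by (simp add: d_def Y.norm_diff_triangle)
  qed
  have "D.mcomplete"
    unfolding D.mcomplete_def
  proof (intro allI impI)
    fix \<sigma> assume \<sigma>: "D.MCauchy \<sigma>"
    then have V: "range \<sigma> \<subseteq> V\<^sub>2" by (simp add: D.MCauchy_def)
    then have \<sigma>V: "\<sigma> n \<in> V\<^sub>2" for n by auto
    have "\<exists>N. \<forall>i\<ge>N. \<forall>j\<ge>N. nrm\<^sub>2 (add\<^sub>2 (\<sigma> i) (scale\<^sub>2 (-1) (\<sigma> j))) < e" if "e > 0" for e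
      using \<sigma> that \<sigma>V unfolding D.MCauchy_def d_def Y.diff_def by simp
    then obtain l where l: "l \<in> V\<^sub>2" "(\<lambda>n. nrm\<^sub>2 (add\<^sub>2 (\<sigma> n) (scale\<^sub>2 (-1) l))) \<longlonglongrightarrow> 0"
      using Y.complete [OF V] by blast
    have "\<exists>N. \<forall>n\<ge>N. \<sigma> n \<in> V\<^sub>2 \<and> d (\<sigma> n) l < e" if "e > 0" for e
      using order_tendstoD(2) [OF l(2) that] l(1) \<sigma>V
      by (simp add: eventually_sequentially d_def Y.diff_def)
    then show "\<exists>x. limitin D.mtopology \<sigma> x sequentially"
      using l(1) unfolding D.limit_metric_sequentially by blast
  qed
  \<comment> \<open>By surjectivity these closed sets exhaust the target, so that Baire gives one of
    them an interior point.\<close>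
  define A where "A n = D.mtopology closure_of (L ` {x \<in> V\<^sub>1. nrm\<^sub>1 x \<le> real n})" for n
  have AV: "A n \<subseteq> V\<^sub>2" for n
    unfolding A_def using closure_of_subset_topspace [of D.mtopology] by simp
  have "V\<^sub>2 \<subseteq> \<Union>(range A)"
  proof
    fix y assume "y \<in> V\<^sub>2"
    then obtain x where x: "x \<in> V\<^sub>1" "y = L x" using surj by blast
    obtain n where "nrm\<^sub>1 x \<le> real n" using real_arch_simple by blast
    then have "y \<in> L ` {x \<in> V\<^sub>1. nrm\<^sub>1 x \<le> real n}" using x by auto
    moreover have "L ` {x \<in> V\<^sub>1. nrm\<^sub>1 x \<le> real n} \<subseteq> A n"
      unfolding A_def by (rule closure_of_subset) auto
    ultimately show "y \<in> \<Union>(range A)" by blast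
  qed
  with AV have UA: "\<Union>(range A) = V\<^sub>2" by blast
  have "\<exists>n. D.mtopology interior_of A n \<noteq> {}"
  proof (rule ccontr)
    assume "\<not> ?thesis"
    then have "D.mtopology interior_of \<Union>(range A) = {}"
      using \<open>D.mcomplete\<close> by (intro D.metric_Baire_category_alt) (auto simp: A_def)
    moreover have "D.mtopology interior_of V\<^sub>2 = V\<^sub>2"
      using interior_of_topspace [of D.mtopology] by simp
    ultimately show False
      using Y.zero_closed unfolding UA by blast
  qed
  then obtain n y\<^sub>0 where int: "y\<^sub>0 \<in> D.mtopology interior_of A n" by blast
  have sub: "D.mtopology interior_of A n \<subseteq> A n" by (rule interior_of_subset)
  have "openin D.mtopology (D.mtopology interior_of A n)" by simp
  then obtain r where "r > 0" "D.mball y\<^sub>0 r \<subseteq> D.mtopology interior_of A n"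
    using int unfolding D.openin_mtopology by meson
  with sub have r: "r > 0" "D.mball y\<^sub>0 r \<subseteq> A n" by (auto simp: subset_iff)
  have y0: "y\<^sub>0 \<in> V\<^sub>2" using int sub AV [of n] by blast
  have near: "\<exists>x\<in>V\<^sub>1. nrm\<^sub>1 x \<le> real n \<and> nrm\<^sub>2 (Y.diff y (L x)) < e"
    if "y \<in> V\<^sub>2" "nrm\<^sub>2 (Y.diff y\<^sub>0 y) < r" "e > 0" for y e
  proof -
    have "y \<in> A n" using r y0 that by (auto simp: d_def subset_iff)
    then obtain z where "z \<in> L ` {x \<in> V\<^sub>1. nrm\<^sub>1 x \<le> real n}" "z \<in> D.mball y e"
      unfolding A_def D.metric_closure_of using \<open>e > 0\<close> by blast
    then show ?thesis using that by (auto simp: d_def)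
  qed
  \<comment> \<open>A point near \<open>y\<^sub>0 + y\<close> and one near \<open>y\<^sub>0\<close>
    are both approximated; subtraction recentres the ball at 0 and doubles the bound on the
    lift.\<close>
  have small: "\<exists>x\<in>V\<^sub>1. nrm\<^sub>1 x \<le> 2 * real n \<and> nrm\<^sub>2 (Y.diff y (L x)) < e"
    if y: "y \<in> V\<^sub>2" "nrm\<^sub>2 y < r" "e > 0" for y e
  proof -
    have "nrm\<^sub>2 (Y.diff y\<^sub>0 (add\<^sub>2 y\<^sub>0 y)) = nrm\<^sub>2 y"
      using y y0 Y.norm_diff_commute [of y\<^sub>0 "add\<^sub>2 y\<^sub>0 y"] by simp
    then obtain x\<^sub>1 where x1: "x\<^sub>1 \<in> V\<^sub>1" "nrm\<^sub>1 x\<^sub>1 \<le> real n" "nrm\<^sub>2 (Y.diff (add\<^sub>2 y\<^sub>0 y) (L x\<^sub>1)) < e/2"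
      using near [of "add\<^sub>2 y\<^sub>0 y" "e/2"] y y0 by auto
    obtain x\<^sub>2 where x2: "x\<^sub>2 \<in> V\<^sub>1" "nrm\<^sub>1 x\<^sub>2 \<le> real n" "nrm\<^sub>2 (Y.diff y\<^sub>0 (L x\<^sub>2)) < e/2"
      using near [of y\<^sub>0 "e/2"] y y0 r by auto
    have "Y.diff y (L (X.diff x\<^sub>1 x\<^sub>2)) = Y.diff (Y.diff (add\<^sub>2 y\<^sub>0 y) (L x\<^sub>1)) (Y.diff y\<^sub>0 (L x\<^sub>2))"
      using Y.diff_diff_diff [of "add\<^sub>2 y\<^sub>0 y" y\<^sub>0 "L x\<^sub>1" "L x\<^sub>2"] x1 x2 y y0 by (simp add: L_diff)
    then have "nrm\<^sub>2 (Y.diff y (L (X.diff x\<^sub>1 x\<^sub>2))) < e"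
      using Y.norm_diff_le [of "Y.diff (add\<^sub>2 y\<^sub>0 y) (L x\<^sub>1)" "Y.diff y\<^sub>0 (L x\<^sub>2)"] x1 x2 y y0 by simp
    moreover have "nrm\<^sub>1 (X.diff x\<^sub>1 x\<^sub>2) \<le> 2 * real n"
      using X.norm_diff_le [of x\<^sub>1 x\<^sub>2] x1 x2 by simp
    ultimately show ?thesis using x1 x2 by (intro bexI [of _ "X.diff x\<^sub>1 x\<^sub>2"]) auto
  qed
  \<comment> \<open>Rescaling \<open>y\<close> to norm \<open>r / 2\<close> means multiplying by
    \<open>c = r / (2 * nrm\<^sub>2 y)\<close>; a lift of norm at most \<open>2 * n\<close>, divided
    by \<open>c\<close>, has norm at most \<open>4 * n / r\<close> times that of
    \<open>y\<close>.\<close>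
  define C where "C = 4 * real n / r"
  have C0: "C \<ge> 0" using r by (simp add: C_def)
  have half: "\<exists>x\<in>V\<^sub>1. nrm\<^sub>1 x \<le> C * nrm\<^sub>2 y \<and> nrm\<^sub>2 (Y.diff y (L x)) \<le> nrm\<^sub>2 y / 2"
    if y: "y \<in> V\<^sub>2" for y
  proof (cases "y = zero\<^sub>2")
    case True
    then show ?thesis by (intro bexI [of _ zero\<^sub>1]) (auto simp: L_zero)
  next
    case False
    then have pos: "nrm\<^sub>2 y > 0" using y Y.norm_eq_zero Y.norm_nonneg by (simp add: less_le)
    define c where "c = r / (2 * nrm\<^sub>2 y)"
    have c: "c > 0" using r pos by (simp add: c_def)
    have "nrm\<^sub>2 (scale\<^sub>2 (of_real c) y) < r"
      using y c r pos by (simp add: Y.norm_scale) (simp add: c_def)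
    \<comment> \<open>The permitted error becomes half the norm of \<open>y\<close> after division
      by \<open>c\<close>.\<close>
    then obtain x where x: "x \<in> V\<^sub>1" "nrm\<^sub>1 x \<le> 2 * real n"
      "nrm\<^sub>2 (Y.diff (scale\<^sub>2 (of_real c) y) (L x)) < c * (nrm\<^sub>2 y / 2)"
      using small [of "scale\<^sub>2 (of_real c) y" "c * (nrm\<^sub>2 y / 2)"] y c pos by auto
    have inv: "scale\<^sub>2 (of_real (1/c)) (scale\<^sub>2 (of_real c) y) = y"
      using c y by (simp add: Y.scale_scale Y.scale_one)
    have "Y.diff y (L (scale\<^sub>1 (of_real (1/c)) x))
        = scale\<^sub>2 (of_real (1/c)) (Y.diff (scale\<^sub>2 (of_real c) y) (L x))"
      using x y inv by (simp add: Y.scale_diff L_scale)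
    then have "nrm\<^sub>2 (Y.diff y (L (scale\<^sub>1 (of_real (1/c)) x))) =
        nrm\<^sub>2 (Y.diff (scale\<^sub>2 (of_real c) y) (L x)) / c"
      using x y c by (simp add: Y.norm_scale norm_divide)
    also have "\<dots> \<le> nrm\<^sub>2 y / 2"
      using x(3) c by (simp add: field_simps)
    finally have 1: "nrm\<^sub>2 (Y.diff y (L (scale\<^sub>1 (of_real (1/c)) x))) \<le> nrm\<^sub>2 y / 2" .
    have "nrm\<^sub>1 (scale\<^sub>1 (of_real (1/c)) x) = nrm\<^sub>1 x / c"
      using x c by (simp add: X.norm_scale norm_divide)
    also have "\<dots> \<le> 2 * real n / c"
      using x c by (intro divide_right_mono) auto
    also have "\<dots> = C * nrm\<^sub>2 y"
      using r pos by (simp add: C_def c_def field_simps)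
    finally show ?thesis using 1 x by (intro bexI [of _ "scale\<^sub>1 (of_real (1/c)) x"]) auto
  qed
  then have "\<forall>y\<in>V\<^sub>2. \<exists>x. x \<in> V\<^sub>1 \<and> nrm\<^sub>1 x \<le> C * nrm\<^sub>2 y \<and> nrm\<^sub>2 (Y.diff y (L x)) \<le> nrm\<^sub>2 y / 2"
    by blast
  from bchoice [OF this] obtain h where h: "\<And>y. y \<in> V\<^sub>2 \<Longrightarrow> h y \<in> V\<^sub>1"
    "\<And>y. y \<in> V\<^sub>2 \<Longrightarrow> nrm\<^sub>1 (h y) \<le> C * nrm\<^sub>2 y"
    "\<And>y. y \<in> V\<^sub>2 \<Longrightarrow> nrm\<^sub>2 (Y.diff y (L (h y))) \<le> nrm\<^sub>2 y / 2"
    by blast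
  \<comment> \<open>Since the residuals halve, the lifts add up to at most \<open>2 * C\<close>
    times the norm of \<open>y\<close>. The extra 1 keeps the final constant positive when
    \<open>n = 0\<close> and hence \<open>C = 0\<close>.\<close>
  have "\<exists>x\<in>V\<^sub>1. L x = y \<and> nrm\<^sub>1 x \<le> (2 * C + 1) * nrm\<^sub>2 y" if y: "y \<in> V\<^sub>2" for y
  proof -
    \<comment> \<open>\<open>s k\<close> collects the lifts found so far, and \<open>R k\<close> is
      the residual that the next lift halves.\<close>
    define s where "s = rec_nat zero\<^sub>1 (\<lambda>_ x. add\<^sub>1 (h (Y.diff y (L x))) x)"
    define R where "R k = Y.diff y (L (s k))" for k
    have s_Suc: "s (Suc k) = add\<^sub>1 (h (R k)) (s k)" for k by (simp add: s_def R_def)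
    have sV: "s k \<in> V\<^sub>1" for k
      by (induction k) (simp_all add: s_def h y)
    have RV: "R k \<in> V\<^sub>2" for k using y sV by (simp add: R_def)
    have hV: "h (R k) \<in> V\<^sub>1" for k using RV h by simp
    have R_Suc: "R (Suc k) = Y.diff (R k) (L (h (R k)))" for k
      using Y.diff_add_add [of y zero\<^sub>2 "L (s k)" "L (h (R k))"] y sV [of k] hV [of k] RV [of k]
      unfolding R_def [of "Suc k"] s_Suc
      by (simp add: L_add Y.add_zero Y.add_commute [of "L (h (R k))" "L (s k)"] R_def [symmetric])
         (simp add: Y.diff_def Y.add_zero_left)
    have Rk: "nrm\<^sub>2 (R k) \<le> nrm\<^sub>2 y / 2 ^ k" for k
    proof (induction k)
      case 0
      then show ?case using y by (simp add: R_def s_def L_zero)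
    next
      case (Suc k)
      have "nrm\<^sub>2 (R (Suc k)) \<le> nrm\<^sub>2 (R k) / 2"
        using h(3) [OF RV [of k]] by (simp add: R_Suc)
      also have "\<dots> \<le> nrm\<^sub>2 y / 2 ^ k / 2"
        using Suc by simp
      finally show ?case by simp
    qed
    have "nrm\<^sub>1 (X.diff (s (Suc k)) (s k)) \<le> C * nrm\<^sub>2 y / 2 ^ k" for k
    proof -
      have "nrm\<^sub>1 (X.diff (s (Suc k)) (s k)) \<le> C * nrm\<^sub>2 (R k)"
        using hV sV h(2) [OF RV] X.add_diff_cancel X.add_commute by (simp add: s_Suc)
      also have "\<dots> \<le> C * (nrm\<^sub>2 y / 2 ^ k)"
        using Rk C0 by (intro mult_left_mono)
      finally show ?thesis by simp
    qed
    then obtain l where l: "l \<in> V\<^sub>1" "\<And>k. nrm\<^sub>1 (X.diff (s k) l) \<le> 2 * (C * nrm\<^sub>2 y) / 2 ^ k"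
      using X.geometric_Cauchy_limit [of s "C * nrm\<^sub>2 y"] sV by blast
    have "nrm\<^sub>1 l \<le> 2 * (C * nrm\<^sub>2 y)"
      using l(2) [of 0] l(1) X.norm_diff_commute [of zero\<^sub>1 l] by (simp add: s_def)
    then have "nrm\<^sub>1 l \<le> (2 * C + 1) * nrm\<^sub>2 y"
      using Y.norm_nonneg [OF y] by (simp add: algebra_simps)
    \<comment> \<open>The residual tends to 0 along \<open>s k\<close>, and boundedness of
      \<open>L\<close> carries this over to the limit \<open>l\<close>. The absolute value enters
      because \<open>K\<close> comes without a sign.\<close>
    moreover have "nrm\<^sub>2 (Y.diff y (L l)) \<le> 0"
    proof (rule tendsto_lowerbound)
      show "(\<lambda>k. (nrm\<^sub>2 y + \<bar>K\<bar> * (2 * (C * nrm\<^sub>2 y))) / 2 ^ k) \<longlonglongrightarrow> 0"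
        by (rule LIMSEQ_divide_realpow_zero) simp
      show "\<forall>\<^sub>F k in sequentially. nrm\<^sub>2 (Y.diff y (L l)) \<le> (nrm\<^sub>2 y + \<bar>K\<bar> * (2 * (C * nrm\<^sub>2 y))) / 2 ^ k"
      proof (intro always_eventually allI)
        fix k
        have "nrm\<^sub>2 (Y.diff (L (s k)) (L l)) \<le> K * nrm\<^sub>1 (X.diff (s k) l)"
          using bounded [of "X.diff (s k) l"] sV l by (simp add: L_diff)
        also have "\<dots> \<le> \<bar>K\<bar> * nrm\<^sub>1 (X.diff (s k) l)"
          using X.norm_nonneg sV l by (intro mult_right_mono) auto
        also have "\<dots> \<le> \<bar>K\<bar> * (2 * (C * nrm\<^sub>2 y) / 2 ^ k)"
          using l(2) by (intro mult_left_mono) auto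
        finally have "nrm\<^sub>2 (Y.diff (L (s k)) (L l)) \<le> \<bar>K\<bar> * (2 * (C * nrm\<^sub>2 y) / 2 ^ k)" .
        moreover have "nrm\<^sub>2 (Y.diff y (L l)) \<le> nrm\<^sub>2 (R k) + nrm\<^sub>2 (Y.diff (L (s k)) (L l))"
          using Y.norm_diff_triangle y sV l unfolding R_def by simp
        ultimately show "nrm\<^sub>2 (Y.diff y (L l)) \<le> (nrm\<^sub>2 y + \<bar>K\<bar> * (2 * (C * nrm\<^sub>2 y))) / 2 ^ k"
          using Rk [of k] by (simp add: add_divide_distrib)
      qed
    qed simp
    ultimately show ?thesis
      using Y.norm_diff_le_zero [of y "L l"] y l(1) by (intro bexI [of _ l]) auto
  qed
  then show thesis
    using C0 by (intro that [of "2 * C + 1"]) auto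
qed

section \<open>Sections continuous up to an error\<close>

lemma eventually_nhdsin_self:
  "\<lbrakk>eventually P (nhdsin X s); s \<in> topspace X\<rbrakk> \<Longrightarrow> P s"
  by (auto simp: eventually_nhdsin)

lemma eventually_nhdsin_openin:
  "\<lbrakk>openin X U; s \<in> U\<rbrakk> \<Longrightarrow> \<forall>\<^sub>F t in nhdsin X s. t \<in> U"
  by (auto simp: eventually_nhdsin)

lemma eventually_nhdsin_topspace: "\<forall>\<^sub>F t in nhdsin X s. t \<in> topspace X"
  by (cases "s \<in> topspace X") (auto intro: eventually_nhdsin_openin)

lemma openin_eventually_nhdsin:
  assumes "S \<subseteq> topspace X" "\<And>s. s \<in> S \<Longrightarrow> \<forall>\<^sub>F t in nhdsin X s. t \<in> S"
  shows "openin X S"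
proof (subst openin_subopen, intro ballI)
  fix s assume "s \<in> S"
  then show "\<exists>W. openin X W \<and> s \<in> W \<and> W \<subseteq> S"
    using assms(2) [of s] assms(1) unfolding eventually_nhdsin by blast
qed

context banach_bundle
begin

text \<open>A difference involves only addition and scalar multiplication, so one term serves all
  fibers; sums and convexity depend on the base point through the carrier or its zero.\<close>

abbreviation bdiff :: "'e \<Rightarrow> 'e \<Rightarrow> 'e" where
  "bdiff \<equiv> banach_space_on.diff (badd \<xi>) (bscale \<xi>)"

abbreviation fiber_sum :: "'t \<Rightarrow> ('i \<Rightarrow> 'e) \<Rightarrow> 'i set \<Rightarrow> 'e" where
  "fiber_sum t \<equiv> banach_space_on.vsum (fiber \<xi> t) (badd \<xi>) (bzero \<xi> t)"

abbreviation fiber_convex :: "'t \<Rightarrow> 'e set \<Rightarrow> bool" where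
  "fiber_convex t \<equiv> banach_space_on.convex_in (fiber \<xi> t) (badd \<xi>) (bscale \<xi>)"

section \<open>Fibers, projection and basic neighbourhoods in the bundle space\<close>

lemma proj_topspace: "x \<in> topspace (btotal \<xi>) \<Longrightarrow> bproj \<xi> x \<in> topspace T"
  using proj_surj by blast

lemma mem_fiber_proj: "x \<in> topspace (btotal \<xi>) \<Longrightarrow> x \<in> fiber \<xi> (bproj \<xi> x)"
  by (simp add: fiber_def)

lemma fiberD: "x \<in> fiber \<xi> t \<Longrightarrow> x \<in> topspace (btotal \<xi>)" "x \<in> fiber \<xi> t \<Longrightarrow> bproj \<xi> x = t"
  by (auto simp: fiber_def)

lemma openin_mem_fiber: "\<lbrakk>openin (btotal \<xi>) U; x \<in> U\<rbrakk> \<Longrightarrow> x \<in> fiber \<xi> (bproj \<xi> x)"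
  by (meson mem_fiber_proj openin_subset subsetD)

lemma openin_proj_topspace: "\<lbrakk>openin (btotal \<xi>) U; x \<in> U\<rbrakk> \<Longrightarrow> bproj \<xi> x \<in> topspace T"
  by (meson proj_topspace openin_subset subsetD)

lemma openin_proj_preimage:
  "openin T W \<Longrightarrow> openin (btotal \<xi>) {x \<in> topspace (btotal \<xi>). bproj \<xi> x \<in> W}"
  using proj_continuous by (rule openin_continuous_map_preimage)

lemma openin_proj_image: "openin (btotal \<xi>) U \<Longrightarrow> openin T (bproj \<xi> ` U)"
  using proj_open by (simp add: open_map_def)

lemma bnorm_nonneg: "x \<in> topspace (btotal \<xi>) \<Longrightarrow> 0 \<le> bnorm \<xi> x"
  using banach_space_on.norm_nonneg [OF fiber_banach] mem_fiber_proj proj_topspace by blast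

text \<open>The net axiom is applied to the coarsest filter on the bundle space along which the
  projection tends to \<open>s\<close> and the norm to 0; its basic sets are the tubes of the
  conclusion. A tube contains the zero vectors of all fibers over \<open>W\<close>, which makes the
  zero section continuous.\<close>

lemma nbhd_bzero:
  assumes U: "openin (btotal \<xi>) U" "bzero \<xi> s \<in> U" and s: "s \<in> topspace T"
  obtains W \<delta> where "openin T W" "s \<in> W" "\<delta> > 0"
    "\<And>z. \<lbrakk>z \<in> topspace (btotal \<xi>); bproj \<xi> z \<in> W; bnorm \<xi> z < \<delta>\<rbrakk> \<Longrightarrow> z \<in> U"
proof -
  define A where "A = inf (filtercomap (bproj \<xi>) (nhdsin T s)) (filtercomap (bnorm \<xi>) (nhds 0))"
  define F where "F = inf A (principal (topspace (btotal \<xi>)))"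
  have "limitin T (bproj \<xi>) s F"
    unfolding limitin_def
  proof (intro conjI allI impI s)
    fix W assume "openin T W \<and> s \<in> W"
    then have "\<forall>\<^sub>F x in filtercomap (bproj \<xi>) (nhdsin T s). bproj \<xi> x \<in> W"
      by (intro eventually_filtercomapI eventually_nhdsin_openin) auto
    then show "\<forall>\<^sub>F x in F. bproj \<xi> x \<in> W"
      by (rule filter_leD [rotated]) (simp add: F_def A_def le_infI1)
  qed
  moreover have "(bnorm \<xi> \<longlongrightarrow> 0) F"
    by (rule filterlim_mono [OF filterlim_filtercomap order_refl]) (simp add: F_def A_def le_infI1)
  moreover have "F \<le> principal (topspace (btotal \<xi>))"
    by (simp add: F_def)
  ultimately have "\<forall>\<^sub>F x in F. x \<in> U"
    using net_to_zero U unfolding limitin_def by blast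
  then have "\<forall>\<^sub>F x in A. x \<in> topspace (btotal \<xi>) \<longrightarrow> x \<in> U"
    by (simp add: F_def eventually_inf_principal)
  then obtain P Q where P: "eventually P (nhdsin T s)" and Q: "eventually Q (nhds 0)"
    and PQ: "\<And>x. \<lbrakk>P (bproj \<xi> x); Q (bnorm \<xi> x); x \<in> topspace (btotal \<xi>)\<rbrakk> \<Longrightarrow> x \<in> U"
    unfolding A_def eventually_inf eventually_filtercomap by metis
  obtain W where "openin T W" "s \<in> W" "\<forall>t\<in>W. P t"
    using P s by (auto simp: eventually_nhdsin)
  moreover obtain \<delta> where "\<delta> > 0" "\<And>r. \<bar>r\<bar> < \<delta> \<Longrightarrow> Q r"
    using Q by (auto simp: eventually_nhds_metric dist_real_def)
  ultimately show thesis
    using PQ bnorm_nonneg by (intro that [of W \<delta>]) auto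
qed

lemma badd_nbhd:
  assumes U: "openin (btotal \<xi>) U" "badd \<xi> x y \<in> U"
    and xy: "x \<in> topspace (btotal \<xi>)" "y \<in> topspace (btotal \<xi>)" "bproj \<xi> x = bproj \<xi> y"
  obtains A B where "openin (btotal \<xi>) A" "openin (btotal \<xi>) B" "x \<in> A" "y \<in> B"
    "\<And>a b. \<lbrakk>a \<in> A; b \<in> B; bproj \<xi> a = bproj \<xi> b\<rbrakk> \<Longrightarrow> badd \<xi> a b \<in> U"
proof -
  let ?P = "prod_topology (btotal \<xi>) (btotal \<xi>)"
  let ?D = "{(x, y). bproj \<xi> x = bproj \<xi> y}"
  have "openin (subtopology ?P ?D) {p \<in> topspace (subtopology ?P ?D). (\<lambda>(x, y). badd \<xi> x y) p \<in> U}"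
    using add_continuous U(1) by (rule openin_continuous_map_preimage)
  then obtain O' where O': "openin ?P O'"
    "{p \<in> topspace (subtopology ?P ?D). (\<lambda>(x, y). badd \<xi> x y) p \<in> U} = O' \<inter> ?D"
    unfolding openin_subtopology by blast
  then have "(x, y) \<in> O'"
    using U xy by (auto simp: set_eq_iff)
  then obtain A B where AB: "openin (btotal \<xi>) A" "openin (btotal \<xi>) B" "x \<in> A" "y \<in> B" "A \<times> B \<subseteq> O'"
    using O'(1) unfolding openin_prod_topology_alt by metis
  show thesis
  proof (rule that [OF AB(1-4)])
    fix a b assume "a \<in> A" "b \<in> B" "bproj \<xi> a = bproj \<xi> b"
    then have "(a, b) \<in> O' \<inter> ?D" using AB(5) by auto
    then show "badd \<xi> a b \<in> U" unfolding O'(2) [symmetric] by simp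
  qed
qed

lemma bscale_nbhd:
  assumes U: "openin (btotal \<xi>) U" "bscale \<xi> c x \<in> U" and x: "x \<in> topspace (btotal \<xi>)"
  obtains C A where "open C" "openin (btotal \<xi>) A" "c \<in> C" "x \<in> A"
    "\<And>c' a. \<lbrakk>c' \<in> C; a \<in> A\<rbrakk> \<Longrightarrow> bscale \<xi> c' a \<in> U"
proof -
  let ?P = "prod_topology euclidean (btotal \<xi>)"
  define O' where "O' = {p \<in> topspace ?P. (\<lambda>(c, x). bscale \<xi> c x) p \<in> U}"
  have "openin ?P O'"
    unfolding O'_def using scale_continuous U(1) by (rule openin_continuous_map_preimage)
  moreover have "(c, x) \<in> O'"
    using U x by (simp add: O'_def)
  ultimately obtain C A where AB: "openin euclidean C" "openin (btotal \<xi>) A" "c \<in> C" "x \<in> A" "C \<times> A \<subseteq> O'"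
    unfolding openin_prod_topology_alt by metis
  show thesis
  proof (rule that [of C A])
    fix c' a assume "c' \<in> C" "a \<in> A"
    then have "(c', a) \<in> O'" using AB(5) by auto
    then show "bscale \<xi> c' a \<in> U" by (simp add: O'_def)
  qed (use AB in auto)
qed

text \<open>Write \<open>w\<close> as \<open>u\<close> plus the difference of \<open>w\<close> and
  \<open>u\<close>. Addition is continuous at \<open>x\<close> and the zero vector of its fiber, and
  a tube around that zero vector supplies \<delta>. One \<delta> serves all fibers that
  \<open>U'\<close> meets, which stands in for the uniformity of a metric.\<close>

lemma nbhd_norm_uniform:
  assumes U: "openin (btotal \<xi>) U" "x \<in> U"
  obtains U' \<delta> where "openin (btotal \<xi>) U'" "x \<in> U'" "\<delta> > 0"
    "\<And>u w. \<lbrakk>u \<in> U'; w \<in> fiber \<xi> (bproj \<xi> u); bnorm \<xi> (bdiff w u) < \<delta>\<rbrakk> \<Longrightarrow> w \<in> U"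
proof -
  define s where "s = bproj \<xi> x"
  have s: "s \<in> topspace T" and x: "x \<in> fiber \<xi> s"
    using U openin_mem_fiber openin_proj_topspace by (auto simp: s_def)
  interpret B: banach_space_on "fiber \<xi> s" "badd \<xi>" "bscale \<xi>" "bzero \<xi> s" "bnorm \<xi>"
    using s by (rule fiber_banach)
  have zero: "badd \<xi> x (bzero \<xi> s) \<in> U" "bproj \<xi> x = bproj \<xi> (bzero \<xi> s)"
    using U(2) B.add_zero [OF x] fiberD(2) [OF B.zero_closed] fiberD(2) [OF x] by simp_all
  obtain A B where AB: "openin (btotal \<xi>) A" "openin (btotal \<xi>) B" "x \<in> A" "bzero \<xi> s \<in> B"
    "\<And>a b. \<lbrakk>a \<in> A; b \<in> B; bproj \<xi> a = bproj \<xi> b\<rbrakk> \<Longrightarrow> badd \<xi> a b \<in> U"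
    using badd_nbhd [OF U(1) zero(1) fiberD(1) [OF x] fiberD(1) [OF B.zero_closed] zero(2)] by blast
  obtain W \<delta> where W: "openin T W" "s \<in> W" "\<delta> > 0"
    "\<And>z. \<lbrakk>z \<in> topspace (btotal \<xi>); bproj \<xi> z \<in> W; bnorm \<xi> z < \<delta>\<rbrakk> \<Longrightarrow> z \<in> B"
    using nbhd_bzero [OF AB(2,4) s] by blast
  show thesis
  proof (rule that [of "A \<inter> {u \<in> topspace (btotal \<xi>). bproj \<xi> u \<in> W}" \<delta>])
    show "openin (btotal \<xi>) (A \<inter> {u \<in> topspace (btotal \<xi>). bproj \<xi> u \<in> W})"
      using AB(1) W(1) openin_proj_preimage by blast
    show "x \<in> A \<inter> {u \<in> topspace (btotal \<xi>). bproj \<xi> u \<in> W}"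
      using AB(3) W(2) fiberD [OF x] by simp
    fix u w assume u: "u \<in> A \<inter> {u \<in> topspace (btotal \<xi>). bproj \<xi> u \<in> W}"
      and w: "w \<in> fiber \<xi> (bproj \<xi> u)" and less: "bnorm \<xi> (bdiff w u) < \<delta>"
    define t where "t = bproj \<xi> u"
    have t: "t \<in> topspace T" and ut: "u \<in> fiber \<xi> t" and wt: "w \<in> fiber \<xi> t"
      using u w proj_topspace mem_fiber_proj unfolding t_def by blast+
    interpret D: banach_space_on "fiber \<xi> t" "badd \<xi>" "bscale \<xi>" "bzero \<xi> t" "bnorm \<xi>"
      using t by (rule fiber_banach)
    have d: "bdiff w u \<in> fiber \<xi> t" using ut wt by simp
    then have "bdiff w u \<in> B"
      using W(4) less u fiberD [OF d] by (simp add: t_def)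
    then have "badd \<xi> u (bdiff w u) \<in> U"
      using AB(5) u fiberD(2) [OF d] by (simp add: t_def)
    then show "w \<in> U"
      using D.add_commute [OF d ut] ut wt by simp
  qed (rule W)
qed

text \<open>The norm of a difference is upper semicontinuous on pairs in a common fiber and vanishes
  at \<open>(x, x)\<close>. The slices of \<open>V\<close> in the fibers thus have diameter at most
  \<open>e\<close>.\<close>

lemma thin_nbhd:
  assumes x: "x \<in> topspace (btotal \<xi>)" and e: "e > 0"
  obtains V where "openin (btotal \<xi>) V" "x \<in> V"
    "\<And>u w. \<lbrakk>u \<in> V; w \<in> V; bproj \<xi> u = bproj \<xi> w\<rbrakk> \<Longrightarrow> bnorm \<xi> (bdiff u w) < e"
proof -
  define s where "s = bproj \<xi> x"
  have s: "s \<in> topspace T" and xs: "x \<in> fiber \<xi> s"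
    using x mem_fiber_proj proj_topspace by (auto simp: s_def)
  interpret B: banach_space_on "fiber \<xi> s" "badd \<xi>" "bscale \<xi>" "bzero \<xi> s" "bnorm \<xi>"
    using s by (rule fiber_banach)
  let ?U = "{x \<in> topspace (btotal \<xi>). bnorm \<xi> x < e}"
  have U: "openin (btotal \<xi>) ?U" by (rule norm_upper_semicontinuous)
  have "badd \<xi> x (bscale \<xi> (-1) x) = bzero \<xi> s"
    using B.diff_self [OF xs] by (simp add: B.diff_def)
  then have "badd \<xi> x (bscale \<xi> (-1) x) \<in> ?U"
    using e fiberD(1) [OF B.zero_closed] by simp
  moreover have "bscale \<xi> (-1) x \<in> topspace (btotal \<xi>)" "bproj \<xi> x = bproj \<xi> (bscale \<xi> (-1) x)"
    using fiberD [OF B.scale_closed [OF xs]] by (auto simp: s_def)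
  ultimately obtain A B where AB: "openin (btotal \<xi>) A" "openin (btotal \<xi>) B" "x \<in> A" "bscale \<xi> (-1) x \<in> B"
    "\<And>a b. \<lbrakk>a \<in> A; b \<in> B; bproj \<xi> a = bproj \<xi> b\<rbrakk> \<Longrightarrow> badd \<xi> a b \<in> ?U"
    using badd_nbhd [OF U _ x] by blast
  obtain C A' where C: "open C" "openin (btotal \<xi>) A'" "-1 \<in> C" "x \<in> A'"
    "\<And>c' a. \<lbrakk>c' \<in> C; a \<in> A'\<rbrakk> \<Longrightarrow> bscale \<xi> c' a \<in> B"
    using bscale_nbhd [OF AB(2,4) x] by blast
  show thesis
  proof (rule that [of "A \<inter> A'"])
    fix u w assume u: "u \<in> A \<inter> A'" and w: "w \<in> A \<inter> A'" and eq: "bproj \<xi> u = bproj \<xi> w"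
    define t where "t = bproj \<xi> w"
    have t: "t \<in> topspace T" and wt: "w \<in> fiber \<xi> t"
      using w openin_mem_fiber [OF AB(1)] openin_proj_topspace [OF AB(1)] by (auto simp: t_def)
    have "bproj \<xi> (bscale \<xi> (-1) w) = t"
      using banach_space_on.scale_closed [OF fiber_banach [OF t] wt] fiberD(2) by blast
    then have "badd \<xi> u (bscale \<xi> (-1) w) \<in> ?U"
      using AB(5) C(3,5) u w eq by (simp add: t_def)
    then show "bnorm \<xi> (bdiff u w) < e"
      by (simp add: banach_space_on.diff_def [OF fiber_banach [OF t]])
  qed (use AB C in auto)
qed

text \<open>
  The section \<open>f\<close>, not assumed continuous, is within \<open>\<rho>\<close> of being continuous at \<open>s\<close>. Constant \<open>0\<close> is
  continuity at \<open>s\<close>; unlike a condition on thin neighbourhoods, this one adds up under sums and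
  scalar multiples, so that it passes to the convex combinations given by a partition of unity.
\<close>

definition defect_at :: "('t \<Rightarrow> 'e) \<Rightarrow> ('t \<Rightarrow> real) \<Rightarrow> 't \<Rightarrow> bool" where
  "defect_at f \<rho> s \<longleftrightarrow> (\<forall>U. openin (btotal \<xi>) U \<and> f s \<in> U \<longrightarrow>
     (\<forall>\<^sub>F t in nhdsin T s. \<exists>u\<in>U \<inter> fiber \<xi> t. bnorm \<xi> (bdiff (f t) u) \<le> \<rho> t))"

section \<open>Approximate continuity under fiberwise operations\<close>

lemma defect_at_cong:
  assumes "defect_at f \<rho> s" "\<forall>\<^sub>F t in nhdsin T s. f t = g t \<and> \<rho> t \<le> \<sigma> t" "s \<in> topspace T"
  shows "defect_at g \<sigma> s"
  unfolding defect_at_def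
proof (intro allI impI)
  fix U assume "openin (btotal \<xi>) U \<and> g s \<in> U"
  moreover have "f s = g s" using eventually_nhdsin_self [OF assms(2,3)] by simp
  ultimately have "\<forall>\<^sub>F t in nhdsin T s. \<exists>u\<in>U \<inter> fiber \<xi> t. bnorm \<xi> (bdiff (f t) u) \<le> \<rho> t"
    using assms(1) by (simp add: defect_at_def)
  then show "\<forall>\<^sub>F t in nhdsin T s. \<exists>u\<in>U \<inter> fiber \<xi> t. bnorm \<xi> (bdiff (g t) u) \<le> \<sigma> t"
    using assms(2) by eventually_elim force
qed

lemma defect_at_bzero:
  assumes s: "s \<in> topspace T"
  shows "defect_at (bzero \<xi>) (\<lambda>_. 0) s"
  unfolding defect_at_def
proof (intro allI impI)
  fix U assume "openin (btotal \<xi>) U \<and> bzero \<xi> s \<in> U"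
  then have U: "openin (btotal \<xi>) U" "bzero \<xi> s \<in> U" by simp_all
  obtain W \<delta> where W: "openin T W" "s \<in> W" "\<delta> > 0"
    "\<And>z. \<lbrakk>z \<in> topspace (btotal \<xi>); bproj \<xi> z \<in> W; bnorm \<xi> z < \<delta>\<rbrakk> \<Longrightarrow> z \<in> U"
    using nbhd_bzero [OF U s] by blast
  have "\<forall>\<^sub>F t in nhdsin T s. t \<in> W \<and> t \<in> topspace T"
    using W(1,2) by (intro eventually_conj eventually_nhdsin_openin eventually_nhdsin_topspace)
  then show "\<forall>\<^sub>F t in nhdsin T s. \<exists>u\<in>U \<inter> fiber \<xi> t. bnorm \<xi> (bdiff (bzero \<xi> t) u) \<le> 0"
  proof eventually_elim
    case (elim t)
    interpret B: banach_space_on "fiber \<xi> t" "badd \<xi>" "bscale \<xi>" "bzero \<xi> t" "bnorm \<xi>"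
      using elim fiber_banach by blast
    have "bzero \<xi> t \<in> U"
      using W(3,4) elim fiberD [OF B.zero_closed] by simp
    then show ?case
      by (intro bexI [of _ "bzero \<xi> t"]) auto
  qed
qed

lemma defect_at_badd:
  assumes f: "defect_at f \<rho> s" "\<forall>\<^sub>F t in nhdsin T s. f t \<in> fiber \<xi> t"
    and g: "defect_at g \<sigma> s" "\<forall>\<^sub>F t in nhdsin T s. g t \<in> fiber \<xi> t"
    and s: "s \<in> topspace T"
  shows "defect_at (\<lambda>t. badd \<xi> (f t) (g t)) (\<lambda>t. \<rho> t + \<sigma> t) s"
  unfolding defect_at_def
proof (intro allI impI)
  fix U assume "openin (btotal \<xi>) U \<and> badd \<xi> (f s) (g s) \<in> U"
  then have U: "openin (btotal \<xi>) U" "badd \<xi> (f s) (g s) \<in> U" by simp_all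
  have fs: "f s \<in> fiber \<xi> s" and gs: "g s \<in> fiber \<xi> s"
    using eventually_nhdsin_self [OF f(2) s] eventually_nhdsin_self [OF g(2) s] .
  have eq: "bproj \<xi> (f s) = bproj \<xi> (g s)"
    using fs gs by (simp add: fiber_def)
  obtain A B where AB: "openin (btotal \<xi>) A" "openin (btotal \<xi>) B" "f s \<in> A" "g s \<in> B"
    "\<And>a b. \<lbrakk>a \<in> A; b \<in> B; bproj \<xi> a = bproj \<xi> b\<rbrakk> \<Longrightarrow> badd \<xi> a b \<in> U"
    using badd_nbhd [OF U fiberD(1) [OF fs] fiberD(1) [OF gs] eq] by blast
  have "\<forall>\<^sub>F t in nhdsin T s. \<exists>u\<in>A \<inter> fiber \<xi> t. bnorm \<xi> (bdiff (f t) u) \<le> \<rho> t"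
    using f(1) AB by (simp add: defect_at_def)
  moreover have "\<forall>\<^sub>F t in nhdsin T s. \<exists>u\<in>B \<inter> fiber \<xi> t. bnorm \<xi> (bdiff (g t) u) \<le> \<sigma> t"
    using g(1) AB by (simp add: defect_at_def)
  ultimately show "\<forall>\<^sub>F t in nhdsin T s.
      \<exists>u\<in>U \<inter> fiber \<xi> t. bnorm \<xi> (bdiff (badd \<xi> (f t) (g t)) u) \<le> \<rho> t + \<sigma> t"
    using f(2) g(2) eventually_nhdsin_topspace
  proof eventually_elim
    case (elim t)
    then obtain u v where uv: "u \<in> A" "u \<in> fiber \<xi> t" "bnorm \<xi> (bdiff (f t) u) \<le> \<rho> t"
      "v \<in> B" "v \<in> fiber \<xi> t" "bnorm \<xi> (bdiff (g t) v) \<le> \<sigma> t" by blast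
    interpret B: banach_space_on "fiber \<xi> t" "badd \<xi>" "bscale \<xi>" "bzero \<xi> t" "bnorm \<xi>"
      using elim fiber_banach by blast
    have "bnorm \<xi> (bdiff (badd \<xi> (f t) (g t)) (badd \<xi> u v)) \<le> \<rho> t + \<sigma> t"
      using B.norm_triangle [of "bdiff (f t) u" "bdiff (g t) v"] uv elim by (simp add: B.diff_add_add)
    moreover have "badd \<xi> u v \<in> U"
      using AB(5) uv fiberD(2) by blast
    ultimately show ?case
      using uv by (intro bexI [of _ "badd \<xi> u v"]) auto
  qed
qed

lemma defect_at_bscale:
  assumes f: "defect_at f \<rho> s" "\<forall>\<^sub>F t in nhdsin T s. f t \<in> fiber \<xi> t"
    and h: "(h \<longlongrightarrow> h s) (nhdsin T s)" and s: "s \<in> topspace T"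
  shows "defect_at (\<lambda>t. bscale \<xi> (h t) (f t)) (\<lambda>t. norm (h t) * \<rho> t) s"
  unfolding defect_at_def
proof (intro allI impI)
  fix U assume "openin (btotal \<xi>) U \<and> bscale \<xi> (h s) (f s) \<in> U"
  then have U: "openin (btotal \<xi>) U" "bscale \<xi> (h s) (f s) \<in> U" by simp_all
  have fs: "f s \<in> fiber \<xi> s"
    using eventually_nhdsin_self [OF f(2) s] .
  obtain C A where CA: "open C" "openin (btotal \<xi>) A" "h s \<in> C" "f s \<in> A"
    "\<And>c' a. \<lbrakk>c' \<in> C; a \<in> A\<rbrakk> \<Longrightarrow> bscale \<xi> c' a \<in> U"
    using bscale_nbhd [OF U fiberD(1) [OF fs]] by blast
  have "\<forall>\<^sub>F t in nhdsin T s. \<exists>u\<in>A \<inter> fiber \<xi> t. bnorm \<xi> (bdiff (f t) u) \<le> \<rho> t"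
    using f(1) CA by (simp add: defect_at_def)
  moreover have "\<forall>\<^sub>F t in nhdsin T s. h t \<in> C"
    using h CA by (simp add: topological_tendstoD)
  ultimately show "\<forall>\<^sub>F t in nhdsin T s.
      \<exists>u\<in>U \<inter> fiber \<xi> t. bnorm \<xi> (bdiff (bscale \<xi> (h t) (f t)) u) \<le> norm (h t) * \<rho> t"
    using f(2) eventually_nhdsin_topspace
  proof eventually_elim
    case (elim t)
    then obtain u where u: "u \<in> A" "u \<in> fiber \<xi> t" "bnorm \<xi> (bdiff (f t) u) \<le> \<rho> t" by blast
    interpret B: banach_space_on "fiber \<xi> t" "badd \<xi>" "bscale \<xi>" "bzero \<xi> t" "bnorm \<xi>"
      using elim fiber_banach by blast
    have "bnorm \<xi> (bdiff (bscale \<xi> (h t) (f t)) (bscale \<xi> (h t) u)) \<le> norm (h t) * \<rho> t"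
      using u elim by (simp add: B.norm_scale mult_left_mono flip: B.scale_diff)
    moreover have "bscale \<xi> (h t) u \<in> U"
      using CA(5) u elim by blast
    ultimately show ?case
      using u by (intro bexI [of _ "bscale \<xi> (h t) u"]) auto
  qed
qed

text \<open>The error is averaged by the weights and does not accumulate: where the weights sum to
  1, the combination inherits the common bound, however many terms overlap.\<close>

lemma defect_at_fiber_sum:
  assumes "finite J" and s: "s \<in> topspace T"
    and "\<And>i. i \<in> J \<Longrightarrow> defect_at (f i) \<rho> s" "\<And>i. i \<in> J \<Longrightarrow> \<forall>\<^sub>F t in nhdsin T s. f i t \<in> fiber \<xi> t"
    and "\<And>i. i \<in> J \<Longrightarrow> (h i \<longlongrightarrow> h i s) (nhdsin T s)" "\<And>i t. (h i t :: real) \<ge> 0"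
  shows "defect_at (\<lambda>t. fiber_sum t (\<lambda>i. bscale \<xi> (of_real (h i t)) (f i t)) J)
           (\<lambda>t. (\<Sum>i\<in>J. h i t) * \<rho> t) s"
  using assms(1,3-)
proof (induction J)
  case empty
  have "\<forall>\<^sub>F t in nhdsin T s. bzero \<xi> t = fiber_sum t (\<lambda>i. bscale \<xi> (of_real (h i t)) (f i t)) {} \<and> 0 \<le> 0 * \<rho> t"
    using eventually_nhdsin_topspace
    by eventually_elim (simp add: banach_space_on.vsum_empty [OF fiber_banach])
  from defect_at_cong [OF defect_at_bzero [OF s] this s] show ?case by simp
next
  case (insert i J)
  let ?F = "\<lambda>J t. fiber_sum t (\<lambda>i. bscale \<xi> (of_real (h i t)) (f i t)) J"
  have 1: "defect_at (\<lambda>t. bscale \<xi> (of_real (h i t)) (f i t)) (\<lambda>t. norm (of_real (h i t) :: 'k) * \<rho> t) s"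
    using insert.prems s by (intro defect_at_bscale tendsto_of_real) auto
  have fib: "\<forall>\<^sub>F t in nhdsin T s. t \<in> topspace T \<and> f i t \<in> fiber \<xi> t"
    using insert.prems eventually_nhdsin_topspace by (intro eventually_conj) auto
  then have 2: "\<forall>\<^sub>F t in nhdsin T s. bscale \<xi> (of_real (h i t)) (f i t) \<in> fiber \<xi> t"
    by eventually_elim (simp add: banach_space_on.scale_closed [OF fiber_banach])
  have 3: "defect_at (?F J) (\<lambda>t. (\<Sum>i\<in>J. h i t) * \<rho> t) s"
    using insert by simp
  have 4: "\<forall>\<^sub>F t in nhdsin T s. ?F J t \<in> fiber \<xi> t"
    using eventually_nhdsin_topspace
    by eventually_elim (simp add: banach_space_on.vsum_closed [OF fiber_banach])
  have 5: "\<forall>\<^sub>F t in nhdsin T s. badd \<xi> (bscale \<xi> (of_real (h i t)) (f i t)) (?F J t) = ?F (insert i J) t \<and>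
      norm (of_real (h i t) :: 'k) * \<rho> t + (\<Sum>i\<in>J. h i t) * \<rho> t \<le> (\<Sum>i\<in>insert i J. h i t) * \<rho> t"
    using fib
  proof eventually_elim
    case (elim t)
    interpret B: banach_space_on "fiber \<xi> t" "badd \<xi>" "bscale \<xi>" "bzero \<xi> t" "bnorm \<xi>"
      using elim fiber_banach by blast
    show ?case
      using elim insert.hyps insert.prems(4) by (simp add: algebra_simps)
  qed
  show ?case
    by (rule defect_at_cong [OF defect_at_badd [OF 1 2 3 4 s] 5 s])
qed

lemma defect_at_continuous_map:
  assumes f: "continuous_map T (btotal \<xi>) f" "\<And>t. t \<in> topspace T \<Longrightarrow> f t \<in> fiber \<xi> t"
    and s: "s \<in> topspace T"
  shows "defect_at f (\<lambda>_. 0) s"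
  unfolding defect_at_def
proof (intro allI impI)
  fix U assume U: "openin (btotal \<xi>) U \<and> f s \<in> U"
  then have "openin T {t \<in> topspace T. f t \<in> U}"
    using f(1) openin_continuous_map_preimage by blast
  then have "\<forall>\<^sub>F t in nhdsin T s. t \<in> {t \<in> topspace T. f t \<in> U}"
    using U s by (intro eventually_nhdsin_openin) auto
  then show "\<forall>\<^sub>F t in nhdsin T s. \<exists>u\<in>U \<inter> fiber \<xi> t. bnorm \<xi> (bdiff (f t) u) \<le> 0"
  proof eventually_elim
    case (elim t)
    interpret B: banach_space_on "fiber \<xi> t" "badd \<xi>" "bscale \<xi>" "bzero \<xi> t" "bnorm \<xi>"
      using elim fiber_banach by blast
    show ?case
      using elim f(2) by (intro bexI [of _ "f t"]) auto
  qed
qed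

text \<open>A uniform limit theorem whose approximants are themselves only nearly continuous. It
  serves the limit of the selection iteration, the description of sections by zero defect, and
  uniform limits of sections.\<close>

lemma continuous_map_of_defects:
  assumes f: "\<And>t. t \<in> topspace T \<Longrightarrow> f t \<in> fiber \<xi> t"
    and approx: "\<And>e. e > 0 \<Longrightarrow> \<exists>g. (\<forall>t\<in>topspace T. g t \<in> fiber \<xi> t) \<and> (\<forall>s\<in>topspace T. defect_at g (\<lambda>_. e) s) \<and>
        (\<forall>t\<in>topspace T. bnorm \<xi> (bdiff (f t) (g t)) \<le> e)"
  shows "continuous_map T (btotal \<xi>) f"
proof -
  have ev: "\<forall>\<^sub>F t in nhdsin T s. f t \<in> U" if s: "s \<in> topspace T" and U: "openin (btotal \<xi>) U" "f s \<in> U" for s U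
  proof -
    obtain U' \<delta> where U': "openin (btotal \<xi>) U'" "f s \<in> U'" "\<delta> > 0"
      "\<And>u w. \<lbrakk>u \<in> U'; w \<in> fiber \<xi> (bproj \<xi> u); bnorm \<xi> (bdiff w u) < \<delta>\<rbrakk> \<Longrightarrow> w \<in> U"
      using nbhd_norm_uniform [OF U] by blast
    \<comment> \<open>The defect of \<open>g\<close> is tested on neighbourhoods of
      \<open>g s\<close>, not of \<open>f s\<close>; the second shrinking ensures that
      \<open>U'\<close> contains \<open>g s\<close> too.\<close>
    obtain U'' \<delta>' where U'': "openin (btotal \<xi>) U''" "f s \<in> U''" "\<delta>' > 0"
      "\<And>u w. \<lbrakk>u \<in> U''; w \<in> fiber \<xi> (bproj \<xi> u); bnorm \<xi> (bdiff w u) < \<delta>'\<rbrakk> \<Longrightarrow> w \<in> U'"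
      using nbhd_norm_uniform [OF U'(1,2)] by blast
    \<comment> \<open>\<open>2 * e < \<delta>\<close> covers the way from \<open>f t\<close> through
      \<open>g t\<close> to \<open>u\<close>, and \<open>e < \<delta>'\<close> the step from
      \<open>f s\<close> to \<open>g s\<close>.\<close>
    define e where "e = min (\<delta> / 3) (\<delta>' / 2)"
    have e: "e > 0" "2 * e < \<delta>" "e < \<delta>'" using U'(3) U''(3) by (auto simp: e_def)
    obtain g where g: "\<And>t. t \<in> topspace T \<Longrightarrow> g t \<in> fiber \<xi> t" "defect_at g (\<lambda>_. e) s"
        "\<And>t. t \<in> topspace T \<Longrightarrow> bnorm \<xi> (bdiff (f t) (g t)) \<le> e"
      using approx [OF e(1)] s by blast
    interpret S: banach_space_on "fiber \<xi> s" "badd \<xi>" "bscale \<xi>" "bzero \<xi> s" "bnorm \<xi>"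
      using s fiber_banach by blast
    have "g s \<in> U'"
      using U''(4) [of "f s" "g s"] U''(2) g(1,3) [OF s] e f [OF s] fiberD(2) [OF f [OF s]]
        S.norm_diff_commute [of "f s" "g s"] by simp
    then have "\<forall>\<^sub>F t in nhdsin T s. \<exists>u\<in>U' \<inter> fiber \<xi> t. bnorm \<xi> (bdiff (g t) u) \<le> e"
      using g(2) U'(1) by (simp add: defect_at_def)
    then show ?thesis
      using eventually_nhdsin_topspace
    proof eventually_elim
      case (elim t)
      then obtain u where u: "u \<in> U'" "u \<in> fiber \<xi> t" "bnorm \<xi> (bdiff (g t) u) \<le> e" by blast
      interpret B: banach_space_on "fiber \<xi> t" "badd \<xi>" "bscale \<xi>" "bzero \<xi> t" "bnorm \<xi>"
        using elim fiber_banach by blast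
      have "bnorm \<xi> (bdiff (f t) u) < \<delta>"
        using B.norm_diff_triangle [of "f t" "g t" u] f g u elim e by fastforce
      then show ?case
        using U'(4) [of u "f t"] u f elim fiberD(2) by auto
    qed
  qed
  have "openin T {t \<in> topspace T. f t \<in> U}" if "openin (btotal \<xi>) U" for U
    using ev that by (intro openin_eventually_nhdsin) (auto intro!: eventually_conj eventually_nhdsin_topspace)
  then show ?thesis
    using f fiberD(1) by (auto simp: continuous_map_def)
qed

end

section \<open>Continuous selections\<close>

context banach_bundle
begin

definition fiberwise_lsc :: "('t \<Rightarrow> 'e set) \<Rightarrow> bool" where
  "fiberwise_lsc \<Phi> \<longleftrightarrow> (\<forall>U. openin (btotal \<xi>) U \<longrightarrow> openin T {t \<in> topspace T. \<Phi> t \<inter> U \<noteq> {}})"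

lemma fiber_convexD: "\<lbrakk>t \<in> topspace T; fiber_convex t C\<rbrakk> \<Longrightarrow> C \<subseteq> fiber \<xi> t"
  by (simp add: banach_space_on.convex_in_def [OF fiber_banach])

text \<open>One step of the selection iteration. The distance estimate is conditional on the defect
  of \<open>f\<close>, so that the same lemma also starts the iteration, where \<open>f\<close> is
  an arbitrary pointwise choice.\<close>

lemma selection_refinement:
  assumes T: "paracompact_Hausdorff_space T"
    and convex: "\<And>t. t \<in> topspace T \<Longrightarrow> fiber_convex t (\<Phi> t)" and lsc: "fiberwise_lsc \<Phi>"
    and f: "\<And>t. t \<in> topspace T \<Longrightarrow> f t \<in> \<Phi> t" and e: "e > 0"
  obtains g where "\<And>t. t \<in> topspace T \<Longrightarrow> g t \<in> \<Phi> t" "\<And>s. s \<in> topspace T \<Longrightarrow> defect_at g (\<lambda>_. e) s"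
    "\<And>t. \<lbrakk>t \<in> topspace T; \<forall>s\<in>topspace T. defect_at f (\<lambda>_. d) s\<rbrakk> \<Longrightarrow> bnorm \<xi> (bdiff (g t) (f t)) \<le> d + e"
proof -
  have \<Phi>: "\<Phi> t \<subseteq> fiber \<xi> t" if "t \<in> topspace T" for t
    using fiber_convexD convex that by blast
  have fib: "f t \<in> fiber \<xi> t" if "t \<in> topspace T" for t
    using \<Phi> f that by blast
  \<comment> \<open>Vacuous when \<open>f\<close> does not have defect \<open>d\<close> everywhere,
    so that one choice of neighbourhoods serves both uses of the lemma.\<close>
  define close where "close V t \<longleftrightarrow> (\<forall>s\<in>topspace T. defect_at f (\<lambda>_. d) s) \<longrightarrow>
      (\<exists>u\<in>V \<inter> fiber \<xi> t. bnorm \<xi> (bdiff (f t) u) \<le> d)" for V t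
  have "\<exists>V N. openin (btotal \<xi>) V \<and> openin T N \<and> s \<in> N \<and> (\<forall>t\<in>N. \<Phi> t \<inter> V \<noteq> {} \<and> close V t) \<and>
      (\<forall>u\<in>V. \<forall>w\<in>V. bproj \<xi> u = bproj \<xi> w \<longrightarrow> bnorm \<xi> (bdiff u w) < e)"
    if s: "s \<in> topspace T" for s
  proof -
    obtain V where V: "openin (btotal \<xi>) V" "f s \<in> V"
      "\<And>u w. \<lbrakk>u \<in> V; w \<in> V; bproj \<xi> u = bproj \<xi> w\<rbrakk> \<Longrightarrow> bnorm \<xi> (bdiff u w) < e"
      using thin_nbhd [OF fiberD(1) [OF fib [OF s]] e] by blast
    have "openin T {t \<in> topspace T. \<Phi> t \<inter> V \<noteq> {}}"
      using lsc V(1) by (simp add: fiberwise_lsc_def)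
    moreover have "s \<in> {t \<in> topspace T. \<Phi> t \<inter> V \<noteq> {}}"
      using s f V(2) by blast
    ultimately have "\<forall>\<^sub>F t in nhdsin T s. t \<in> {t \<in> topspace T. \<Phi> t \<inter> V \<noteq> {}}"
      by (rule eventually_nhdsin_openin)
    moreover have "\<forall>\<^sub>F t in nhdsin T s. close V t"
    proof (cases "\<forall>s\<in>topspace T. defect_at f (\<lambda>_. d) s")
      case True
      then have "\<forall>\<^sub>F t in nhdsin T s. \<exists>u\<in>V \<inter> fiber \<xi> t. bnorm \<xi> (bdiff (f t) u) \<le> d"
        using V s by (simp add: defect_at_def)
      then show ?thesis by eventually_elim (simp add: close_def)
    qed (auto simp: close_def)
    ultimately have "\<forall>\<^sub>F t in nhdsin T s. \<Phi> t \<inter> V \<noteq> {} \<and> close V t"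
      by eventually_elim simp
    then obtain N where "openin T N" "s \<in> N" "\<forall>t\<in>N. \<Phi> t \<inter> V \<noteq> {} \<and> close V t"
      using s unfolding eventually_nhdsin by blast
    with V(1,3) show ?thesis by (intro exI [of _ V] exI [of _ N]) blast
  qed
  then have "\<forall>s\<in>topspace T. \<exists>V N. openin (btotal \<xi>) V \<and> openin T N \<and> s \<in> N \<and>
      (\<forall>t\<in>N. \<Phi> t \<inter> V \<noteq> {} \<and> close V t) \<and>
      (\<forall>u\<in>V. \<forall>w\<in>V. bproj \<xi> u = bproj \<xi> w \<longrightarrow> bnorm \<xi> (bdiff u w) < e)"
    by blast
  from bchoice [OF this] obtain V where
    "\<forall>s\<in>topspace T. \<exists>N. openin (btotal \<xi>) (V s) \<and> openin T N \<and> s \<in> N \<and>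
      (\<forall>t\<in>N. \<Phi> t \<inter> V s \<noteq> {} \<and> close (V s) t) \<and>
      (\<forall>u\<in>V s. \<forall>w\<in>V s. bproj \<xi> u = bproj \<xi> w \<longrightarrow> bnorm \<xi> (bdiff u w) < e)" ..
  from bchoice [OF this] obtain N where
    "\<forall>s\<in>topspace T. openin (btotal \<xi>) (V s) \<and> openin T (N s) \<and> s \<in> N s \<and>
      (\<forall>t\<in>N s. \<Phi> t \<inter> V s \<noteq> {} \<and> close (V s) t) \<and>
      (\<forall>u\<in>V s. \<forall>w\<in>V s. bproj \<xi> u = bproj \<xi> w \<longrightarrow> bnorm \<xi> (bdiff u w) < e)" ..
  then have V: "\<And>s. s \<in> topspace T \<Longrightarrow> openin (btotal \<xi>) (V s)"
    and N: "\<And>s. s \<in> topspace T \<Longrightarrow> openin T (N s) \<and> s \<in> N s"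
    and VN: "\<And>s t. \<lbrakk>s \<in> topspace T; t \<in> N s\<rbrakk> \<Longrightarrow> \<Phi> t \<inter> V s \<noteq> {} \<and> close (V s) t"
    and thin: "\<And>s u w. \<lbrakk>s \<in> topspace T; u \<in> V s; w \<in> V s; bproj \<xi> u = bproj \<xi> w\<rbrakk> \<Longrightarrow> bnorm \<xi> (bdiff u w) < e"
    by simp_all
  obtain I :: "'t set set" and c and h :: "'t set \<Rightarrow> 't \<Rightarrow> real" where
    c: "\<And>i. i \<in> I \<Longrightarrow> c i \<in> topspace T" and h0: "\<And>i t. h i t \<ge> 0"
    and h: "\<And>i s. \<lbrakk>i \<in> I; s \<in> topspace T\<rbrakk> \<Longrightarrow> (h i \<longlongrightarrow> h i s) (nhdsin T s)"
    and loc: "\<And>s. s \<in> topspace T \<Longrightarrow> \<exists>J\<subseteq>I. finite J \<and> (\<forall>i\<in>J. s \<in> N (c i)) \<and>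
        (\<forall>\<^sub>F t in nhdsin T s. (\<forall>i\<in>I - J. h i t = 0) \<and> (\<Sum>i\<in>J. h i t) = 1)"
    using paracompact_partition_of_unity [OF T N] by blast
  \<comment> \<open>A discontinuous local selection: any point of \<open>\<Phi> t\<close> in the
    thin set will do, since two such points differ by less than \<open>e\<close>.\<close>
  define w where "w i t = (SOME x. x \<in> \<Phi> t \<inter> V (c i))" for i t
  have w: "w i t \<in> \<Phi> t" "w i t \<in> V (c i)" "w i t \<in> fiber \<xi> t" "t \<in> topspace T"
    if "i \<in> I" "t \<in> N (c i)" for i t
  proof -
    have "\<exists>x. x \<in> \<Phi> t \<inter> V (c i)"
      using VN [OF c [OF that(1)] that(2)] by blast
    then have "w i t \<in> \<Phi> t \<inter> V (c i)"
      unfolding w_def by (rule someI_ex)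
    moreover show "t \<in> topspace T"
      using openin_subset [OF conjunct1 [OF N [OF c [OF that(1)]]]] that(2) by blast
    ultimately show "w i t \<in> \<Phi> t" "w i t \<in> V (c i)" "w i t \<in> fiber \<xi> t"
      using \<Phi> by blast+
  qed
  define g where "g t = fiber_sum t (\<lambda>i. bscale \<xi> (of_real (h i t)) (w i t)) {i \<in> I. h i t \<noteq> 0}" for t
  \<comment> \<open>Near \<open>s\<close> the index set that varies with \<open>t\<close> is
    replaced by one fixed finite \<open>J\<close>, as the lemma on defects of sums requires. Indices
    of \<open>J\<close> with weight 0 at \<open>t\<close> add nothing.\<close>
  have gJ: "\<exists>J\<subseteq>I. finite J \<and> (\<forall>\<^sub>F t in nhdsin T s. (\<forall>i\<in>J. t \<in> N (c i)) \<and> (\<Sum>i\<in>J. h i t) = 1 \<and>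
      g t = fiber_sum t (\<lambda>i. bscale \<xi> (of_real (h i t)) (w i t)) J)"
    if s: "s \<in> topspace T" for s
  proof -
    obtain J where J: "J \<subseteq> I" "finite J" "\<And>i. i \<in> J \<Longrightarrow> s \<in> N (c i)"
      "\<forall>\<^sub>F t in nhdsin T s. (\<forall>i\<in>I - J. h i t = 0) \<and> (\<Sum>i\<in>J. h i t) = 1"
      using loc [OF s] by blast
    have "\<forall>\<^sub>F t in nhdsin T s. t \<in> N (c i)" if "i \<in> J" for i
      using J(1) J(3) [OF that] that N c by (intro eventually_nhdsin_openin) blast+
    then have "\<forall>\<^sub>F t in nhdsin T s. \<forall>i\<in>J. t \<in> N (c i)"
      using J(2) by (simp add: eventually_ball_finite_distrib)
    then have "\<forall>\<^sub>F t in nhdsin T s. (\<forall>i\<in>J. t \<in> N (c i)) \<and> (\<Sum>i\<in>J. h i t) = 1 \<and>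
      g t = fiber_sum t (\<lambda>i. bscale \<xi> (of_real (h i t)) (w i t)) J"
      using J(4) eventually_nhdsin_topspace
    proof eventually_elim
      case (elim t)
      interpret B: banach_space_on "fiber \<xi> t" "badd \<xi>" "bscale \<xi>" "bzero \<xi> t" "bnorm \<xi>"
        using elim fiber_banach by blast
      have "B.vsum (\<lambda>i. bscale \<xi> (of_real (h i t)) (w i t)) J
          = B.vsum (\<lambda>i. bscale \<xi> (of_real (h i t)) (w i t)) {i \<in> I. h i t \<noteq> 0}"
      proof (rule B.vsum_mono_neutral [OF J(2)])
        show "{i \<in> I. h i t \<noteq> 0} \<subseteq> J" using elim by blast
        fix i assume i: "i \<in> J - {i \<in> I. h i t \<noteq> 0}"
        then have "i \<in> I" "h i t = 0" "t \<in> N (c i)" using J(1) elim by auto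
        then show "bscale \<xi> (of_real (h i t)) (w i t) = bzero \<xi> t"
          using w(3) by simp
      qed
      with elim show ?case by (simp add: g_def)
    qed
    with J show ?thesis by blast
  qed
  \<comment> \<open>Each value of \<open>g\<close> is a convex combination of admissible points
    \<open>w i t\<close>. This is applied to \<open>\<Phi> t\<close> for membership and to a closed
    ball around \<open>f t\<close> for the distance.\<close>
  have in_convex: "g t \<in> C"
    if t: "t \<in> topspace T" and C: "fiber_convex t C" and wC: "\<And>i. \<lbrakk>i \<in> I; t \<in> N (c i)\<rbrakk> \<Longrightarrow> w i t \<in> C" for t C
  proof -
    interpret B: banach_space_on "fiber \<xi> t" "badd \<xi>" "bscale \<xi>" "bzero \<xi> t" "bnorm \<xi>"
      using t fiber_banach by blast
    obtain J where J: "J \<subseteq> I" "finite J" "\<forall>\<^sub>F t in nhdsin T t. (\<forall>i\<in>J. t \<in> N (c i)) \<and> (\<Sum>i\<in>J. h i t) = 1 \<and>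
      g t = fiber_sum t (\<lambda>i. bscale \<xi> (of_real (h i t)) (w i t)) J"
      using gJ [OF t] by blast
    have Jt: "(\<forall>i\<in>J. t \<in> N (c i)) \<and> (\<Sum>i\<in>J. h i t) = 1 \<and>
      g t = fiber_sum t (\<lambda>i. bscale \<xi> (of_real (h i t)) (w i t)) J"
      by (rule eventually_nhdsin_self [OF J(3) t])
    then have "fiber_sum t (\<lambda>i. bscale \<xi> (of_real (h i t)) (w i t)) J \<in> C"
      using J(1,2) wC h0 by (intro B.convex_in_vsum [OF C]) auto
    with Jt show ?thesis by simp
  qed
  show thesis
  proof (rule that)
    show "g t \<in> \<Phi> t" if "t \<in> topspace T" for t
      by (rule in_convex [OF that convex [OF that]]) (rule w(1))
    show "bnorm \<xi> (bdiff (g t) (f t)) \<le> d + e"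
      if t: "t \<in> topspace T" and all: "\<forall>s\<in>topspace T. defect_at f (\<lambda>_. d) s" for t
    proof -
      interpret B: banach_space_on "fiber \<xi> t" "badd \<xi>" "bscale \<xi>" "bzero \<xi> t" "bnorm \<xi>"
        using t fiber_banach by blast
      have "w i t \<in> {x \<in> fiber \<xi> t. bnorm \<xi> (bdiff x (f t)) \<le> d + e}" if i: "i \<in> I" "t \<in> N (c i)" for i
      proof -
        \<comment> \<open>\<open>close\<close> provides a point of the same thin set within
          \<open>d\<close> of \<open>f t\<close>; thinness costs another \<open>e\<close>.\<close>
        obtain u where u: "u \<in> V (c i)" "u \<in> fiber \<xi> t" "bnorm \<xi> (bdiff (f t) u) \<le> d"
          using VN [OF c [OF i(1)] i(2)] all unfolding close_def by blast
        have "bproj \<xi> (w i t) = bproj \<xi> u"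
          using fiberD(2) [OF u(2)] fiberD(2) [OF w(3) [OF i]] by simp
        then have "bnorm \<xi> (bdiff (w i t) u) < e"
          using thin [OF c [OF i(1)] w(2) [OF i] u(1)] by simp
        then have "bnorm \<xi> (bdiff (w i t) (f t)) \<le> d + e"
          using B.norm_diff_triangle [OF w(3) [OF i] u(2) fib [OF t]]
            B.norm_diff_commute [OF u(2) fib [OF t]] u(3) by simp
        then show ?thesis using w(3) [OF i] by simp
      qed
      then have "g t \<in> {x \<in> fiber \<xi> t. bnorm \<xi> (bdiff x (f t)) \<le> d + e}"
        by (rule in_convex [OF t B.convex_in_cball [OF fib [OF t]]])
      then show ?thesis by simp
    qed
    show "defect_at g (\<lambda>_. e) s" if s: "s \<in> topspace T" for s
    proof -
      obtain J where J: "J \<subseteq> I" "finite J" "\<forall>\<^sub>F t in nhdsin T s. (\<forall>i\<in>J. t \<in> N (c i)) \<and> (\<Sum>i\<in>J. h i t) = 1 \<and>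
        g t = fiber_sum t (\<lambda>i. bscale \<xi> (of_real (h i t)) (w i t)) J"
        using gJ [OF s] by blast
      \<comment> \<open>As the projection is open, all fibers over a neighbourhood of
        \<open>s\<close> meet \<open>U \<inter> V (c i)\<close>; a point there and
        \<open>w i t\<close> lie in one thin set, whatever choices \<open>w\<close> makes.\<close>
      have defect_w: "defect_at (w i) (\<lambda>_. e) s" if i: "i \<in> I" "s \<in> N (c i)" for i
        unfolding defect_at_def
      proof (intro allI impI)
        fix U assume U: "openin (btotal \<xi>) U \<and> w i s \<in> U"
        have "openin T (bproj \<xi> ` (U \<inter> V (c i)))"
          using U V [OF c [OF i(1)]] by (intro openin_proj_image) blast
        moreover have "s \<in> bproj \<xi> ` (U \<inter> V (c i))"
          using U w(2) [OF i] fiberD(2) [OF w(3) [OF i]] by (intro image_eqI [of _ _ "w i s"]) auto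
        ultimately have "\<forall>\<^sub>F t in nhdsin T s. t \<in> bproj \<xi> ` (U \<inter> V (c i))"
          by (rule eventually_nhdsin_openin)
        moreover have "\<forall>\<^sub>F t in nhdsin T s. t \<in> N (c i)"
          using i N c by (intro eventually_nhdsin_openin) blast+
        ultimately show "\<forall>\<^sub>F t in nhdsin T s. \<exists>u\<in>U \<inter> fiber \<xi> t. bnorm \<xi> (bdiff (w i t) u) \<le> e"
        proof eventually_elim
          case (elim t)
          then obtain u where u: "u \<in> U" "u \<in> V (c i)" "t = bproj \<xi> u" by blast
          have "u \<in> fiber \<xi> t"
            using openin_mem_fiber U u by blast
          moreover have "bnorm \<xi> (bdiff (w i t) u) < e"
            using thin [OF c [OF i(1)] w(2) [OF i(1) elim(2)] u(2)] fiberD(2) [OF w(3) [OF i(1) elim(2)]] u(3)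
            by simp
          ultimately show ?case using u by (intro bexI [of _ u]) auto
        qed
      qed
      have Js: "i \<in> I \<and> s \<in> N (c i)" if "i \<in> J" for i
        using eventually_nhdsin_self [OF J(3) s] J(1) that by blast
      have 1: "\<forall>\<^sub>F t in nhdsin T s. w i t \<in> fiber \<xi> t" if "i \<in> J" for i
        using J(3)
        by eventually_elim (use J(1) that w(3) in blast)
      have 2: "defect_at (\<lambda>t. fiber_sum t (\<lambda>i. bscale \<xi> (of_real (h i t)) (w i t)) J)
           (\<lambda>t. (\<Sum>i\<in>J. h i t) * e) s"
        using Js 1 defect_w h0 h s by (intro defect_at_fiber_sum J(2)) auto
      \<comment> \<open>The weights sum to 1 near \<open>s\<close>, so the averaged error is again
        \<open>e\<close>.\<close>
      have "\<forall>\<^sub>F t in nhdsin T s. fiber_sum t (\<lambda>i. bscale \<xi> (of_real (h i t)) (w i t)) J = g t \<and>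
          (\<Sum>i\<in>J. h i t) * e \<le> e"
        using J(3) by eventually_elim simp
      from defect_at_cong [OF 2 this s] show ?thesis .
    qed
  qed
qed

text \<open>
  A Michael selection theorem. As the values of \<open>\<Phi>\<close> are not assumed closed, the section is only
  found in their norm closures.
\<close>

theorem continuous_selection:
  assumes T: "paracompact_Hausdorff_space T"
    and convex: "\<And>t. t \<in> topspace T \<Longrightarrow> fiber_convex t (\<Phi> t)" and lsc: "fiberwise_lsc \<Phi>"
    and ne: "\<And>t. t \<in> topspace T \<Longrightarrow> \<Phi> t \<noteq> {}"
  obtains f where "f \<in> bundle_sections T \<xi>"
    "\<And>t e. \<lbrakk>t \<in> topspace T; e > 0\<rbrakk> \<Longrightarrow> \<exists>x\<in>\<Phi> t. bnorm \<xi> (bdiff (f t) x) < e"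
proof -
  define sel where "sel g \<longleftrightarrow> (\<forall>t\<in>topspace T. g t \<in> \<Phi> t)" for g
  \<comment> \<open>Refinement with \<open>e = 1 / 2 ^ n\<close> and \<open>d = 2 / 2 ^ n\<close>,
    whence \<open>d + e = 3 / 2 ^ n\<close>. For positive \<open>n\<close> the bound
    \<open>d\<close> is the defect \<open>1 / 2 ^ (n - 1)\<close> of the previous stage; at
    \<open>n = 0\<close> the premise may fail.\<close>
  define Q where "Q n f g \<longleftrightarrow> sel g \<and> (\<forall>s\<in>topspace T. defect_at g (\<lambda>_. 1 / 2 ^ n) s) \<and>
     ((\<forall>s\<in>topspace T. defect_at f (\<lambda>_. 2 / 2 ^ n) s) \<longrightarrow>
        (\<forall>t\<in>topspace T. bnorm \<xi> (bdiff (g t) (f t)) \<le> 3 / 2 ^ n))" for n f g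
  have step: "\<exists>g. Q n f g" if f: "sel f" for f n
  proof -
    have f: "f t \<in> \<Phi> t" if "t \<in> topspace T" for t using f that by (simp add: sel_def)
    have e: "(1 / 2 ^ n :: real) > 0" by simp
    obtain g where "\<And>t. t \<in> topspace T \<Longrightarrow> g t \<in> \<Phi> t" "\<And>s. s \<in> topspace T \<Longrightarrow> defect_at g (\<lambda>_. 1 / 2 ^ n) s"
      "\<And>t. \<lbrakk>t \<in> topspace T; \<forall>s\<in>topspace T. defect_at f (\<lambda>_. 2 / 2 ^ n) s\<rbrakk>
        \<Longrightarrow> bnorm \<xi> (bdiff (g t) (f t)) \<le> 2 / 2 ^ n + 1 / 2 ^ n"
      using selection_refinement [where f = f and \<Phi> = \<Phi> and d = "2 / 2 ^ n", OF T convex lsc f e] by blast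
    then show ?thesis
      by (intro exI [of _ g]) (simp add: Q_def sel_def flip: add_divide_distrib)
  qed
  define G where "G = rec_nat (\<lambda>t. SOME x. x \<in> \<Phi> t) (\<lambda>n f. SOME g. Q n f g)"
  have sel_G: "sel (G n)" for n
  proof (induction n)
    case 0
    then show ?case using ne by (simp add: sel_def G_def some_in_eq)
  next
    case (Suc n)
    then show ?case
      using someI_ex [OF step [OF Suc, of n]] by (simp add: G_def Q_def)
  qed
  have Q_G: "Q n (G n) (G (Suc n))" for n
    using someI_ex [OF step [OF sel_G, of n n]] by (simp add: G_def)
  have \<Phi>: "\<Phi> t \<subseteq> fiber \<xi> t" if "t \<in> topspace T" for t
    using fiber_convexD convex that by blast
  have fib: "G n t \<in> fiber \<xi> t" if "t \<in> topspace T" for n t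
    using \<Phi> sel_G that unfolding sel_def by blast
  have defect: "defect_at (G (Suc n)) (\<lambda>_. 1 / 2 ^ n) s" if "s \<in> topspace T" for n s
    using Q_G that by (simp add: Q_def)
  \<comment> \<open>The sequence is used from index 1 on, as \<open>G 0\<close> is an arbitrary
    choice at no known distance from \<open>G 1\<close>. Here \<open>3 / 2 ^ (n + 1)\<close> is
    written as \<open>(3 / 2) / 2 ^ n\<close>, and the limit lemma doubles the constant to
    3.\<close>
  have dist: "bnorm \<xi> (bdiff (G (Suc (Suc n)) t) (G (Suc n) t)) \<le> 3 / 2 / 2 ^ n" if "t \<in> topspace T" for n t
    using Q_G [of "Suc n"] defect [of _ n] that by (simp add: Q_def)
  have "\<exists>l\<in>fiber \<xi> t. \<forall>n. bnorm \<xi> (bdiff (G (Suc n) t) l) \<le> 3 / 2 ^ n" if t: "t \<in> topspace T" for t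
  proof -
    interpret B: banach_space_on "fiber \<xi> t" "badd \<xi>" "bscale \<xi>" "bzero \<xi> t" "bnorm \<xi>"
      using t fiber_banach by blast
    obtain l where "l \<in> fiber \<xi> t" "\<And>n. bnorm \<xi> (bdiff (G (Suc n) t) l) \<le> 2 * (3 / 2) / 2 ^ n"
      using B.geometric_Cauchy_limit [of "\<lambda>n. G (Suc n) t" "3/2"] fib [OF t] dist [OF t] by blast
    then show ?thesis by auto
  qed
  then have "\<forall>t\<in>topspace T. \<exists>l. l \<in> fiber \<xi> t \<and> (\<forall>n. bnorm \<xi> (bdiff (G (Suc n) t) l) \<le> 3 / 2 ^ n)"
    by blast
  from bchoice [OF this] obtain l where
    l: "\<And>t. t \<in> topspace T \<Longrightarrow> l t \<in> fiber \<xi> t"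
       "\<And>t n. t \<in> topspace T \<Longrightarrow> bnorm \<xi> (bdiff (G (Suc n) t) (l t)) \<le> 3 / 2 ^ n"
    by blast
  define f where "f = restrict l (topspace T)"
  have f: "f t \<in> fiber \<xi> t" if "t \<in> topspace T" for t
    using l(1) that by (simp add: f_def)
  have fG: "bnorm \<xi> (bdiff (f t) (G (Suc n) t)) \<le> 3 / 2 ^ n" if t: "t \<in> topspace T" for t n
    using l [OF t] banach_space_on.norm_diff_commute [OF fiber_banach [OF t] f [OF t] fib [OF t]] t
    by (simp add: f_def)
  have small: "\<exists>n. 3 / 2 ^ n < e" if "e > 0" for e :: real
    using order_tendstoD(2) [OF LIMSEQ_divide_realpow_zero [of 2 3] that]
    by (auto simp: eventually_sequentially)
  have "continuous_map T (btotal \<xi>) f"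
  proof (rule continuous_map_of_defects [OF f])
    fix e :: real assume "e > 0"
    then obtain n where n: "3 / 2 ^ n < e" using small by blast
    have "(1 :: real) / 2 ^ n \<le> 3 / 2 ^ n"
      by (intro divide_right_mono) auto
    with n have n1: "1 / 2 ^ n \<le> e" by linarith
    have "defect_at (G (Suc n)) (\<lambda>_. e) s" if s: "s \<in> topspace T" for s
      by (rule defect_at_cong [OF defect [OF s, of n] _ s]) (simp add: n1)
    moreover have "bnorm \<xi> (bdiff (f t) (G (Suc n) t)) \<le> e" if "t \<in> topspace T" for t
      using fG [OF that, of n] n by linarith
    ultimately show "\<exists>g. (\<forall>t\<in>topspace T. g t \<in> fiber \<xi> t) \<and> (\<forall>s\<in>topspace T. defect_at g (\<lambda>_. e) s) \<and>
        (\<forall>t\<in>topspace T. bnorm \<xi> (bdiff (f t) (g t)) \<le> e)"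
      using fib by blast
  qed
  then have "f \<in> bundle_sections T \<xi>"
    using fiberD(2) [OF f] by (auto simp: bundle_sections_def f_def)
  moreover have "\<exists>x\<in>\<Phi> t. bnorm \<xi> (bdiff (f t) x) < e" if t: "t \<in> topspace T" and e: "e > 0" for t e
  proof -
    obtain n where n: "3 / 2 ^ n < e" using small e by blast
    have "G (Suc n) t \<in> \<Phi> t" using sel_G t by (simp add: sel_def)
    moreover have "bnorm \<xi> (bdiff (f t) (G (Suc n) t)) < e" using fG [OF t, of n] n by linarith
    ultimately show ?thesis by blast
  qed
  ultimately show thesis using that by blast
qed

end

section \<open>The space of bounded sections\<close>

context banach_bundle
begin

text \<open>Zero defect everywhere amounts to continuity. In this form the stability of sections
  under addition and scalar multiples is read off from the calculus of defects.\<close>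

lemma bundle_sections_iff:
  "f \<in> bundle_sections T \<xi> \<longleftrightarrow> f \<in> extensional (topspace T) \<and>
     (\<forall>t\<in>topspace T. f t \<in> fiber \<xi> t \<and> defect_at f (\<lambda>_. 0) t)"
proof -
  have "continuous_map T (btotal \<xi>) f"
    if fib: "\<And>t. t \<in> topspace T \<Longrightarrow> f t \<in> fiber \<xi> t" and "\<And>t. t \<in> topspace T \<Longrightarrow> defect_at f (\<lambda>_. 0) t"
  proof (rule continuous_map_of_defects [OF fib])
    fix e :: real assume "e > 0"
    then have "defect_at f (\<lambda>_. e) t" if "t \<in> topspace T" for t
      using that by (intro defect_at_cong [OF \<open>\<And>t. t \<in> topspace T \<Longrightarrow> defect_at f (\<lambda>_. 0) t\<close>]) auto
    moreover have "bnorm \<xi> (bdiff (f t) (f t)) \<le> e" if t: "t \<in> topspace T" for t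
    proof -
      interpret B: banach_space_on "fiber \<xi> t" "badd \<xi>" "bscale \<xi>" "bzero \<xi> t" "bnorm \<xi>"
        using t by (rule fiber_banach)
      show ?thesis using fib [OF t] \<open>e > 0\<close> by simp
    qed
    ultimately show "\<exists>g. (\<forall>t\<in>topspace T. g t \<in> fiber \<xi> t) \<and> (\<forall>s\<in>topspace T. defect_at g (\<lambda>_. e) s) \<and>
        (\<forall>t\<in>topspace T. bnorm \<xi> (bdiff (f t) (g t)) \<le> e)"
      using fib by blast
  qed
  moreover have "f t \<in> fiber \<xi> t" if "continuous_map T (btotal \<xi>) f" "\<forall>t\<in>topspace T. bproj \<xi> (f t) = t" "t \<in> topspace T" for t
    using that by (auto simp: fiber_def continuous_map_def)
  ultimately show ?thesis
    unfolding bundle_sections_def using defect_at_continuous_map fiberD(2) by blast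
qed

lemma bounded_sections_fiber: "\<lbrakk>f \<in> bounded_sections T \<xi>; t \<in> topspace T\<rbrakk> \<Longrightarrow> f t \<in> fiber \<xi> t"
  by (simp add: bounded_sections_def bundle_sections_iff)

lemma bounded_sections_iff:
  "f \<in> bounded_sections T \<xi> \<longleftrightarrow> f \<in> bundle_sections T \<xi> \<and> (\<exists>C. \<forall>t\<in>topspace T. bnorm \<xi> (f t) \<le> C)"
  by (auto simp: bounded_sections_def bdd_above_def)

text \<open>The real supremum is informative only for bounded sections over a nonempty base, hence
  the nonemptiness assumptions that follow.\<close>

definition section_norm :: "('t \<Rightarrow> 'e) \<Rightarrow> real" where
  "section_norm f = (SUP t\<in>topspace T. bnorm \<xi> (f t))"

lemma norm_le_section_norm:
  "\<lbrakk>f \<in> bounded_sections T \<xi>; t \<in> topspace T\<rbrakk> \<Longrightarrow> bnorm \<xi> (f t) \<le> section_norm f"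
  unfolding section_norm_def bounded_sections_def by (intro cSUP_upper) auto

lemma section_norm_le:
  "\<lbrakk>topspace T \<noteq> {}; \<And>t. t \<in> topspace T \<Longrightarrow> bnorm \<xi> (f t) \<le> C\<rbrakk> \<Longrightarrow> section_norm f \<le> C"
  unfolding section_norm_def by (intro cSUP_least) auto

lemma uniform_limit_section:
  assumes f: "f \<in> extensional (topspace T)" "\<And>t. t \<in> topspace T \<Longrightarrow> f t \<in> fiber \<xi> t"
    and approx: "\<And>e. e > 0 \<Longrightarrow> \<exists>g\<in>bundle_sections T \<xi>. \<forall>t\<in>topspace T. bnorm \<xi> (bdiff (f t) (g t)) \<le> e"
  shows "f \<in> bundle_sections T \<xi>"
proof -
  have "continuous_map T (btotal \<xi>) f"
  proof (rule continuous_map_of_defects [OF f(2)])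
    fix e :: real assume "e > 0"
    then obtain g where g: "g \<in> bundle_sections T \<xi>" "\<forall>t\<in>topspace T. bnorm \<xi> (bdiff (f t) (g t)) \<le> e"
      using approx by blast
    have gs: "g t \<in> fiber \<xi> t" "defect_at g (\<lambda>_. 0) t" if "t \<in> topspace T" for t
      using g(1) that by (simp_all add: bundle_sections_iff)
    have "defect_at g (\<lambda>_. e) s" if s: "s \<in> topspace T" for s
      by (rule defect_at_cong [OF gs(2) [OF s] _ s]) (use \<open>e > 0\<close> in simp)
    then show "\<exists>g. (\<forall>t\<in>topspace T. g t \<in> fiber \<xi> t) \<and> (\<forall>s\<in>topspace T. defect_at g (\<lambda>_. e) s) \<and>
        (\<forall>t\<in>topspace T. bnorm \<xi> (bdiff (f t) (g t)) \<le> e)"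
      using g(2) gs(1) by blast
  qed
  then show ?thesis
    unfolding bundle_sections_def using f fiberD(2) by blast
qed

section \<open>The Banach space of bounded sections\<close>

definition section_add :: "('t \<Rightarrow> 'e) \<Rightarrow> ('t \<Rightarrow> 'e) \<Rightarrow> 't \<Rightarrow> 'e" where
  "section_add f g = restrict (\<lambda>t. badd \<xi> (f t) (g t)) (topspace T)"

definition section_scale :: "'k \<Rightarrow> ('t \<Rightarrow> 'e) \<Rightarrow> 't \<Rightarrow> 'e" where
  "section_scale c f = restrict (\<lambda>t. bscale \<xi> c (f t)) (topspace T)"

definition section_zero :: "'t \<Rightarrow> 'e" where
  "section_zero = restrict (bzero \<xi>) (topspace T)"

lemma section_apply:
  assumes "t \<in> topspace T"
  shows "section_add f g t = badd \<xi> (f t) (g t)" "section_scale c f t = bscale \<xi> c (f t)"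
    "section_zero t = bzero \<xi> t"
  using assms by (simp_all add: section_add_def section_scale_def section_zero_def)

lemma section_extensional:
  "section_add f g \<in> extensional (topspace T)" "section_scale c f \<in> extensional (topspace T)"
  "section_zero \<in> extensional (topspace T)"
  by (simp_all add: section_add_def section_scale_def section_zero_def)

lemma section_add_closed:
  assumes f: "f \<in> bounded_sections T \<xi>" and g: "g \<in> bounded_sections T \<xi>"
  shows "section_add f g \<in> bounded_sections T \<xi>"
proof -
  have "defect_at (section_add f g) (\<lambda>_. 0) s \<and> section_add f g s \<in> fiber \<xi> s \<and>
      bnorm \<xi> (section_add f g s) \<le> section_norm f + section_norm g" if s: "s \<in> topspace T" for s
  proof -
    interpret B: banach_space_on "fiber \<xi> s" "badd \<xi>" "bscale \<xi>" "bzero \<xi> s" "bnorm \<xi>"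
      using s by (rule fiber_banach)
    have fib: "\<forall>\<^sub>F t in nhdsin T s. k t \<in> fiber \<xi> t" if "k \<in> bounded_sections T \<xi>" for k
      using eventually_nhdsin_topspace by eventually_elim (simp add: that bounded_sections_fiber)
    have def0: "defect_at k (\<lambda>_. 0) s" if "k \<in> bounded_sections T \<xi>" for k
      using that s by (simp add: bounded_sections_def bundle_sections_iff)
    have "\<forall>\<^sub>F t in nhdsin T s. badd \<xi> (f t) (g t) = section_add f g t \<and> 0 + 0 \<le> (0 :: real)"
      using eventually_nhdsin_topspace by eventually_elim (simp add: section_apply)
    from defect_at_cong [OF defect_at_badd [OF def0 [OF f] fib [OF f] def0 [OF g] fib [OF g] s] this s]
    have "defect_at (section_add f g) (\<lambda>_. 0) s" .
    moreover have "section_add f g s \<in> fiber \<xi> s"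
      using f g s by (simp add: section_apply bounded_sections_fiber)
    moreover have "bnorm \<xi> (section_add f g s) \<le> section_norm f + section_norm g"
      using B.norm_triangle [of "f s" "g s"] bounded_sections_fiber [OF f s] bounded_sections_fiber [OF g s]
        norm_le_section_norm [OF f s] norm_le_section_norm [OF g s] s by (simp add: section_apply)
    ultimately show ?thesis by blast
  qed
  then show ?thesis
    unfolding bounded_sections_iff bundle_sections_iff using section_extensional by blast
qed

lemma section_scale_closed:
  assumes f: "f \<in> bounded_sections T \<xi>"
  shows "section_scale c f \<in> bounded_sections T \<xi>"
proof -
  have "defect_at (section_scale c f) (\<lambda>_. 0) s \<and> section_scale c f s \<in> fiber \<xi> s \<and>
      bnorm \<xi> (section_scale c f s) \<le> norm c * section_norm f" if s: "s \<in> topspace T" for s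
  proof -
    interpret B: banach_space_on "fiber \<xi> s" "badd \<xi>" "bscale \<xi>" "bzero \<xi> s" "bnorm \<xi>"
      using s by (rule fiber_banach)
    have fib: "\<forall>\<^sub>F t in nhdsin T s. f t \<in> fiber \<xi> t"
      using eventually_nhdsin_topspace by eventually_elim (simp add: f bounded_sections_fiber)
    have def0: "defect_at f (\<lambda>_. 0) s"
      using f s by (simp add: bounded_sections_def bundle_sections_iff)
    have "\<forall>\<^sub>F t in nhdsin T s. bscale \<xi> c (f t) = section_scale c f t \<and> norm c * 0 \<le> (0 :: real)"
      using eventually_nhdsin_topspace by eventually_elim (simp add: section_apply)
    from defect_at_cong [OF defect_at_bscale [OF def0 fib tendsto_const s] this s]
    have "defect_at (section_scale c f) (\<lambda>_. 0) s" .
    moreover have "section_scale c f s \<in> fiber \<xi> s"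
      using f s by (simp add: section_apply bounded_sections_fiber)
    moreover have "bnorm \<xi> (section_scale c f s) \<le> norm c * section_norm f"
      using bounded_sections_fiber [OF f s] norm_le_section_norm [OF f s] s
      by (simp add: section_apply B.norm_scale mult_left_mono)
    ultimately show ?thesis by blast
  qed
  then show ?thesis
    unfolding bounded_sections_iff bundle_sections_iff using section_extensional by blast
qed

lemma section_zero_closed: "section_zero \<in> bounded_sections T \<xi>"
proof -
  have "defect_at section_zero (\<lambda>_. 0) s \<and> section_zero s \<in> fiber \<xi> s \<and> bnorm \<xi> (section_zero s) \<le> 0"
    if s: "s \<in> topspace T" for s
  proof -
    interpret B: banach_space_on "fiber \<xi> s" "badd \<xi>" "bscale \<xi>" "bzero \<xi> s" "bnorm \<xi>"
      using s by (rule fiber_banach)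
    have "\<forall>\<^sub>F t in nhdsin T s. bzero \<xi> t = section_zero t \<and> 0 \<le> (0 :: real)"
      using eventually_nhdsin_topspace by eventually_elim (simp add: section_apply)
    from defect_at_cong [OF defect_at_bzero [OF s] this s]
    show ?thesis using s by (simp add: section_apply)
  qed
  then show ?thesis
    unfolding bounded_sections_iff bundle_sections_iff using section_extensional by blast
qed

lemma bounded_sections_extensional: "f \<in> bounded_sections T \<xi> \<Longrightarrow> f \<in> extensional (topspace T)"
  by (simp add: bounded_sections_def bundle_sections_def)

text \<open>The algebraic laws hold pointwise, and extensionality turns them into equations of
  functions. For completeness, limits are taken in each fiber, and the uniform Cauchy condition
  makes the convergence uniform, so that the limit is a section.\<close>

theorem bounded_sections_banach:
  assumes ne: "topspace T \<noteq> {}"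
  shows "banach_space_on (bounded_sections T \<xi>) section_add section_scale section_zero section_norm"
proof
  note [simp] = section_apply bounded_sections_fiber
  note closed = section_add_closed section_scale_closed section_zero_closed
  note ext = section_extensional bounded_sections_extensional
  show "section_zero \<in> bounded_sections T \<xi>"
    by (rule section_zero_closed)
  show "section_add x y \<in> bounded_sections T \<xi>" if "x \<in> bounded_sections T \<xi>" "y \<in> bounded_sections T \<xi>" for x y
    using that by (rule section_add_closed)
  show "section_scale c x \<in> bounded_sections T \<xi>" if "x \<in> bounded_sections T \<xi>" for c x
    using that by (rule section_scale_closed)
  show "section_add (section_add x y) z = section_add x (section_add y z)"
    if "x \<in> bounded_sections T \<xi>" "y \<in> bounded_sections T \<xi>" "z \<in> bounded_sections T \<xi>" for x y z
    using that by (intro extensionalityI [where A = "topspace T"] ext) (simp add: banach_space_on.add_assoc [OF fiber_banach])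
  show "section_add x y = section_add y x" if "x \<in> bounded_sections T \<xi>" "y \<in> bounded_sections T \<xi>" for x y
    using that by (intro extensionalityI [where A = "topspace T"] ext) (simp add: banach_space_on.add_commute [OF fiber_banach, of _ "x _"])
  show "section_add x section_zero = x" if "x \<in> bounded_sections T \<xi>" for x
    using that by (intro extensionalityI [where A = "topspace T"] ext) (simp_all add: banach_space_on.add_zero [OF fiber_banach])
  show "\<exists>y\<in>bounded_sections T \<xi>. section_add x y = section_zero" if x: "x \<in> bounded_sections T \<xi>" for x
  proof (intro bexI [of _ "section_scale (-1) x"] extensionalityI [where A = "topspace T"] ext closed x)
    fix t assume t: "t \<in> topspace T"
    then show "section_add x (section_scale (-1) x) t = section_zero t"
      using banach_space_on.diff_self [OF fiber_banach [OF t], of "x t"] x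
      by (simp add: banach_space_on.diff_def [OF fiber_banach [OF t]])
  qed
  show "section_scale c (section_add x y) = section_add (section_scale c x) (section_scale c y)"
    if "x \<in> bounded_sections T \<xi>" "y \<in> bounded_sections T \<xi>" for c x y
    using that by (intro extensionalityI [where A = "topspace T"] ext) (simp add: banach_space_on.scale_add_right [OF fiber_banach])
  show "section_scale (c + d) x = section_add (section_scale c x) (section_scale d x)"
    if "x \<in> bounded_sections T \<xi>" for c d x
    using that by (intro extensionalityI [where A = "topspace T"] ext) (simp add: banach_space_on.scale_add_left [OF fiber_banach])
  show "section_scale c (section_scale d x) = section_scale (c * d) x"
    if "x \<in> bounded_sections T \<xi>" for c d x
    using that by (intro extensionalityI [where A = "topspace T"] ext) (simp add: banach_space_on.scale_scale [OF fiber_banach])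
  show "section_scale 1 x = x" if "x \<in> bounded_sections T \<xi>" for x
    using that by (intro extensionalityI [where A = "topspace T"] ext) (simp_all add: banach_space_on.scale_one [OF fiber_banach])
  obtain t\<^sub>0 where t0: "t\<^sub>0 \<in> topspace T" using ne by blast
  show nn: "0 \<le> section_norm x" if "x \<in> bounded_sections T \<xi>" for x
    using norm_le_section_norm [OF that t0] bnorm_nonneg [OF fiberD(1) [OF bounded_sections_fiber [OF that t0]]]
    by linarith
  show "section_norm x = 0 \<longleftrightarrow> x = section_zero" if x: "x \<in> bounded_sections T \<xi>" for x
  proof
    assume 0: "section_norm x = 0"
    show "x = section_zero"
    proof (intro extensionalityI [where A = "topspace T"] ext x)
      fix t assume t: "t \<in> topspace T"
      have "bnorm \<xi> (x t) = 0"
        using norm_le_section_norm [OF x t] bnorm_nonneg [OF fiberD(1) [OF bounded_sections_fiber [OF x t]]] 0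
        by simp
      then show "x t = section_zero t"
        using banach_space_on.norm_eq_zero [OF fiber_banach [OF t]] x t by simp
    qed
  next
    assume "x = section_zero"
    then have "section_norm x \<le> 0"
      by (intro section_norm_le ne) (simp add: banach_space_on.norm_zero [OF fiber_banach])
    with nn [OF x] show "section_norm x = 0" by simp
  qed
  have scale_le: "section_norm (section_scale c x) \<le> norm c * section_norm x" if x: "x \<in> bounded_sections T \<xi>" for c x
    using x norm_le_section_norm [OF x]
    by (intro section_norm_le ne) (simp add: banach_space_on.norm_scale [OF fiber_banach] mult_left_mono)
  show "section_norm (section_scale c x) = norm c * section_norm x" if x: "x \<in> bounded_sections T \<xi>" for c x
  proof (cases "c = 0")
    case True
    then show ?thesis
      using scale_le [OF x, of c] nn [OF section_scale_closed [OF x, of c]] by simp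
  next
    case False
    \<comment> \<open>The reverse inequality is the estimate \<open>scale_le\<close> for the scalar
      \<open>inverse c\<close>.\<close>
    have "section_scale (inverse c) (section_scale c x) = x"
      using x False by (intro extensionalityI [where A = "topspace T"] ext)
        (simp_all add: banach_space_on.scale_scale [OF fiber_banach] banach_space_on.scale_one [OF fiber_banach])
    then have "section_norm x \<le> norm (inverse c) * section_norm (section_scale c x)"
      using scale_le [OF section_scale_closed [OF x, of c], of "inverse c"] by simp
    then have "norm c * section_norm x \<le> section_norm (section_scale c x)"
      using False by (simp add: norm_divide field_simps)
    with scale_le [OF x, of c] show ?thesis by simp
  qed
  show "section_norm (section_add x y) \<le> section_norm x + section_norm y"
    if x: "x \<in> bounded_sections T \<xi>" and y: "y \<in> bounded_sections T \<xi>" for x y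
  proof (rule section_norm_le [OF ne])
    fix t assume t: "t \<in> topspace T"
    show "bnorm \<xi> (section_add x y t) \<le> section_norm x + section_norm y"
      using banach_space_on.norm_triangle [OF fiber_banach [OF t]
          bounded_sections_fiber [OF x t] bounded_sections_fiber [OF y t]]
        norm_le_section_norm [OF x t] norm_le_section_norm [OF y t] t by simp
  qed
  fix \<sigma> :: "nat \<Rightarrow> 't \<Rightarrow> 'e"
  assume range: "range \<sigma> \<subseteq> bounded_sections T \<xi>"
    and Cauchy: "\<And>e. e > 0 \<Longrightarrow> \<exists>N. \<forall>i\<ge>N. \<forall>j\<ge>N. section_norm (section_add (\<sigma> i) (section_scale (-1) (\<sigma> j))) < e"
  have \<sigma>: "\<sigma> n \<in> bounded_sections T \<xi>" for n by (rule range_subsetD [OF range])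
  have sd: "section_add f (section_scale (-1) g) t = bdiff (f t) (g t)" if "t \<in> topspace T" for f g t
    using that by (simp add: banach_space_on.diff_def [OF fiber_banach [OF that]])
  have unif: "\<exists>N. \<forall>i\<ge>N. \<forall>j\<ge>N. \<forall>t\<in>topspace T. bnorm \<xi> (bdiff (\<sigma> i t) (\<sigma> j t)) < e" if e: "e > 0" for e
  proof -
    obtain N where N: "\<And>i j. \<lbrakk>i \<ge> N; j \<ge> N\<rbrakk> \<Longrightarrow> section_norm (section_add (\<sigma> i) (section_scale (-1) (\<sigma> j))) < e"
      using Cauchy [OF e] by blast
    have "bnorm \<xi> (bdiff (\<sigma> i t) (\<sigma> j t)) < e" if "i \<ge> N" "j \<ge> N" "t \<in> topspace T" for i j t
      using norm_le_section_norm [OF section_add_closed [OF \<sigma> section_scale_closed [OF \<sigma>]] that(3), of i "-1" j]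
        N [OF that(1,2)] unfolding sd [OF that(3)] by linarith
    then show ?thesis by blast
  qed
  have "\<exists>l. l \<in> fiber \<xi> t \<and> (\<lambda>n. bnorm \<xi> (bdiff (\<sigma> n t) l)) \<longlonglongrightarrow> 0" if t: "t \<in> topspace T" for t
  proof -
    interpret B: banach_space_on "fiber \<xi> t" "badd \<xi>" "bscale \<xi>" "bzero \<xi> t" "bnorm \<xi>"
      using t by (rule fiber_banach)
    have "range (\<lambda>n. \<sigma> n t) \<subseteq> fiber \<xi> t" using \<sigma> t by auto
    moreover have "\<exists>N. \<forall>i\<ge>N. \<forall>j\<ge>N. bnorm \<xi> (badd \<xi> (\<sigma> i t) (bscale \<xi> (-1) (\<sigma> j t))) < e" if "e > 0" for e
      using unif [OF that] t unfolding B.diff_def by blast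
    ultimately show ?thesis
      using B.complete [of "\<lambda>n. \<sigma> n t"] unfolding B.diff_def by blast
  qed
  then have "\<forall>t\<in>topspace T. \<exists>l. l \<in> fiber \<xi> t \<and> (\<lambda>n. bnorm \<xi> (bdiff (\<sigma> n t) l)) \<longlonglongrightarrow> 0"
    by blast
  from bchoice [OF this] obtain k where
    k: "\<And>t. t \<in> topspace T \<Longrightarrow> k t \<in> fiber \<xi> t"
       "\<And>t. t \<in> topspace T \<Longrightarrow> (\<lambda>n. bnorm \<xi> (bdiff (\<sigma> n t) (k t))) \<longlonglongrightarrow> 0"
    by blast
  define l where "l = restrict k (topspace T)"
  have l_ext: "l \<in> extensional (topspace T)" by (simp add: l_def)
  have l: "l t \<in> fiber \<xi> t" "(\<lambda>n. bnorm \<xi> (bdiff (\<sigma> n t) (l t))) \<longlonglongrightarrow> 0" if "t \<in> topspace T" for t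
    using k that by (simp_all add: l_def)
  have conv: "\<exists>N. \<forall>n\<ge>N. \<forall>t\<in>topspace T. bnorm \<xi> (bdiff (\<sigma> n t) (l t)) \<le> e" if "e > 0" for e
  proof -
    obtain N where N: "\<And>i j t. \<lbrakk>i \<ge> N; j \<ge> N; t \<in> topspace T\<rbrakk> \<Longrightarrow> bnorm \<xi> (bdiff (\<sigma> i t) (\<sigma> j t)) < e / 2"
      using unif [of "e/2"] \<open>e > 0\<close> by auto
    have "bnorm \<xi> (bdiff (\<sigma> n t) (l t)) \<le> e" if n: "n \<ge> N" and t: "t \<in> topspace T" for n t
    proof -
      interpret B: banach_space_on "fiber \<xi> t" "badd \<xi>" "bscale \<xi>" "bzero \<xi> t" "bnorm \<xi>"
        using t by (rule fiber_banach)
      \<comment> \<open>The index \<open>m\<close> may depend on \<open>t\<close>, while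
        \<open>N\<close> does not; passing through \<open>\<sigma> m t\<close> gives a bound uniform
        in \<open>t\<close>.\<close>
      have "\<forall>\<^sub>F m in sequentially. bnorm \<xi> (bdiff (\<sigma> m t) (l t)) < e / 2 \<and> m \<ge> N"
        using order_tendstoD(2) [OF l(2) [OF t], of "e/2"] \<open>e > 0\<close>
        by (intro eventually_conj eventually_ge_at_top) auto
      then obtain m where "bnorm \<xi> (bdiff (\<sigma> m t) (l t)) < e / 2" "m \<ge> N"
        using eventually_happens' [OF sequentially_bot] by blast
      then show ?thesis
        using B.norm_diff_triangle [of "\<sigma> n t" "\<sigma> m t" "l t"] N [OF n _ t, of m] l(1) [OF t] \<sigma> t by fastforce
    qed
    then show ?thesis by blast
  qed
  have flip: "bnorm \<xi> (bdiff (l t) (\<sigma> n t)) = bnorm \<xi> (bdiff (\<sigma> n t) (l t))" if t: "t \<in> topspace T" for n t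
    using banach_space_on.norm_diff_commute [OF fiber_banach [OF t]] l(1) [OF t] \<sigma> t by simp
  have "l \<in> bundle_sections T \<xi>"
  proof (rule uniform_limit_section [OF l_ext l(1)])
    fix e :: real assume "e > 0"
    then obtain N where "\<forall>t\<in>topspace T. bnorm \<xi> (bdiff (\<sigma> N t) (l t)) \<le> e"
      using conv by blast
    then show "\<exists>g\<in>bundle_sections T \<xi>. \<forall>t\<in>topspace T. bnorm \<xi> (bdiff (l t) (g t)) \<le> e"
      using \<sigma> [of N] flip by (intro bexI [of _ "\<sigma> N"]) (auto simp: bounded_sections_def)
  qed
  moreover have "\<exists>C. \<forall>t\<in>topspace T. bnorm \<xi> (l t) \<le> C"
  proof -
    obtain N where N: "\<forall>t\<in>topspace T. bnorm \<xi> (bdiff (\<sigma> N t) (l t)) \<le> 1"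
      using conv [of 1] by auto
    have "bnorm \<xi> (l t) \<le> 1 + section_norm (\<sigma> N)" if t: "t \<in> topspace T" for t
      using banach_space_on.norm_le_diff [OF fiber_banach [OF t] l(1) [OF t] bounded_sections_fiber [OF \<sigma> t], of N]
        N flip [OF t] norm_le_section_norm [OF \<sigma> t, of N] t by fastforce
    then show ?thesis by blast
  qed
  ultimately have lb: "l \<in> bounded_sections T \<xi>"
    by (simp add: bounded_sections_iff)
  show "\<exists>l\<in>bounded_sections T \<xi>. (\<lambda>n. section_norm (section_add (\<sigma> n) (section_scale (-1) l))) \<longlonglongrightarrow> 0"
  proof (intro bexI [OF _ lb] LIMSEQ_I)
    fix e :: real assume "e > 0"
    then obtain N where N: "\<And>n t. \<lbrakk>n \<ge> N; t \<in> topspace T\<rbrakk> \<Longrightarrow> bnorm \<xi> (bdiff (\<sigma> n t) (l t)) \<le> e / 2"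
      using conv [of "e/2"] by auto
    have "norm (section_norm (section_add (\<sigma> n) (section_scale (-1) l)) - 0) < e" if "n \<ge> N" for n
    proof -
      have "section_norm (section_add (\<sigma> n) (section_scale (-1) l)) \<le> e / 2"
        using N [OF that] by (intro section_norm_le ne) (simp only: sd)
      then show ?thesis
        using nn [OF section_add_closed [OF \<sigma> section_scale_closed [OF lb]], of n "-1"] \<open>e > 0\<close> by simp
    qed
    then show "\<exists>N. \<forall>n\<ge>N. norm (section_norm (section_add (\<sigma> n) (section_scale (-1) l)) - 0) < e"
      by blast
  qed
qed

text \<open>A Banach bundle over a paracompact base has enough sections. Passing to norm closures
  weakens the strict bound of the field to \<open>\<le> c\<close>, while over the base point of
  \<open>y\<close> the field is a singleton and leaves the limit no freedom.\<close>

theorem bounded_section_through: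
  assumes T: "paracompact_Hausdorff_space T" and y: "y \<in> topspace (btotal \<xi>)" and c: "bnorm \<xi> y < c"
  obtains f where "f \<in> bounded_sections T \<xi>" "f (bproj \<xi> y) = y" "\<And>t. t \<in> topspace T \<Longrightarrow> bnorm \<xi> (f t) \<le> c"
proof -
  define t\<^sub>0 where "t\<^sub>0 = bproj \<xi> y"
  have t0: "t\<^sub>0 \<in> topspace T" and yt: "y \<in> fiber \<xi> t\<^sub>0"
    using y proj_topspace mem_fiber_proj by (auto simp: t\<^sub>0_def)
  \<comment> \<open>Prescribing the value at one point preserves lower semicontinuity, as points of \<open>T\<close> are closed.\<close>
  define \<Phi> where "\<Phi> t = {x \<in> fiber \<xi> t. bnorm \<xi> x < c} \<inter> (if t = t\<^sub>0 then {y} else fiber \<xi> t)" for t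
  have c0: "c > 0" using bnorm_nonneg [OF y] c by simp
  have convex: "fiber_convex t (\<Phi> t)" if t: "t \<in> topspace T" for t
  proof -
    interpret B: banach_space_on "fiber \<xi> t" "badd \<xi>" "bscale \<xi>" "bzero \<xi> t" "bnorm \<xi>"
      using t by (rule fiber_banach)
    have "B.convex_in (fiber \<xi> t)" by (simp add: B.convex_in_def)
    then have "B.convex_in (if t = t\<^sub>0 then {y} else fiber \<xi> t)"
      using yt B.convex_in_singleton [of y] by (cases "t = t\<^sub>0") simp_all
    then show ?thesis
      unfolding \<Phi>_def by (intro B.convex_in_Int B.convex_in_ball)
  qed
  have ne: "\<Phi> t \<noteq> {}" if t: "t \<in> topspace T" for t
  proof -
    interpret B: banach_space_on "fiber \<xi> t" "badd \<xi>" "bscale \<xi>" "bzero \<xi> t" "bnorm \<xi>"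
      using t by (rule fiber_banach)
    have "bzero \<xi> t \<in> \<Phi> t" if "t \<noteq> t\<^sub>0" using that c0 by (simp add: \<Phi>_def)
    moreover have "y \<in> \<Phi> t\<^sub>0" using yt c by (simp add: \<Phi>_def)
    ultimately show ?thesis by blast
  qed
  have lsc: "fiberwise_lsc \<Phi>"
    unfolding fiberwise_lsc_def
  proof (intro allI impI)
    fix U assume U: "openin (btotal \<xi>) U"
    define U' where "U' = U \<inter> {x \<in> topspace (btotal \<xi>). bnorm \<xi> x < c}"
    have "openin (btotal \<xi>) U'"
      unfolding U'_def using U norm_upper_semicontinuous by blast
    then have img: "openin T (bproj \<xi> ` U')" by (rule openin_proj_image)
    have "closedin T {t\<^sub>0}"
      using Hausdorff_base t0 by (simp add: closedin_Hausdorff_singleton)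
    \<comment> \<open>Over the base point of \<open>y\<close> the field offers only
      \<open>y\<close>; when \<open>y\<close> is not in \<open>U'\<close>, this one point is taken
      out of the open image.\<close>
    then have "openin T (bproj \<xi> ` U' - (if y \<in> U' then {} else {t\<^sub>0}))"
      using img by (intro openin_diff) auto
    moreover have "{t \<in> topspace T. \<Phi> t \<inter> U \<noteq> {}} = bproj \<xi> ` U' - (if y \<in> U' then {} else {t\<^sub>0})"
      (is "?L = ?R")
    proof
      show "?L \<subseteq> ?R"
      proof
        fix t assume "t \<in> ?L"
        then obtain x where x: "x \<in> \<Phi> t" "x \<in> U" by blast
        then have "x \<in> fiber \<xi> t" "bnorm \<xi> x < c" "t = t\<^sub>0 \<Longrightarrow> x = y"
          by (auto simp: \<Phi>_def split: if_splits)
        then show "t \<in> ?R"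
          using x(2) fiberD [of x t] by (auto simp: U'_def)
      qed
      show "?R \<subseteq> ?L"
      proof
        fix t assume t: "t \<in> ?R"
        then obtain x where x: "x \<in> U'" "t = bproj \<xi> x" by blast
        then have xU: "x \<in> U" "x \<in> fiber \<xi> t" "bnorm \<xi> x < c" "t \<in> topspace T"
          using mem_fiber_proj proj_topspace by (auto simp: U'_def)
        show "t \<in> ?L"
        proof (cases "t = t\<^sub>0")
          case True
          with t have "y \<in> U'" by (auto split: if_splits)
          then have "y \<in> \<Phi> t \<inter> U" using True yt by (simp add: \<Phi>_def U'_def)
          with xU(4) show ?thesis by blast
        next
          case False
          then have "x \<in> \<Phi> t \<inter> U" using xU by (simp add: \<Phi>_def)
          with xU(4) show ?thesis by blast
        qed
      qed
    qed
    ultimately show "openin T {t \<in> topspace T. \<Phi> t \<inter> U \<noteq> {}}" by simp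
  qed
  obtain f where f: "f \<in> bundle_sections T \<xi>"
    and near: "\<And>t e. \<lbrakk>t \<in> topspace T; e > 0\<rbrakk> \<Longrightarrow> \<exists>x\<in>\<Phi> t. bnorm \<xi> (bdiff (f t) x) < e"
    using continuous_selection [where \<Phi> = \<Phi>, OF T convex lsc ne] by blast
  have fib: "f t \<in> fiber \<xi> t" if "t \<in> topspace T" for t
    using f that by (simp add: bundle_sections_iff)
  have bound: "bnorm \<xi> (f t) \<le> c" if t: "t \<in> topspace T" for t
  proof (rule field_le_epsilon)
    interpret B: banach_space_on "fiber \<xi> t" "badd \<xi>" "bscale \<xi>" "bzero \<xi> t" "bnorm \<xi>"
      using t by (rule fiber_banach)
    fix e :: real assume "e > 0"
    then obtain x where x: "x \<in> \<Phi> t" "bnorm \<xi> (bdiff (f t) x) < e"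
      using near t by blast
    then have "x \<in> fiber \<xi> t" "bnorm \<xi> x < c" by (auto simp: \<Phi>_def)
    then show "bnorm \<xi> (f t) \<le> c + e"
      using B.norm_le_diff [OF fib [OF t], of x] x(2) by linarith
  qed
  have "bnorm \<xi> (bdiff (f t\<^sub>0) y) \<le> 0"
  proof (rule field_le_epsilon)
    fix e :: real assume "e > 0"
    then obtain x where "x \<in> \<Phi> t\<^sub>0" "bnorm \<xi> (bdiff (f t\<^sub>0) x) < e"
      using near t0 by blast
    then show "bnorm \<xi> (bdiff (f t\<^sub>0) y) \<le> 0 + e" by (simp add: \<Phi>_def)
  qed
  then have "f t\<^sub>0 = y"
    by (rule banach_space_on.norm_diff_le_zero [OF fiber_banach [OF t0] fib [OF t0] yt])
  then show thesis
    using f bound by (intro that [of f]) (auto simp: bounded_sections_iff t\<^sub>0_def)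
qed

end

section \<open>Lifting bounded sections\<close>

text \<open>Homogeneity extends the bound from unit balls to whole fibers, and finiteness of the
  extended supremum gives one real constant for all fibers.\<close>

lemma fiber_onorm_bound:
  fixes \<xi>\<^sub>1 :: "('k::real_normed_field, 'e1, 't) bundle_data"
    and \<xi>\<^sub>2 :: "('k, 'e2, 't) bundle_data"
  assumes "banach_bundle T \<xi>\<^sub>1" "banach_bundle T \<xi>\<^sub>2" "banach_bundle_map T \<xi>\<^sub>1 \<xi>\<^sub>2 \<phi>"
    and sup: "(SUP t\<in>topspace T. fiber_onorm \<xi>\<^sub>1 \<xi>\<^sub>2 \<phi> t) < \<infinity>"
  obtains K where "K \<ge> 0" "\<And>x. x \<in> topspace (btotal \<xi>\<^sub>1) \<Longrightarrow> bnorm \<xi>\<^sub>2 (\<phi> x) \<le> K * bnorm \<xi>\<^sub>1 x"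
proof -
  interpret E1: banach_bundle T \<xi>\<^sub>1 by fact
  interpret E2: banach_bundle T \<xi>\<^sub>2 by fact
  interpret M: banach_bundle_map T \<xi>\<^sub>1 \<xi>\<^sub>2 \<phi> by fact
  define S where "S = (SUP t\<in>topspace T. fiber_onorm \<xi>\<^sub>1 \<xi>\<^sub>2 \<phi> t)"
  define K where "K = enn2real S"
  have S: "S = ennreal K"
    using sup by (simp add: S_def K_def)
  have K0: "K \<ge> 0" by (simp add: K_def)
  have "bnorm \<xi>\<^sub>2 (\<phi> x) \<le> K * bnorm \<xi>\<^sub>1 x" if x: "x \<in> topspace (btotal \<xi>\<^sub>1)" for x
  proof -
    define t where "t = bproj \<xi>\<^sub>1 x"
    have t: "t \<in> topspace T" and xt: "x \<in> fiber \<xi>\<^sub>1 t"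
      unfolding t_def using x E1.proj_topspace E1.mem_fiber_proj by blast+
    interpret B1: banach_space_on "fiber \<xi>\<^sub>1 t" "badd \<xi>\<^sub>1" "bscale \<xi>\<^sub>1" "bzero \<xi>\<^sub>1 t" "bnorm \<xi>\<^sub>1"
      using t by (rule E1.fiber_banach)
    interpret B2: banach_space_on "fiber \<xi>\<^sub>2 t" "badd \<xi>\<^sub>2" "bscale \<xi>\<^sub>2" "bzero \<xi>\<^sub>2 t" "bnorm \<xi>\<^sub>2"
      using t by (rule E2.fiber_banach)
    have mem: "\<phi> z \<in> fiber \<xi>\<^sub>2 t" if "z \<in> fiber \<xi>\<^sub>1 t" for z
      using M.map_fiber [OF t] that by blast
    have unit: "bnorm \<xi>\<^sub>2 (\<phi> z) \<le> K" if z: "z \<in> fiber \<xi>\<^sub>1 t" "bnorm \<xi>\<^sub>1 z \<le> 1" for z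
    proof -
      have "ennreal (bnorm \<xi>\<^sub>2 (\<phi> z)) \<le> fiber_onorm \<xi>\<^sub>1 \<xi>\<^sub>2 \<phi> t"
        unfolding fiber_onorm_def using z by (intro SUP_upper) auto
      also have "\<dots> \<le> S"
        unfolding S_def using t by (rule SUP_upper)
      finally show ?thesis
        using K0 B2.norm_nonneg [OF mem [OF z(1)]] by (simp add: S)
    qed
    show ?thesis
    proof (cases "bnorm \<xi>\<^sub>1 x = 0")
      case True
      \<comment> \<open>A vector of norm 0 cannot be normalised; it is 0 times itself, so linearity
        sends it to zero.\<close>
      then have "bscale \<xi>\<^sub>1 0 x = x"
        using B1.norm_eq_zero [OF xt] B1.scale_zero_left [OF xt] by simp
      then have "\<phi> x = bzero \<xi>\<^sub>2 t"
        using M.map_scale [OF t xt, of 0] mem [OF xt] by simp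
      with True show ?thesis by simp
    next
      case False
      define n where "n = bnorm \<xi>\<^sub>1 x"
      have n: "n > 0" using False B1.norm_nonneg [OF xt] by (simp add: n_def)
      have "bnorm \<xi>\<^sub>2 (\<phi> (bscale \<xi>\<^sub>1 (of_real (1/n)) x)) \<le> K"
        using xt n by (intro unit B1.scale_closed) (simp_all add: B1.norm_scale norm_divide n_def)
      then have "bnorm \<xi>\<^sub>2 (\<phi> x) / n \<le> K"
        using n mem [OF xt] M.map_scale [OF t xt, of "of_real (1/n)"] by (simp add: B2.norm_scale norm_divide)
      then show ?thesis using n by (simp add: n_def field_simps)
    qed
  qed
  then show thesis using K0 that by blast
qed

theorem theorem3p5:
  fixes T :: "'t topology"
    and \<xi>\<^sub>1 :: "('k::real_normed_field, 'e1, 't) bundle_data"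
    and \<xi>\<^sub>2 :: "('k, 'e2, 't) bundle_data"
    and \<phi> :: "'e1 \<Rightarrow> 'e2"
  assumes "paracompact_Hausdorff_space T"
    and "banach_bundle T \<xi>\<^sub>1"
    and "banach_bundle T \<xi>\<^sub>2"
    and "banach_bundle_map T \<xi>\<^sub>1 \<xi>\<^sub>2 \<phi>"
    and "\<phi> ` topspace (btotal \<xi>\<^sub>1) = topspace (btotal \<xi>\<^sub>2)"
    and "(SUP t\<in>topspace T. fiber_onorm \<xi>\<^sub>1 \<xi>\<^sub>2 \<phi> t) < \<infinity>"
  shows "induced_section_map T \<phi> ` bounded_sections T \<xi>\<^sub>1 = bounded_sections T \<xi>\<^sub>2 \<longleftrightarrow>
    (\<exists>m::real. m > 0 \<and>
      (\<forall>y\<in>topspace (btotal \<xi>\<^sub>2). \<exists>x\<in>topspace (btotal \<xi>\<^sub>1).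
         \<phi> x = y \<and> bnorm \<xi>\<^sub>1 x \<le> m * bnorm \<xi>\<^sub>2 y))"
proof -
  interpret E1: banach_bundle T \<xi>\<^sub>1 by fact
  interpret E2: banach_bundle T \<xi>\<^sub>2 by fact
  interpret M: banach_bundle_map T \<xi>\<^sub>1 \<xi>\<^sub>2 \<phi> by fact
  note T = assms(1)
  let ?L = "induced_section_map T \<phi>"
  obtain K where K: "K \<ge> 0" "\<And>x. x \<in> topspace (btotal \<xi>\<^sub>1) \<Longrightarrow> bnorm \<xi>\<^sub>2 (\<phi> x) \<le> K * bnorm \<xi>\<^sub>1 x"
    using fiber_onorm_bound [OF assms(2,3,4,6)] by blast
  have L_apply: "?L f t = \<phi> (f t)" if "t \<in> topspace T" for f t
    using that by (simp add: induced_section_map_def)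
  have mem: "\<phi> x \<in> fiber \<xi>\<^sub>2 t" if "t \<in> topspace T" "x \<in> fiber \<xi>\<^sub>1 t" for t x
    using M.map_fiber that by blast
  have map_diff: "\<phi> (E1.bdiff x z) = E2.bdiff (\<phi> x) (\<phi> z)"
    if t: "t \<in> topspace T" "x \<in> fiber \<xi>\<^sub>1 t" "z \<in> fiber \<xi>\<^sub>1 t" for t x z
    using t banach_space_on.scale_closed [OF E1.fiber_banach [OF t(1)] t(3)]
    by (simp add: banach_space_on.diff_def [OF E1.fiber_banach] banach_space_on.diff_def [OF E2.fiber_banach]
        M.map_add M.map_scale)
  \<comment> \<open>The lifting condition does not say in which fiber a preimage lies; preservation
    of base points forces the right one.\<close>
  have fiber_preimage: "z \<in> fiber \<xi>\<^sub>1 t" if z: "z \<in> topspace (btotal \<xi>\<^sub>1)" "\<phi> z \<in> fiber \<xi>\<^sub>2 t" for z t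
  proof -
    have "\<phi> z \<in> fiber \<xi>\<^sub>2 (bproj \<xi>\<^sub>1 z)"
      by (rule mem [OF E1.proj_topspace [OF z(1)] E1.mem_fiber_proj [OF z(1)]])
    then have "bproj \<xi>\<^sub>1 z = t"
      using E2.fiberD(2) z(2) by metis
    then show ?thesis using E1.mem_fiber_proj [OF z(1)] by simp
  qed
  have L_norm_le: "bnorm \<xi>\<^sub>2 (?L f t) \<le> K * E1.section_norm f"
    if f: "f \<in> bounded_sections T \<xi>\<^sub>1" and t: "t \<in> topspace T" for f t
  proof -
    have "bnorm \<xi>\<^sub>2 (?L f t) \<le> K * bnorm \<xi>\<^sub>1 (f t)"
      using K(2) E1.fiberD(1) [OF E1.bounded_sections_fiber [OF f t]] t by (simp add: L_apply)
    also have "\<dots> \<le> K * E1.section_norm f"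
      using K(1) E1.norm_le_section_norm [OF f t] by (rule mult_left_mono [rotated])
    finally show ?thesis .
  qed
  \<comment> \<open>This inclusion holds in any case, by the uniform bound on the fiber operators;
    only the lifting of sections is at stake in the second direction.\<close>
  have L_bounded: "?L f \<in> bounded_sections T \<xi>\<^sub>2" if f: "f \<in> bounded_sections T \<xi>\<^sub>1" for f
  proof -
    have "continuous_map T (btotal \<xi>\<^sub>1) f"
      using f by (simp add: bounded_sections_def bundle_sections_def)
    then have "continuous_map T (btotal \<xi>\<^sub>2) (\<phi> \<circ> f)"
      using M.map_continuous by (rule continuous_map_compose)
    then have "continuous_map T (btotal \<xi>\<^sub>2) (?L f)"
      by (rule continuous_map_eq) (simp add: L_apply)
    moreover have "bproj \<xi>\<^sub>2 (?L f t) = t" if t: "t \<in> topspace T" for t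
      using E2.fiberD(2) [OF mem [OF t E1.bounded_sections_fiber [OF f t]]] t by (simp add: L_apply)
    moreover have "?L f \<in> extensional (topspace T)"
      by (simp add: induced_section_map_def)
    ultimately show ?thesis
      unfolding E2.bounded_sections_iff bundle_sections_def using L_norm_le [OF f] by blast
  qed
  show ?thesis
  proof
    assume surj: "?L ` bounded_sections T \<xi>\<^sub>1 = bounded_sections T \<xi>\<^sub>2"
    show "\<exists>m::real. m > 0 \<and> (\<forall>y\<in>topspace (btotal \<xi>\<^sub>2). \<exists>x\<in>topspace (btotal \<xi>\<^sub>1).
         \<phi> x = y \<and> bnorm \<xi>\<^sub>1 x \<le> m * bnorm \<xi>\<^sub>2 y)"
    \<comment> \<open>The Banach space of bounded sections is set up over a nonempty base; over the
      empty one the bundle space is empty and any constant serves.\<close>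
    proof (cases "topspace T = {}")
      case True
      then have "topspace (btotal \<xi>\<^sub>2) = {}" using E2.proj_surj by simp
      then show ?thesis by (intro exI [of _ 1]) simp
    next
      case False
      have L_add: "?L (E1.section_add f g) = E2.section_add (?L f) (?L g)"
        if "f \<in> bounded_sections T \<xi>\<^sub>1" "g \<in> bounded_sections T \<xi>\<^sub>1" for f g
        using that by (auto simp: fun_eq_iff induced_section_map_def E1.section_add_def E2.section_add_def
            M.map_add E1.bounded_sections_fiber)
      have L_scale: "?L (E1.section_scale c f) = E2.section_scale c (?L f)"
        if "f \<in> bounded_sections T \<xi>\<^sub>1" for c f
        using that by (auto simp: fun_eq_iff induced_section_map_def E1.section_scale_def E2.section_scale_def
            M.map_scale E1.bounded_sections_fiber)
      have L_norm: "E2.section_norm (?L f) \<le> K * E1.section_norm f" if f: "f \<in> bounded_sections T \<xi>\<^sub>1" for f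
        using L_norm_le [OF f] by (rule E2.section_norm_le [OF False])
      obtain M where M: "M > 0" "\<And>g. g \<in> bounded_sections T \<xi>\<^sub>2 \<Longrightarrow>
          \<exists>f\<in>bounded_sections T \<xi>\<^sub>1. ?L f = g \<and> E1.section_norm f \<le> M * E2.section_norm g"
        using open_mapping_banach_space_on [where L = ?L and K = K, OF E1.bounded_sections_banach [OF False]
            E2.bounded_sections_banach [OF False] L_add L_scale surj L_norm] by blast
      \<comment> \<open>\<open>M\<close> is the price of lifting a section, the factor 2 that of a
        section through \<open>y\<close>; any factor above 1 would serve.\<close>
      have "\<exists>x\<in>topspace (btotal \<xi>\<^sub>1). \<phi> x = y \<and> bnorm \<xi>\<^sub>1 x \<le> (2 * M) * bnorm \<xi>\<^sub>2 y"
        if y: "y \<in> topspace (btotal \<xi>\<^sub>2)" for y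
      proof -
        define t where "t = bproj \<xi>\<^sub>2 y"
        have t: "t \<in> topspace T" and yt: "y \<in> fiber \<xi>\<^sub>2 t"
          unfolding t_def using y E2.proj_topspace E2.mem_fiber_proj by blast+
        interpret B1: banach_space_on "fiber \<xi>\<^sub>1 t" "badd \<xi>\<^sub>1" "bscale \<xi>\<^sub>1" "bzero \<xi>\<^sub>1 t" "bnorm \<xi>\<^sub>1"
          using t by (rule E1.fiber_banach)
        interpret B2: banach_space_on "fiber \<xi>\<^sub>2 t" "badd \<xi>\<^sub>2" "bscale \<xi>\<^sub>2" "bzero \<xi>\<^sub>2 t" "bnorm \<xi>\<^sub>2"
          using t by (rule E2.fiber_banach)
        show ?thesis
        \<comment> \<open>Twice the norm of \<open>y\<close> exceeds that norm only if it is
          positive; a zero vector is lifted to a zero vector.\<close>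
        proof (cases "bnorm \<xi>\<^sub>2 y = 0")
          case True
          then have "y = bzero \<xi>\<^sub>2 t" using B2.norm_eq_zero [OF yt] by simp
          moreover have "\<phi> (bzero \<xi>\<^sub>1 t) = bzero \<xi>\<^sub>2 t"
            using M.map_scale [OF t B1.zero_closed, of 0] mem [OF t B1.zero_closed] by simp
          ultimately show ?thesis
            using E1.fiberD(1) [OF B1.zero_closed] by (intro bexI [of _ "bzero \<xi>\<^sub>1 t"]) auto
        next
          case False
          then have pos: "bnorm \<xi>\<^sub>2 y < 2 * bnorm \<xi>\<^sub>2 y"
            using B2.norm_nonneg [OF yt] by simp
          obtain g where g: "g \<in> bounded_sections T \<xi>\<^sub>2" "g t = y"
            "\<And>t. t \<in> topspace T \<Longrightarrow> bnorm \<xi>\<^sub>2 (g t) \<le> 2 * bnorm \<xi>\<^sub>2 y"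
            using E2.bounded_section_through [OF T y pos] unfolding t_def by blast
          obtain f where f: "f \<in> bounded_sections T \<xi>\<^sub>1" "?L f = g"
            "E1.section_norm f \<le> M * E2.section_norm g"
            using M(2) [OF g(1)] by blast
          have "bnorm \<xi>\<^sub>1 (f t) \<le> M * E2.section_norm g"
            using E1.norm_le_section_norm [OF f(1) t] f(3) by linarith
          also have "\<dots> \<le> M * (2 * bnorm \<xi>\<^sub>2 y)"
            using M(1) E2.section_norm_le [OF \<open>topspace T \<noteq> {}\<close> g(3)] by simp
          finally have "bnorm \<xi>\<^sub>1 (f t) \<le> (2 * M) * bnorm \<xi>\<^sub>2 y" by (simp add: mult_ac)
          moreover have "\<phi> (f t) = y"
            using L_apply [OF t, of f] f(2) g(2) by simp
          ultimately show ?thesis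
            using E1.fiberD(1) [OF E1.bounded_sections_fiber [OF f(1) t]] by blast
        qed
      qed
      then show ?thesis using M(1) by (intro exI [of _ "2 * M"]) auto
    qed
  next
    assume "\<exists>m::real. m > 0 \<and> (\<forall>y\<in>topspace (btotal \<xi>\<^sub>2). \<exists>x\<in>topspace (btotal \<xi>\<^sub>1).
         \<phi> x = y \<and> bnorm \<xi>\<^sub>1 x \<le> m * bnorm \<xi>\<^sub>2 y)"
    then obtain m where m: "m > 0" and lift: "\<And>y. y \<in> topspace (btotal \<xi>\<^sub>2) \<Longrightarrow>
        \<exists>x\<in>topspace (btotal \<xi>\<^sub>1). \<phi> x = y \<and> bnorm \<xi>\<^sub>1 x \<le> m * bnorm \<xi>\<^sub>2 y"
      by blast
    have lift_fiber: "\<exists>x\<in>fiber \<xi>\<^sub>1 t. \<phi> x = y \<and> bnorm \<xi>\<^sub>1 x \<le> m * bnorm \<xi>\<^sub>2 y" if y: "y \<in> fiber \<xi>\<^sub>2 t" for y t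
      using lift [OF E2.fiberD(1) [OF y]] y fiber_preimage by blast
    have "g \<in> ?L ` bounded_sections T \<xi>\<^sub>1" if g: "g \<in> bounded_sections T \<xi>\<^sub>2" for g
    proof -
      have gfib: "g t \<in> fiber \<xi>\<^sub>2 t" if "t \<in> topspace T" for t
        by (rule E2.bounded_sections_fiber [OF g that])
      have g_cont: "continuous_map T (btotal \<xi>\<^sub>2) g"
        using g by (simp add: bounded_sections_def bundle_sections_def)
      \<comment> \<open>Each \<open>g t\<close> has a lift of norm at most
        \<open>m * E2.section_norm g\<close>; the added 1 makes the bound strict and the norm
        constraint an open condition.\<close>
      define c where "c = m * E2.section_norm g + 1"
      define \<Phi> where "\<Phi> t = {x \<in> fiber \<xi>\<^sub>1 t. bnorm \<xi>\<^sub>1 x < c} \<inter> {x \<in> fiber \<xi>\<^sub>1 t. \<phi> x = g t}" for t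
      have ne: "\<Phi> t \<noteq> {}" if t: "t \<in> topspace T" for t
      proof -
        obtain x where x: "x \<in> fiber \<xi>\<^sub>1 t" "\<phi> x = g t" "bnorm \<xi>\<^sub>1 x \<le> m * bnorm \<xi>\<^sub>2 (g t)"
          using lift_fiber [OF gfib [OF t]] by blast
        moreover have "m * bnorm \<xi>\<^sub>2 (g t) \<le> m * E2.section_norm g"
          using m E2.norm_le_section_norm [OF g t] by simp
        ultimately have "x \<in> \<Phi> t" by (simp add: \<Phi>_def c_def)
        then show ?thesis by blast
      qed
      have convex: "E1.fiber_convex t (\<Phi> t)" if t: "t \<in> topspace T" for t
      proof -
        interpret B1: banach_space_on "fiber \<xi>\<^sub>1 t" "badd \<xi>\<^sub>1" "bscale \<xi>\<^sub>1" "bzero \<xi>\<^sub>1 t" "bnorm \<xi>\<^sub>1"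
          using t by (rule E1.fiber_banach)
        interpret B2: banach_space_on "fiber \<xi>\<^sub>2 t" "badd \<xi>\<^sub>2" "bscale \<xi>\<^sub>2" "bzero \<xi>\<^sub>2 t" "bnorm \<xi>\<^sub>2"
          using t by (rule E2.fiber_banach)
        have "B1.convex_in {x \<in> fiber \<xi>\<^sub>1 t. \<phi> x = g t}"
          unfolding B1.convex_in_def
        proof (intro conjI ballI allI impI)
          fix x z and u v :: real
          assume *: "x \<in> {x \<in> fiber \<xi>\<^sub>1 t. \<phi> x = g t}" "z \<in> {x \<in> fiber \<xi>\<^sub>1 t. \<phi> x = g t}" "0 \<le> u" "0 \<le> v" "u + v = 1"
          have "\<phi> (badd \<xi>\<^sub>1 (bscale \<xi>\<^sub>1 (of_real u) x) (bscale \<xi>\<^sub>1 (of_real v) z)) =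
              badd \<xi>\<^sub>2 (bscale \<xi>\<^sub>2 (of_real u) (g t)) (bscale \<xi>\<^sub>2 (of_real v) (g t))"
            using * t by (simp add: M.map_add M.map_scale)
          also have "\<dots> = g t"
            using gfib [OF t] *(5) by (simp add: B2.scale_one flip: B2.scale_add_left of_real_add)
          finally show "badd \<xi>\<^sub>1 (bscale \<xi>\<^sub>1 (of_real u) x) (bscale \<xi>\<^sub>1 (of_real v) z) \<in> {x \<in> fiber \<xi>\<^sub>1 t. \<phi> x = g t}"
            using * by simp
        qed auto
        then show ?thesis
          unfolding \<Phi>_def by (intro B1.convex_in_Int B1.convex_in_ball)
      qed
      have lsc: "E1.fiberwise_lsc \<Phi>"
        unfolding E1.fiberwise_lsc_def
      proof (intro allI impI)
        fix U assume U: "openin (btotal \<xi>\<^sub>1) U"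
        \<comment> \<open>Upper semicontinuity of the norm lets the open set absorb the constraint
          \<open>bnorm < c\<close>, so that only the equation \<open>\<phi> x = g t\<close> remains
          to be met.\<close>
        define U\<^sub>c where "U\<^sub>c = U \<inter> {x \<in> topspace (btotal \<xi>\<^sub>1). bnorm \<xi>\<^sub>1 x < c}"
        have Uc: "openin (btotal \<xi>\<^sub>1) U\<^sub>c"
          unfolding U\<^sub>c_def using U E1.norm_upper_semicontinuous by blast
        have "\<forall>\<^sub>F t in nhdsin T s. t \<in> {t \<in> topspace T. \<Phi> t \<inter> U \<noteq> {}}"
          if s: "s \<in> topspace T" and meets: "\<Phi> s \<inter> U \<noteq> {}" for s
        proof -
          obtain x where x: "x \<in> fiber \<xi>\<^sub>1 s" "bnorm \<xi>\<^sub>1 x < c" "\<phi> x = g s" "x \<in> U"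
            using meets by (auto simp: \<Phi>_def)
          then have xUc: "x \<in> U\<^sub>c" using E1.fiberD(1) [OF x(1)] by (simp add: U\<^sub>c_def)
          obtain U' \<delta> where U': "openin (btotal \<xi>\<^sub>1) U'" "x \<in> U'" "\<delta> > 0"
            "\<And>u w. \<lbrakk>u \<in> U'; w \<in> fiber \<xi>\<^sub>1 (bproj \<xi>\<^sub>1 u); bnorm \<xi>\<^sub>1 (E1.bdiff w u) < \<delta>\<rbrakk> \<Longrightarrow> w \<in> U\<^sub>c"
            using E1.nbhd_norm_uniform [OF Uc xUc] by blast
          \<comment> \<open>Lifting a correction costs a factor \<open>m\<close>, hence the width of
            the thin set.\<close>
          have "\<delta> / m > 0" using U'(3) m by simp
          then obtain V where V: "openin (btotal \<xi>\<^sub>2) V" "g s \<in> V"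
            "\<And>u w. \<lbrakk>u \<in> V; w \<in> V; bproj \<xi>\<^sub>2 u = bproj \<xi>\<^sub>2 w\<rbrakk> \<Longrightarrow> bnorm \<xi>\<^sub>2 (E2.bdiff u w) < \<delta> / m"
            using E2.thin_nbhd [OF E2.fiberD(1) [OF gfib [OF s]], of "\<delta> / m"] by blast
          \<comment> \<open>Points \<open>u\<close> near \<open>x\<close> whose image lies in the
            thin set \<open>V\<close>. As the projection is open, they occur over all
            \<open>t\<close> near \<open>s\<close>, where \<open>g t\<close> lies in
            \<open>V\<close> as well.\<close>
          define P where "P = U' \<inter> {u \<in> topspace (btotal \<xi>\<^sub>1). \<phi> u \<in> V}"
          have "openin (btotal \<xi>\<^sub>1) P"
            unfolding P_def using U'(1) openin_continuous_map_preimage [OF M.map_continuous V(1)] by blast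
          then have "openin T (bproj \<xi>\<^sub>1 ` P)" by (rule E1.openin_proj_image)
          moreover have "s \<in> bproj \<xi>\<^sub>1 ` P"
            using x U'(2) V(2) E1.fiberD [OF x(1)] by (intro image_eqI [of _ _ x]) (auto simp: P_def)
          ultimately have "\<forall>\<^sub>F t in nhdsin T s. t \<in> bproj \<xi>\<^sub>1 ` P"
            by (rule eventually_nhdsin_openin)
          moreover have "\<forall>\<^sub>F t in nhdsin T s. t \<in> {t \<in> topspace T. g t \<in> V}"
            using openin_continuous_map_preimage [OF g_cont V(1)] s V(2)
            by (intro eventually_nhdsin_openin) auto
          ultimately show ?thesis
          proof eventually_elim
            case (elim t)
            then have t: "t \<in> topspace T" and gV: "g t \<in> V" by auto
            obtain u where u: "u \<in> U'" "u \<in> topspace (btotal \<xi>\<^sub>1)" "\<phi> u \<in> V" "t = bproj \<xi>\<^sub>1 u"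
              using elim(1) by (auto simp: P_def)
            then have ut: "u \<in> fiber \<xi>\<^sub>1 t" by (simp add: E1.mem_fiber_proj)
            interpret B1: banach_space_on "fiber \<xi>\<^sub>1 t" "badd \<xi>\<^sub>1" "bscale \<xi>\<^sub>1" "bzero \<xi>\<^sub>1 t" "bnorm \<xi>\<^sub>1"
              using t by (rule E1.fiber_banach)
            interpret B2: banach_space_on "fiber \<xi>\<^sub>2 t" "badd \<xi>\<^sub>2" "bscale \<xi>\<^sub>2" "bzero \<xi>\<^sub>2 t" "bnorm \<xi>\<^sub>2"
              using t by (rule E2.fiber_banach)
            have \<phi>u: "\<phi> u \<in> fiber \<xi>\<^sub>2 t" by (rule mem [OF t ut])
            then have "bnorm \<xi>\<^sub>2 (E2.bdiff (g t) (\<phi> u)) < \<delta> / m"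
              using V(3) [OF gV u(3)] E2.fiberD(2) [OF gfib [OF t]] E2.fiberD(2) [OF \<phi>u] by simp
            then have small: "m * bnorm \<xi>\<^sub>2 (E2.bdiff (g t) (\<phi> u)) < \<delta>"
              using m by (simp add: field_simps)
            \<comment> \<open>\<open>z\<close> lifts the discrepancy between \<open>g t\<close> and
              \<open>\<phi> u\<close>, so that \<open>u + z\<close> is an exact lift of
              \<open>g t\<close> within \<delta> of \<open>u\<close>.\<close>
            obtain z where z: "z \<in> fiber \<xi>\<^sub>1 t" "\<phi> z = E2.bdiff (g t) (\<phi> u)"
              "bnorm \<xi>\<^sub>1 z \<le> m * bnorm \<xi>\<^sub>2 (E2.bdiff (g t) (\<phi> u))"
              using lift_fiber [OF B2.diff_closed [OF gfib [OF t] \<phi>u]] by blast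
            define w where "w = badd \<xi>\<^sub>1 u z"
            have w: "w \<in> fiber \<xi>\<^sub>1 t" using ut z(1) by (simp add: w_def)
            have "bnorm \<xi>\<^sub>1 (E1.bdiff w u) < \<delta>"
              using z(3) small B1.add_diff_cancel [OF z(1) ut] by (simp add: w_def)
            then have "w \<in> U\<^sub>c"
              using U'(4) [OF u(1)] w u(4) by simp
            moreover have "\<phi> w = g t"
              using M.map_add [OF t ut z(1)] z(2) B2.add_commute [OF \<phi>u, of "E2.bdiff (g t) (\<phi> u)"] gfib [OF t] \<phi>u
              by (simp add: w_def)
            ultimately have "w \<in> \<Phi> t \<inter> U" using w by (simp add: \<Phi>_def U\<^sub>c_def)
            with t show ?case by blast
          qed
        qed
        then show "openin T {t \<in> topspace T. \<Phi> t \<inter> U \<noteq> {}}"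
          by (intro openin_eventually_nhdsin) auto
      qed
      obtain f where f: "f \<in> bundle_sections T \<xi>\<^sub>1"
        and near: "\<And>t e. \<lbrakk>t \<in> topspace T; e > 0\<rbrakk> \<Longrightarrow> \<exists>x\<in>\<Phi> t. bnorm \<xi>\<^sub>1 (E1.bdiff (f t) x) < e"
        using E1.continuous_selection [where \<Phi> = \<Phi>, OF T convex lsc ne] by blast
      have fib: "f t \<in> fiber \<xi>\<^sub>1 t" if "t \<in> topspace T" for t
        using f that by (simp add: E1.bundle_sections_iff)
      have "bnorm \<xi>\<^sub>1 (f t) \<le> c + 1 \<and> \<phi> (f t) = g t" if t: "t \<in> topspace T" for t
      proof
        interpret B1: banach_space_on "fiber \<xi>\<^sub>1 t" "badd \<xi>\<^sub>1" "bscale \<xi>\<^sub>1" "bzero \<xi>\<^sub>1 t" "bnorm \<xi>\<^sub>1"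
          using t by (rule E1.fiber_banach)
        interpret B2: banach_space_on "fiber \<xi>\<^sub>2 t" "badd \<xi>\<^sub>2" "bscale \<xi>\<^sub>2" "bzero \<xi>\<^sub>2 t" "bnorm \<xi>\<^sub>2"
          using t by (rule E2.fiber_banach)
        have \<Phi>: "x \<in> fiber \<xi>\<^sub>1 t \<and> bnorm \<xi>\<^sub>1 x < c \<and> \<phi> x = g t" if "x \<in> \<Phi> t" for x
          using that by (simp add: \<Phi>_def)
        obtain x where "x \<in> \<Phi> t" "bnorm \<xi>\<^sub>1 (E1.bdiff (f t) x) < 1"
          using near [OF t, of 1] by auto
        then show "bnorm \<xi>\<^sub>1 (f t) \<le> c + 1"
          using B1.norm_le_diff [OF fib [OF t], of x] \<Phi> [of x] by linarith
        \<comment> \<open>The selection lies only in the norm closure of \<open>\<Phi> t\<close>,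
          but boundedness of \<phi> makes the solution set of \<open>\<phi> x = g t\<close> closed
          in the fiber.\<close>
        have "bnorm \<xi>\<^sub>2 (E2.bdiff (\<phi> (f t)) (g t)) \<le> 0"
        proof (rule field_le_epsilon)
          fix e :: real assume e: "e > 0"
          \<comment> \<open>\<open>K + 1\<close> stands in the denominator because \<open>K\<close>
            may be 0.\<close>
          then have "e / (K + 1) > 0" using K(1) by simp
          then obtain x where x: "x \<in> \<Phi> t" "bnorm \<xi>\<^sub>1 (E1.bdiff (f t) x) < e / (K + 1)"
            using near [OF t] by blast
          have xt: "x \<in> fiber \<xi>\<^sub>1 t" "\<phi> x = g t" using \<Phi> [OF x(1)] by simp_all
          have d: "E1.bdiff (f t) x \<in> fiber \<xi>\<^sub>1 t" using fib [OF t] xt by simp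
          have "bnorm \<xi>\<^sub>2 (E2.bdiff (\<phi> (f t)) (g t)) \<le> K * bnorm \<xi>\<^sub>1 (E1.bdiff (f t) x)"
            using K(2) [OF E1.fiberD(1) [OF d]] map_diff [OF t fib [OF t] xt(1)] xt(2) by simp
          also have "\<dots> \<le> (K + 1) * bnorm \<xi>\<^sub>1 (E1.bdiff (f t) x)"
            using B1.norm_nonneg [OF d] by (intro mult_right_mono) auto
          also have "\<dots> \<le> e"
            using x(2) K(1) by (simp add: field_simps)
          finally show "bnorm \<xi>\<^sub>2 (E2.bdiff (\<phi> (f t)) (g t)) \<le> 0 + e" by simp
        qed
        then show "\<phi> (f t) = g t"
          by (rule B2.norm_diff_le_zero [OF mem [OF t fib [OF t]] gfib [OF t]])
      qed
      then have fb: "f \<in> bounded_sections T \<xi>\<^sub>1" and fg: "\<And>t. t \<in> topspace T \<Longrightarrow> \<phi> (f t) = g t"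
        using f by (auto simp: E1.bounded_sections_iff)
      have "g = ?L f"
        by (rule extensionalityI [OF E2.bounded_sections_extensional [OF g] E2.bounded_sections_extensional [OF L_bounded [OF fb]]])
           (simp add: L_apply fg)
      with fb show ?thesis by blast
    qed
    with L_bounded show "?L ` bounded_sections T \<xi>\<^sub>1 = bounded_sections T \<xi>\<^sub>2" by blast
  qed
qed

end
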